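(* Let $1<\alpha<2$, let $P=(P_t)_{t\ge0}$ be the contraction $\mathcal C_0$-semigroup on $L^2(\mathbb R_+)$ of the spectrally negative $\alpha$-stable process reflected at its infimum (defined in the context), and let $\widehat P_t$ be the $L^2(\mathbb R_+)$-adjoint of $P_t$. Then for each $t>0$, $$S_p(\widehat P_t)=\emptyset\qquad\text{and}\qquad(e^{-q^\alpha t})_{q>0}\subseteq S_r(\widehat P_t)=S_p(P_t),$$ where $S_p$ and $S_r$ denote the point spectrum and the residual spectrum, respectively.
   Context: $\mathbb R_+=(0,\infty)$ and $L^2(\mathbb R_+)$ is with respect to Lebesgue measure (complexified when speaking about spectra). Semigroup. Let $Z$ be the spectrally negative $\alpha$-stable Lévy process (no positive jumps) with $\mathbb E[e^{zZ_t}]=e^{tz^\alpha}$ for $\Re z\ge0$, and let $X$ be $Z$ started from $x\ge0$ and reflected at its infimum: $X_t=Z_t$ for $t<T$ and $X_t=Z_t-\inf_{s\le t}Z_s$ for $t\ge T$, where $T=\inf\{t>0: Z_t\le0\}$. Put $P_tf(x)=\mathbb E_x[f(X_t)]$. This Feller semigroup extends uniquely to a contraction $\mathcal C_0$-semigroup on $L^2(\mathbb R_+)$, also denoted $P$. Spectrum. For a bounded operator $\mathrm P$ on $L^2(\mathbb R_+)$ and $\mathfrak z\in\mathbb C$: $\mathfrak z\in S_p(\mathrm P)$ if $\mathrm{Ker}(\mathrm P-\mathfrak zI)\ne\{0\}$; $\mathfrak z\in S_r(\mathrm P)$ if $\mathrm{Ker}(\mathrm P-\mathfrak zI)=\{0\}$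 and $\overline{\mathrm{Ran}}(\mathrm P-\mathfrak zI)\subsetneq L^2(\mathbb R_+)$. *)

theory Defs
  imports "HOL-Probability.Probability"
begin

section \<open>The complex Hilbert space $L^2(0,\infty)$\<close>

abbreviation leb_pos :: "real measure" where
  "leb_pos \<equiv> restrict_space lborel {0<..}"

definition square_integrable :: "(real \<Rightarrow> complex) \<Rightarrow> bool" where
  "square_integrable f \<longleftrightarrow>
     f \<in> borel_measurable leb_pos \<and> integrable leb_pos (\<lambda>x. (cmod (f x))\<^sup>2)"

lemma square_integrable_zero: "square_integrable (\<lambda>x. 0)"
  by (simp add: square_integrable_def)

lemma square_integrable_scale:
  assumes "square_integrable f"
  shows "square_integrable (\<lambda>x. c * f x)"
  using assms by (auto simp: square_integrable_def norm_mult power_mult_distrib)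

lemma square_integrable_add:
  assumes "square_integrable f" "square_integrable g"
  shows "square_integrable (\<lambda>x. f x + g x)"
proof -
  have m: "f \<in> borel_measurable leb_pos" "g \<in> borel_measurable leb_pos"
    and i: "integrable leb_pos (\<lambda>x. (cmod (f x))\<^sup>2)" "integrable leb_pos (\<lambda>x. (cmod (g x))\<^sup>2)"
    using assms by (auto simp: square_integrable_def)
  have bound: "(cmod (a + b))\<^sup>2 \<le> 2 * (cmod a)\<^sup>2 + 2 * (cmod b)\<^sup>2" for a b :: complex
  proof -
    have "(cmod (a + b))\<^sup>2 \<le> (cmod a + cmod b)\<^sup>2"
      by (intro power_mono norm_triangle_ineq) auto
    also have "\<dots> \<le> 2 * (cmod a)\<^sup>2 + 2 * (cmod b)\<^sup>2"
      using sum_squares_bound[of "cmod a" "cmod b"] by (simp add: power2_sum)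
    finally show ?thesis .
  qed
  have "integrable leb_pos (\<lambda>x. (cmod (f x + g x))\<^sup>2)"
    by (rule Bochner_Integration.integrable_bound
          [where f = "\<lambda>x. 2 * (cmod (f x))\<^sup>2 + 2 * (cmod (g x))\<^sup>2"])
       (use i m bound in auto)
  with m show ?thesis by (auto simp: square_integrable_def)
qed

lemma square_integrable_diff:
  assumes "square_integrable f" "square_integrable g"
  shows "square_integrable (\<lambda>x. f x - g x)"
  using square_integrable_add[OF assms(1) square_integrable_scale[OF assms(2), of "-1"]] by simp

lemma square_integrable_mult_cnj:
  assumes "square_integrable f" "square_integrable g"
  shows "integrable leb_pos (\<lambda>x. f x * cnj (g x))"
proof -
  have m: "f \<in> borel_measurable leb_pos" "g \<in> borel_measurable leb_pos"
    and i: "integrable leb_pos (\<lambda>x. (cmod (f x))\<^sup>2)" "integrable leb_pos (\<lambda>x. (cmod (g x))\<^sup>2)"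
    using assms by (auto simp: square_integrable_def)
  have mc: "(\<lambda>x. cnj (g x)) \<in> borel_measurable leb_pos"
    using m(2) by (intro borel_measurable_continuous_on[where f = cnj]) (auto intro: continuous_intros)
  have bound: "a * b \<le> a\<^sup>2 + b\<^sup>2" if "0 \<le> a" "0 \<le> b" for a b :: real
  proof -
    have "2 * a * b \<le> a\<^sup>2 + b\<^sup>2" by (rule sum_squares_bound)
    moreover have "0 \<le> a * b" using that by simp
    ultimately show ?thesis by simp
  qed
  show ?thesis
    by (rule Bochner_Integration.integrable_bound
          [where f = "\<lambda>x. (cmod (f x))\<^sup>2 + (cmod (g x))\<^sup>2"])
       (use i m mc bound in \<open>auto simp: norm_mult\<close>)
qed

definition l2_rel :: "(real \<Rightarrow> complex) \<Rightarrow> (real \<Rightarrow> complex) \<Rightarrow> bool" where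
  "l2_rel f g \<longleftrightarrow>
     square_integrable f \<and> square_integrable g \<and> (AE x in leb_pos. f x = g x)"

lemma part_equivp_l2_rel: "part_equivp l2_rel"
proof (rule part_equivpI)
  show "\<exists>f. l2_rel f f"
    using square_integrable_zero by (auto simp: l2_rel_def)
  show "symp l2_rel"
    by (auto intro!: sympI simp: l2_rel_def elim: eventually_mono)
  show "transp l2_rel"
  proof (rule transpI)
    fix f g h assume a: "l2_rel f g" "l2_rel g h"
    then have "AE x in leb_pos. f x = g x" "AE x in leb_pos. g x = h x"
      by (auto simp: l2_rel_def)
    then have "AE x in leb_pos. f x = h x" by eventually_elim simp
    with a show "l2_rel f h" by (auto simp: l2_rel_def)
  qed
qed

quotient_type l2 = "real \<Rightarrow> complex" / partial: l2_rel
  by (rule part_equivp_l2_rel)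

definition l2_class :: "(real \<Rightarrow> complex) \<Rightarrow> l2 \<Rightarrow> bool" where
  "l2_class f u \<longleftrightarrow> square_integrable f \<and> u = abs_l2 f"

lift_definition l2_scale :: "complex \<Rightarrow> l2 \<Rightarrow> l2" is "\<lambda>c f x. c * f x"
  unfolding l2_rel_def by (auto intro: square_integrable_scale elim: eventually_mono)

lift_definition l2_cinner :: "l2 \<Rightarrow> l2 \<Rightarrow> complex" is
  "\<lambda>f g. (LINT x|leb_pos. f x * cnj (g x))"
proof -
  fix f f' g g' assume a: "l2_rel f f'" "l2_rel g g'"
  then have "AE x in leb_pos. f x = f' x" "AE x in leb_pos. g x = g' x"
    by (auto simp: l2_rel_def)
  then have ae: "AE x in leb_pos. f x * cnj (g x) = f' x * cnj (g' x)" by eventually_elim simp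
  have "integrable leb_pos (\<lambda>x. f x * cnj (g x))" "integrable leb_pos (\<lambda>x. f' x * cnj (g' x))"
    using a by (auto simp: l2_rel_def intro: square_integrable_mult_cnj)
  with ae show "(LINT x|leb_pos. f x * cnj (g x)) = (LINT x|leb_pos. f' x * cnj (g' x))"
    by (intro integral_cong_AE) auto
qed

instantiation l2 :: real_vector
begin

lift_definition zero_l2 :: l2 is "\<lambda>x. 0"
  using square_integrable_zero by (simp add: l2_rel_def)

lift_definition plus_l2 :: "l2 \<Rightarrow> l2 \<Rightarrow> l2" is "\<lambda>f g x. f x + g x"
  unfolding l2_rel_def by (auto intro: square_integrable_add elim: eventually_elim2)

lift_definition minus_l2 :: "l2 \<Rightarrow> l2 \<Rightarrow> l2" is "\<lambda>f g x. f x - g x"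
  unfolding l2_rel_def by (auto intro: square_integrable_diff elim: eventually_elim2)

definition uminus_l2 :: "l2 \<Rightarrow> l2" where
  "uminus_l2 u = l2_scale (- 1) u"

definition scaleR_l2 :: "real \<Rightarrow> l2 \<Rightarrow> l2" where
  "scaleR_l2 r u = l2_scale (complex_of_real r) u"

instance
proof
  fix a b c :: l2 and r s :: real
  show "a + b + c = a + (b + c)"
    by transfer (auto simp: l2_rel_def add.assoc intro!: square_integrable_add)
  show "a + b = b + a"
    by transfer (auto simp: l2_rel_def add.commute intro!: square_integrable_add)
  show "0 + a = a"
    by transfer (auto simp: l2_rel_def)
  show "- a + a = 0"
    unfolding uminus_l2_def
    by transfer (auto simp: l2_rel_def square_integrable_zero)
  show "a - b = a + - b"
    unfolding uminus_l2_def
    by transfer (auto simp: l2_rel_def intro!: square_integrable_diff)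
  show "r *\<^sub>R (a + b) = r *\<^sub>R a + r *\<^sub>R b"
    unfolding scaleR_l2_def
    by transfer (auto simp: l2_rel_def distrib_left distrib_right
        intro!: square_integrable_add square_integrable_scale)
  show "(r + s) *\<^sub>R a = r *\<^sub>R a + s *\<^sub>R a"
    unfolding scaleR_l2_def
    by transfer (auto simp: l2_rel_def distrib_left distrib_right
        intro!: square_integrable_add square_integrable_scale)
  show "r *\<^sub>R s *\<^sub>R a = (r * s) *\<^sub>R a"
    unfolding scaleR_l2_def
    by transfer (auto simp: l2_rel_def mult.assoc intro!: square_integrable_scale)
  show "1 *\<^sub>R a = a"
    unfolding scaleR_l2_def by transfer (auto simp: l2_rel_def)
qed

end

lemma l2_cinner_add_left: "l2_cinner (a + b) c = l2_cinner a c + l2_cinner b c"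
proof (transfer, goal_cases)
  case (1 f g h)
  then have "integrable leb_pos (\<lambda>x. f x * cnj (h x))" "integrable leb_pos (\<lambda>x. g x * cnj (h x))"
    by (auto simp: l2_rel_def intro: square_integrable_mult_cnj)
  then show ?case by (simp add: distrib_right)
qed

lemma l2_cinner_scale_left: "l2_cinner (l2_scale z a) b = z * l2_cinner a b"
  by transfer (simp add: mult.assoc)

lemma l2_cinner_commute: "l2_cinner a b = cnj (l2_cinner b a)"
  by transfer (subst Bochner_Integration.integral_cnj[symmetric], simp add: mult.commute)

lemma Re_l2_cinner_self: "Re (l2_cinner (abs_l2 f) (abs_l2 f)) = (LINT x|leb_pos. (cmod (f x))\<^sup>2)"
  if "square_integrable f"
proof -
  have r: "l2_rel f f" using that by (simp add: l2_rel_def)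
  have "l2_cinner (abs_l2 f) (abs_l2 f) = (LINT x|leb_pos. f x * cnj (f x))"
    using r by (simp add: l2_cinner.abs_eq)
  also have "\<dots> = (LINT x|leb_pos. complex_of_real ((cmod (f x))\<^sup>2))"
    by (simp only: complex_norm_square)
  finally show ?thesis by (simp only: integral_complex_of_real Re_complex_of_real)
qed

lemma l2_cases:
  obtains f where "square_integrable f" "u = abs_l2 f"
  by (metis Quotient3_l2 Quotient3_def l2_rel_def)

lemma l2_cinner_self_nonneg: "0 \<le> Re (l2_cinner a a)"
  by (cases a rule: l2_cases) (simp add: Re_l2_cinner_self)

lemma l2_cinner_self_eq_0: "Re (l2_cinner a a) = 0 \<longleftrightarrow> a = 0"
proof (cases a rule: l2_cases)
  case (1 f)
  then have i: "integrable leb_pos (\<lambda>x. (cmod (f x))\<^sup>2)" by (simp add: square_integrable_def)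
  have "Re (l2_cinner a a) = 0 \<longleftrightarrow> (AE x in leb_pos. f x = 0)"
    using 1 integral_nonneg_eq_0_iff_AE[OF i] by (simp add: Re_l2_cinner_self)
  also have "\<dots> \<longleftrightarrow> l2_rel f (\<lambda>x. 0)"
    using 1 square_integrable_zero by (simp add: l2_rel_def)
  also have "\<dots> \<longleftrightarrow> a = 0"
    using 1 square_integrable_zero Quotient3_rel[OF Quotient3_l2, of f "\<lambda>x. 0"]
    by (simp add: zero_l2_def l2_rel_def)
  finally show ?thesis .
qed

instantiation l2 :: real_inner
begin

definition inner_l2 :: "l2 \<Rightarrow> l2 \<Rightarrow> real" where
  "inner_l2 u v = Re (l2_cinner u v)"

definition norm_l2 :: "l2 \<Rightarrow> real" where
  "norm_l2 u = sqrt (inner u u)"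

definition sgn_l2 :: "l2 \<Rightarrow> l2" where
  "sgn_l2 u = inverse (norm u) *\<^sub>R u"

definition dist_l2 :: "l2 \<Rightarrow> l2 \<Rightarrow> real" where
  "dist_l2 u v = norm (u - v)"

definition uniformity_l2 :: "(l2 \<times> l2) filter" where
  "uniformity_l2 = (INF e\<in>{0<..}. principal {(u, v). dist u v < e})"

definition open_l2 :: "l2 set \<Rightarrow> bool" where
  "open_l2 U \<longleftrightarrow> (\<forall>u\<in>U. eventually (\<lambda>(u', v). u' = u \<longrightarrow> v \<in> U) uniformity)"

instance
proof
  fix a b c :: l2 and r :: real
  show "inner a b = inner b a"
    unfolding inner_l2_def by (subst l2_cinner_commute) simp
  show "inner (a + b) c = inner a c + inner b c"
    by (simp add: inner_l2_def l2_cinner_add_left)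
  show "inner (r *\<^sub>R a) b = r * inner a b"
    by (simp add: inner_l2_def scaleR_l2_def l2_cinner_scale_left)
  show "0 \<le> inner a a"
    by (simp add: inner_l2_def l2_cinner_self_nonneg)
  show "inner a a = 0 \<longleftrightarrow> a = 0"
    by (simp add: inner_l2_def l2_cinner_self_eq_0)
qed (auto simp: norm_l2_def sgn_l2_def dist_l2_def uniformity_l2_def open_l2_def)

end


section \<open>Operators, adjoints and spectra\<close>

definition bounded_operator :: "(l2 \<Rightarrow> l2) \<Rightarrow> bool" where
  "bounded_operator A \<longleftrightarrow>
     bounded_linear A \<and> (\<forall>c u. A (l2_scale c u) = l2_scale c (A u))"

definition is_adjoint :: "(l2 \<Rightarrow> l2) \<Rightarrow> (l2 \<Rightarrow> l2) \<Rightarrow> bool" where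
  "is_adjoint A B \<longleftrightarrow> (\<forall>u v. l2_cinner (A u) v = l2_cinner u (B v))"

definition op_kernel :: "(l2 \<Rightarrow> l2) \<Rightarrow> l2 set" where
  "op_kernel A = {u. A u = 0}"

definition point_spectrum :: "(l2 \<Rightarrow> l2) \<Rightarrow> complex set" where
  "point_spectrum A = {z. op_kernel (\<lambda>u. A u - l2_scale z u) \<noteq> {0}}"

definition residual_spectrum :: "(l2 \<Rightarrow> l2) \<Rightarrow> complex set" where
  "residual_spectrum A =
     {z. op_kernel (\<lambda>u. A u - l2_scale z u) = {0} \<and>
         closure (range (\<lambda>u. A u - l2_scale z u)) \<subset> UNIV}"

definition contraction_C0_semigroup :: "(real \<Rightarrow> l2 \<Rightarrow> l2) \<Rightarrow> bool" where
  "contraction_C0_semigroup P \<longleftrightarrow>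
     (\<forall>t\<ge>0. bounded_operator (P t) \<and> (\<forall>u. norm (P t u) \<le> norm u)) \<and>
     P 0 = id \<and>
     (\<forall>s\<ge>0. \<forall>t\<ge>0. P (s + t) = P s \<circ> P t) \<and>
     (\<forall>u. ((\<lambda>t. P t u) \<longlongrightarrow> u) (at_right 0))"


section \<open>The stable process and its reflection at the infimum\<close>

text \<open>Time is the half-line $[0,\infty)$; the values of a process at negative times are
  irrelevant.\<close>

definition levy_process :: "'a measure \<Rightarrow> (real \<Rightarrow> 'a \<Rightarrow> real) \<Rightarrow> bool" where
  "levy_process M Z \<longleftrightarrow>
     prob_space M \<and>
     (\<forall>t\<ge>0. Z t \<in> borel_measurable M) \<and>
     (\<forall>\<omega>\<in>space M. Z 0 \<omega> = 0) \<and>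
     (\<forall>\<omega>\<in>space M. \<forall>t\<ge>0. continuous (at_right t) (\<lambda>s. Z s \<omega>)) \<and>
     (\<forall>\<omega>\<in>space M. \<forall>t>0. \<exists>l. ((\<lambda>s. Z s \<omega>) \<longlongrightarrow> l) (at_left t)) \<and>
     (\<forall>s\<ge>0. \<forall>t\<ge>0. distr M borel (\<lambda>\<omega>. Z (s + t) \<omega> - Z s \<omega>) = distr M borel (Z t)) \<and>
     (\<forall>n. \<forall>\<tau> :: nat \<Rightarrow> real. 0 \<le> \<tau> 0 \<and> mono \<tau> \<longrightarrow>
        prob_space.indep_vars M (\<lambda>_. borel) (\<lambda>i \<omega>. Z (\<tau> (Suc i)) \<omega> - Z (\<tau> i) \<omega>) {..<n})"

text \<open>The Laplace transform needs no integrability side condition: the Bochner integral of a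
  non-integrable function is $0$, whereas the right-hand side never vanishes. The complex power
  is the principal branch, with \<open>0 powr a = 0\<close>.\<close>

definition spectrally_negative_stable ::
    "'a measure \<Rightarrow> real \<Rightarrow> (real \<Rightarrow> 'a \<Rightarrow> real) \<Rightarrow> bool" where
  "spectrally_negative_stable M \<alpha> Z \<longleftrightarrow>
     levy_process M Z \<and>
     (\<forall>\<omega>\<in>space M. \<forall>t>0. Z t \<omega> \<le> Lim (at_left t) (\<lambda>s. Z s \<omega>)) \<and>
     (\<forall>t\<ge>0. \<forall>z. 0 \<le> Re z \<longrightarrow>
        (LINT \<omega>|M. exp (z * complex_of_real (Z t \<omega>))) =
          exp (complex_of_real t * z powr complex_of_real \<alpha>))"

text \<open>The infimum is taken in the extended reals, so \<open>passage_time w = \<infinity>\<close> if the path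
  stays positive.\<close>

definition passage_time :: "(real \<Rightarrow> real) \<Rightarrow> ereal" where
  "passage_time w = Inf (ereal ` {t. 0 < t \<and> w t \<le> 0})"

definition reflected_path :: "(real \<Rightarrow> real) \<Rightarrow> real \<Rightarrow> real" where
  "reflected_path w t =
     (if ereal t < passage_time w then w t else w t - (INF s\<in>{0..t}. w s))"

definition reflected_process :: "(real \<Rightarrow> 'a \<Rightarrow> real) \<Rightarrow> real \<Rightarrow> real \<Rightarrow> 'a \<Rightarrow> real" where
  "reflected_process Z x t \<omega> = reflected_path (\<lambda>s. x + Z s \<omega>) t"

definition transition_op ::
    "'a measure \<Rightarrow> (real \<Rightarrow> 'a \<Rightarrow> real) \<Rightarrow> real \<Rightarrow> (real \<Rightarrow> complex) \<Rightarrow> real \<Rightarrow> complex" where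
  "transition_op M Z t f x = (LINT \<omega>|M. f (reflected_process Z x t \<omega>))"

text \<open>The extension property is imposed on the functions in $C_0([0,\infty)) \cap L^2(0,\infty)$.
  These are dense in $L^2(0,\infty)$, so at most one contraction semigroup satisfies it.\<close>

definition reflected_L2_semigroup ::
    "'a measure \<Rightarrow> (real \<Rightarrow> 'a \<Rightarrow> real) \<Rightarrow> (real \<Rightarrow> l2 \<Rightarrow> l2) \<Rightarrow> bool" where
  "reflected_L2_semigroup M Z P \<longleftrightarrow>
     contraction_C0_semigroup P \<and>
     (\<forall>t\<ge>0. \<forall>f u. continuous_on {0..} f \<and> (f \<longlongrightarrow> 0) at_top \<and> l2_class f u \<longrightarrow>
        l2_class (transition_op M Z t f) (P t u))"

end

theory Submission
  imports Defs "HOL-Complex_Analysis.Complex_Analysis"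
begin

text \<open>The eigenfunctions carry everything. Let \<open>J(x) = E\<^sub>\<alpha>(- x\<^sup>\<alpha>)\<close>, where \<open>E\<^sub>\<alpha>\<close> is the Mittag-Leffler function. The generator
  of the reflected process is the Caputo derivative of order \<open>\<alpha>\<close>, and the dilations \<open>J\<^sub>q(x) = J(q x)\<close> satisfy
  \<open>P\<^sub>t J\<^sub>q = exp (- q\<^sup>\<alpha> t) J\<^sub>q\<close> (\<open>semigroup_eigenvector\<close>). They belong to \<open>L\<^sup>2\<close> and are total there
  (\<open>mittag_leffler_complete\<close>). The rest is linear algebra. An eigenvector of the adjoint is orthogonal to every
  \<open>J\<^sub>q\<close> but possibly one, since the eigenvalues of \<open>P\<^sub>t\<close> at the \<open>J\<^sub>q\<close> are distinct; hence it is zero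
  (\<open>adjoint_no_eigenvector\<close>). Therefore \<open>z\<close> lies in the residual spectrum of the adjoint exactly if the range of the
  adjoint minus \<open>z\<close> is not dense, that is, if the conjugate of \<open>z\<close> is an eigenvalue of \<open>P\<^sub>t\<close> (\<open>range_not_dense_iff\<close>).
  The eigenvalues of \<open>P\<^sub>t\<close> are closed under conjugation, because \<open>P\<^sub>t\<close> commutes with complex conjugation
  (\<open>semigroup_conj\<close>).

  \<^bold>\<open>The function.\<close> The Laplace transform of \<open>J\<close> is \<open>w powr (\<alpha> - 1) / (w powr \<alpha> + 1)\<close>. It is holomorphic in the right half-plane and
  continuous up to the imaginary axis, where its real part is integrable. Defining \<open>J\<close> as the cosine transform of this
  real part makes it bounded, Lipschitz and of order \<open>1 / x\<close> by elementary estimates, and Poisson's formula for the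
  half-plane gives back the Laplace transform (\<open>laplace_mittag_leffler\<close>).

  \<^bold>\<open>Totality.\<close> If \<open>g\<close> is orthogonal to all \<open>J\<^sub>q\<close>, a Laplace transform in \<open>q\<close> shows that the integral of
  \<open>g(x) / (\<mu> + x\<^sup>\<alpha>)\<close> vanishes for all \<open>\<mu> > 0\<close>. By partial fractions all moments with respect to \<open>1 / (1 + x\<^sup>\<alpha>)\<close> vanish,
  and the Weierstrass theorem gives \<open>g = 0\<close>.

  \<^bold>\<open>The eigenvalue equation.\<close> It is the limit of a discrete computation. On a grid of mesh
  \<open>h\<close> the process reflected at its infimum is approximated by the Lindley chain \<open>W \<mapsto> max 0 (W + \<xi>)\<close> driven by the
  increments of \<open>Z\<close>; right continuity of the paths gives convergence. After a Laplace transform with parameter \<open>\<beta>\<close> in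
  the starting point, one step of the chain multiplies \<open>f - f 0\<close> by \<open>exp (h \<beta>\<^sup>\<alpha>)\<close>, up to an error that comes only from
  upward increments. For Lipschitz \<open>f\<close> this error is quadratic in the increment, so it is of order \<open>h powr (2 / \<alpha>) = o(h)\<close>,
  because \<open>\<alpha> < 2\<close>. Summing the steps yields an identity for the Laplace transform of \<open>u\<^sub>t(x) = E\<^sub>x f(X\<^sub>t)\<close> that contains
  only the initial function and the boundary values \<open>u\<^sub>s(0)\<close> (\<open>laplace_reflected_mean\<close>). Letting \<open>t\<close> tend to infinity
  identifies the boundary values, and then the identity identifies \<open>u\<^sub>t\<close>.\<close>

section \<open>Integration over the half-line\<close>

lemma borel_measurable_leb_pos:
  "f \<in> borel_measurable borel \<Longrightarrow> f \<in> borel_measurable leb_pos"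
  by (rule measurable_restrict_space1) simp

lemma borel_measurable_leb_pos_pair:
  assumes "f \<in> borel_measurable (borel \<Otimes>\<^sub>M borel)"
  shows "f \<in> borel_measurable (leb_pos \<Otimes>\<^sub>M leb_pos)"
proof (rule measurable_compose[OF _ assms, of "\<lambda>x. x", simplified])
  have "fst \<in> borel_measurable (leb_pos \<Otimes>\<^sub>M leb_pos)" "snd \<in> borel_measurable (leb_pos \<Otimes>\<^sub>M leb_pos)"
    by (rule measurable_compose[OF measurable_fst borel_measurable_leb_pos[of "\<lambda>x. x"]]
        measurable_compose[OF measurable_snd borel_measurable_leb_pos[of "\<lambda>x. x"]]; simp)+
  then show "(\<lambda>x. x) \<in> leb_pos \<Otimes>\<^sub>M leb_pos \<rightarrow>\<^sub>M borel \<Otimes>\<^sub>M borel"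
    by (subst measurable_pair_iff) (simp add: comp_def)
qed

lemma borel_measurable_leb_pos_pair_sets:
  assumes "sets N = sets (borel :: real measure)" "f \<in> borel_measurable (borel \<Otimes>\<^sub>M borel)"
  shows "f \<in> borel_measurable (leb_pos \<Otimes>\<^sub>M N)"
proof (rule measurable_compose[OF _ assms(2), of "\<lambda>x. x", simplified])
  have "fst \<in> borel_measurable (leb_pos \<Otimes>\<^sub>M N)"
    by (rule measurable_compose[OF measurable_fst borel_measurable_leb_pos[of "\<lambda>x. x"]]) simp
  moreover have "snd \<in> borel_measurable (leb_pos \<Otimes>\<^sub>M N)"
    using measurable_snd[of leb_pos N] by (simp add: measurable_cong_sets[OF refl assms(1)])
  ultimately show "(\<lambda>x. x) \<in> leb_pos \<Otimes>\<^sub>M N \<rightarrow>\<^sub>M borel \<Otimes>\<^sub>M borel"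
    by (subst measurable_pair_iff) (simp add: comp_def)
qed

lemma AE_leb_pos: "AE x in leb_pos. P x" if "\<And>x. 0 < x \<Longrightarrow> P x"
  using that by (intro AE_I2) (simp add: space_restrict_space)

interpretation leb_pos: sigma_finite_measure leb_pos
  by (rule sigma_finite_measure_restrict_space) (auto intro: lborel.sigma_finite_measure_axioms)

interpretation leb_pos_pair: pair_sigma_finite leb_pos leb_pos ..

lemma integrable_leb_pos_iff:
  fixes f :: "real \<Rightarrow> 'b::{banach, second_countable_topology}"
  shows "integrable leb_pos f \<longleftrightarrow> set_integrable lborel {0<..} f"
  by (simp add: integrable_restrict_space set_integrable_def)

lemma integral_leb_pos_eq:
  fixes f :: "real \<Rightarrow> 'b::{banach, second_countable_topology}"
  shows "integral\<^sup>L leb_pos f = (LINT x:{0<..}|lborel. f x)"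
  by (simp add: integral_restrict_space set_lebesgue_integral_def)

lemma integrable_leb_pos_bound:
  fixes f :: "real \<Rightarrow> 'b::{banach, second_countable_topology}" and g :: "real \<Rightarrow> real"
  assumes "integrable leb_pos g" "f \<in> borel_measurable leb_pos" "\<And>x. 0 < x \<Longrightarrow> norm (f x) \<le> g x"
  shows "integrable leb_pos f"
  by (rule Bochner_Integration.integrable_bound[OF assms(1,2)], rule AE_leb_pos)
    (use assms(3) in \<open>fastforce intro: order_trans[OF _ abs_ge_self]\<close>)

lemma integrable_leb_pos_bounded_mult:
  fixes h k :: "real \<Rightarrow> 'b::{real_normed_field, banach, second_countable_topology}"
  assumes h: "integrable leb_pos h" and k: "k \<in> borel_measurable leb_pos" "\<And>x. 0 < x \<Longrightarrow> norm (k x) \<le> B"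
  shows "integrable leb_pos (\<lambda>x. k x * h x)"
proof (rule integrable_leb_pos_bound)
  show "integrable leb_pos (\<lambda>x. B * norm (h x))" using h by simp
  show "norm (k x * h x) \<le> B * norm (h x)" if "0 < x" for x
    using k(2)[OF that] by (simp add: norm_mult mult_right_mono)
qed (intro borel_measurable_times k borel_measurable_integrable[OF h])

lemma abs_integral_leb_pos_mult_le:
  fixes h k :: "real \<Rightarrow> real"
  assumes h: "integrable leb_pos h" and k: "k \<in> borel_measurable leb_pos" "\<And>x. 0 < x \<Longrightarrow> \<bar>k x\<bar> \<le> 1"
  shows "\<bar>LINT x|leb_pos. k x * h x\<bar> \<le> (LINT x|leb_pos. \<bar>h x\<bar>)"
proof (rule order_trans[OF integral_abs_bound], rule integral_mono_AE)
  have "integrable leb_pos (\<lambda>x. k x * h x)"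
    using k by (intro integrable_leb_pos_bounded_mult[OF h, where B = 1]) auto
  then show "integrable leb_pos (\<lambda>x. \<bar>k x * h x\<bar>)" by (rule integrable_abs)
  show "AE x in leb_pos. \<bar>k x * h x\<bar> \<le> \<bar>h x\<bar>"
    using k by (intro AE_leb_pos) (auto simp: abs_mult intro!: mult_left_le_one_le)
qed (use h in simp)

lemma integral_leb_pos_scale:
  fixes f :: "real \<Rightarrow> 'b::{banach, second_countable_topology}"
  assumes "0 < c"
  shows "(LINT x|leb_pos. f (c * x)) = (1 / c) *\<^sub>R (LINT x|leb_pos. f x)"
proof -
  have "(LINT x:{0<..}|lborel. f x) = c *\<^sub>R (LINT x:{0<..}|lborel. f (c * x))"
    using lborel_integral_real_affine[of c "\<lambda>x. indicat_real {0<..} x *\<^sub>R f x" 0] assms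
    by (simp add: set_lebesgue_integral_def indicator_def zero_less_mult_iff)
  then show ?thesis using assms by (simp add: integral_leb_pos_eq)
qed

lemma integrable_leb_pos_scale:
  fixes f :: "real \<Rightarrow> 'b::{banach, second_countable_topology}"
  assumes "0 < c" "integrable leb_pos f"
  shows "integrable leb_pos (\<lambda>x. f (c * x))"
  using lborel_integrable_real_affine[of "\<lambda>x. indicat_real {0<..} x *\<^sub>R f x" c 0] assms
  by (simp add: integrable_leb_pos_iff set_integrable_def indicator_def zero_less_mult_iff)

text \<open>An improper integral over the half-line, where the primitive only has to have limits at both ends; for a
  nonnegative integrand integrability comes for free.\<close>

lemma FTC_leb_pos:
  fixes f F :: "real \<Rightarrow> real"
  assumes "\<And>x. 0 < x \<Longrightarrow> (F has_real_derivative f x) (at x)" "\<And>x. 0 < x \<Longrightarrow> isCont f x"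
    and "(F \<longlongrightarrow> A) (at_right 0)" "(F \<longlongrightarrow> B) at_top" "\<And>x. 0 < x \<Longrightarrow> 0 \<le> f x"
  shows "integrable leb_pos f" "(LINT x|leb_pos. f x) = B - A"
proof -
  have e: "einterval 0 \<infinity> = {0<..}" by (auto simp: einterval_def zero_ereal_def)
  have F0: "((F \<circ> real_of_ereal) \<longlongrightarrow> A) (at_right 0)" "((F \<circ> real_of_ereal) \<longlongrightarrow> B) (at_left \<infinity>)"
    using assms by (auto simp: ereal_tendsto_simps zero_ereal_def)
  note * = interval_integral_FTC_nonneg[of 0 \<infinity> F f A B, OF _ _ _ _ F0]
  show "integrable leb_pos f"
    unfolding integrable_leb_pos_iff using *(1) assms by (auto simp: e)
  show "(LINT x|leb_pos. f x) = B - A"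
    unfolding integral_leb_pos_eq using *(2) assms by (auto simp: e interval_lebesgue_integral_def)
qed

lemma FTC_leb_pos_integrable:
  fixes f F :: "real \<Rightarrow> real"
  assumes "\<And>x. 0 < x \<Longrightarrow> (F has_real_derivative f x) (at x)" "\<And>x. 0 < x \<Longrightarrow> isCont f x"
    and "(F \<longlongrightarrow> A) (at_right 0)" "(F \<longlongrightarrow> B) at_top" "integrable leb_pos f"
  shows "(LINT x|leb_pos. f x) = B - A"
proof -
  have e: "einterval 0 \<infinity> = {0<..}" by (auto simp: einterval_def zero_ereal_def)
  have F0: "((F \<circ> real_of_ereal) \<longlongrightarrow> A) (at_right 0)" "((F \<circ> real_of_ereal) \<longlongrightarrow> B) (at_left \<infinity>)"
    using assms by (auto simp: ereal_tendsto_simps zero_ereal_def)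
  note * = interval_integral_FTC_integrable[of 0 \<infinity> F f A B, OF _ _ _ _ F0]
  show ?thesis
    unfolding integral_leb_pos_eq using * assms
    by (auto simp: e interval_lebesgue_integral_def integrable_leb_pos_iff has_real_derivative_iff_has_vector_derivative)
qed

lemma laplace_integrals:
  assumes "0 < b"
  shows "integrable leb_pos (\<lambda>x. exp (- b * x))" "(LINT x|leb_pos. exp (- b * x)) = 1 / b"
    and "(LINT x|leb_pos. exp (- b * x) * cos (x * \<xi>)) = b / (b\<^sup>2 + \<xi>\<^sup>2)"
proof -
  have l: "((\<lambda>x. exp (- b * x)) \<longlongrightarrow> 0) at_top"
    using assms by real_asymp
  have 1: "((\<lambda>x. - exp (- b * x) / b) has_real_derivative exp (- b * x)) (at x)" for x
    using assms by (auto intro!: derivative_eq_intros)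
  have 2: "((\<lambda>x. - exp (- b * x) / b) \<longlongrightarrow> -1/b) (at_right 0)"
    using assms by (auto intro!: tendsto_eq_intros)
  have 3: "((\<lambda>x. - exp (- b * x) / b) \<longlongrightarrow> 0) at_top"
    using assms by real_asymp
  show i: "integrable leb_pos (\<lambda>x. exp (- b * x))" "(LINT x|leb_pos. exp (- b * x)) = 1 / b"
    using FTC_leb_pos[OF 1 _ 2 3] by auto
  let ?F = "\<lambda>x. exp (- b * x) * (\<xi> * sin (x * \<xi>) - b * cos (x * \<xi>)) / (b\<^sup>2 + \<xi>\<^sup>2)"
  have nz: "b\<^sup>2 + \<xi>\<^sup>2 \<noteq> 0" using assms by (simp add: sum_power2_eq_zero_iff)
  have 4: "(?F has_real_derivative exp (- b * x) * cos (x * \<xi>)) (at x)" for x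
  proof -
    have "(?F has_real_derivative
       (exp (- b * x) * (\<xi> * (cos (x*\<xi>) * \<xi>) - b * (- sin (x*\<xi>) * \<xi>)) 
         + exp (- b * x) * (- b) * (\<xi> * sin (x * \<xi>) - b * cos (x * \<xi>))) / (b\<^sup>2 + \<xi>\<^sup>2)) (at x)"
      by (rule DERIV_cdivide) (auto intro!: derivative_eq_intros)
    also have "(exp (- b * x) * (\<xi> * (cos (x*\<xi>) * \<xi>) - b * (- sin (x*\<xi>) * \<xi>)) 
         + exp (- b * x) * (- b) * (\<xi> * sin (x * \<xi>) - b * cos (x * \<xi>)))
        = exp (- b * x) * cos (x * \<xi>) * (b\<^sup>2 + \<xi>\<^sup>2)"
      by (simp add: algebra_simps power2_eq_square)
    finally show ?thesis by (simp only: nonzero_mult_div_cancel_right[OF nz])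
  qed
  have 5: "(?F \<longlongrightarrow> 0) at_top"
  proof (rule Lim_null_comparison)
    show "\<forall>\<^sub>F x in at_top. norm (?F x) \<le> exp (- b * x) * ((\<bar>\<xi>\<bar> + b) / (b\<^sup>2 + \<xi>\<^sup>2))"
    proof (rule always_eventually, rule allI)
      fix x
      have "\<bar>\<xi> * sin (x * \<xi>) - b * cos (x * \<xi>)\<bar> \<le> \<bar>\<xi>\<bar> * \<bar>sin (x * \<xi>)\<bar> + b * \<bar>cos (x * \<xi>)\<bar>"
        using assms by (intro order_trans[OF abs_triangle_ineq4]) (simp add: abs_mult)
      also have "\<dots> \<le> \<bar>\<xi>\<bar> + b"
        using assms by (intro add_mono mult_left_le) auto
      finally show "norm (?F x) \<le> exp (- b * x) * ((\<bar>\<xi>\<bar> + b) / (b\<^sup>2 + \<xi>\<^sup>2))"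
        by (simp add: abs_mult divide_right_mono)
    qed
    show "((\<lambda>x. exp (- b * x) * ((\<bar>\<xi>\<bar> + b) / (b\<^sup>2 + \<xi>\<^sup>2))) \<longlongrightarrow> 0) at_top"
      by (rule tendsto_mult_left_zero[OF l])
  qed
  have 6: "(?F \<longlongrightarrow> - b / (b\<^sup>2 + \<xi>\<^sup>2)) (at_right 0)"
    using nz by (intro tendsto_eq_intros) auto
  have 7: "integrable leb_pos (\<lambda>x. exp (- b * x) * cos (x * \<xi>))"
    by (rule integrable_leb_pos_bound[OF i(1)]) (auto intro!: borel_measurable_leb_pos simp: abs_mult)
  show "(LINT x|leb_pos. exp (- b * x) * cos (x * \<xi>)) = b / (b\<^sup>2 + \<xi>\<^sup>2)"
    using FTC_leb_pos_integrable[OF 4 _ 6 5 7] by (simp add: continuous_intros)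
qed

lemma continuous_on_if_abs_lipschitz:
  fixes f :: "real \<Rightarrow> real"
  assumes "\<And>x y. \<bar>f x - f y\<bar> \<le> L * \<bar>x - y\<bar>"
  shows "continuous_on UNIV f"
proof -
  have "0 \<le> L" using assms[of 0 1] by (simp add: order_trans[OF abs_ge_zero])
  then have "L-lipschitz_on UNIV f"
    using assms by (intro lipschitz_onI) (auto simp: dist_real_def)
  then show ?thesis by (rule lipschitz_on_continuous_on)
qed

section \<open>Vanishing moments and uniqueness of Laplace transforms\<close>

text \<open>The positive and the negative part of the function are densities of two finite measures with the same
  distribution function, hence of the same measure, so the two densities agree almost everywhere.\<close>

lemma AE_zero_if_integral_Ioc_zero:
  fixes h :: "real \<Rightarrow> real"
  assumes h: "integrable leb_pos h" and z: "\<And>a. 0 < a \<Longrightarrow> (LINT x|leb_pos. indicat_real {..a} x * h x) = 0"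
  shows "AE x in leb_pos. h x = 0"
proof -
  define h' where "h' x = indicat_real {0<..} x * h x" for x
  have ih: "integrable lborel h'"
    using h by (simp add: integrable_leb_pos_iff set_integrable_def h'_def[abs_def])
  have z': "(LINT x:{..a}|lborel. h' x) = 0" for a
  proof (cases "0 < a")
    case True
    have "(LINT x:{..a}|lborel. h' x) = (LINT x|leb_pos. indicat_real {..a} x * h x)"
      by (simp add: integral_leb_pos_eq set_lebesgue_integral_def h'_def mult.left_commute)
    then show ?thesis using z[OF True] by simp
  next
    case False
    have "(LINT x:{..a}|lborel. h' x) = (LINT x|(lborel::real measure). (0::real))"
      unfolding set_lebesgue_integral_def
      by (rule Bochner_Integration.integral_cong) (use False in \<open>auto simp: h'_def indicator_def\<close>)
    then show ?thesis by simp
  qed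
  define hp hm where "hp x = max 0 (h' x)" and "hm x = max 0 (- h' x)" for x
  have [measurable]: "h' \<in> borel_measurable borel" using ih by auto
  have ip: "integrable lborel hp" and im: "integrable lborel hm"
    unfolding hp_def[abs_def] hm_def[abs_def]
    by (intro Bochner_Integration.integrable_max integrable_zero Bochner_Integration.integrable_minus ih)+
  have [measurable]: "hp \<in> borel_measurable borel" "hm \<in> borel_measurable borel"
    using ip im by auto
  have fin: "finite_borel_measure (density lborel (\<lambda>x. ennreal (k x)))"
    if "integrable lborel k" "\<And>x. 0 \<le> k x" for k :: "real \<Rightarrow> real"
  proof -
    have [measurable]: "k \<in> borel_measurable borel" using that by auto
    have "emeasure (density lborel (\<lambda>x. ennreal (k x))) UNIV = ennreal (integral\<^sup>L lborel k)"
      using that by (simp add: emeasure_density nn_integral_eq_integral)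
    then have "finite_measure (density lborel (\<lambda>x. ennreal (k x)))"
      by (intro finite_measureI) simp
    then show ?thesis
      by (intro finite_borel_measure.intro finite_borel_measure_axioms.intro) auto
  qed
  have cdfk: "cdf (density lborel (\<lambda>x. ennreal (k x))) a = (LINT x:{..a}|lborel. k x)"
    if "integrable lborel k" "\<And>x. 0 \<le> k x" for k :: "real \<Rightarrow> real" and a
  proof -
    have [measurable]: "k \<in> borel_measurable borel" using that by auto
    have "emeasure (density lborel (\<lambda>x. ennreal (k x))) {..a} = (\<integral>\<^sup>+x. ennreal (indicat_real {..a} x * k x) \<partial>lborel)"
      by (auto simp: emeasure_density indicator_def intro!: nn_integral_cong)
    also have "\<dots> = ennreal (LINT x:{..a}|lborel. k x)"
      unfolding set_lebesgue_integral_def real_scaleR_def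
      using that integrable_mult_indicator[OF _ that(1), of "{..a}"] by (intro nn_integral_eq_integral) auto
    finally show ?thesis
      using that by (simp add: cdf_def measure_def set_lebesgue_integral_def)
  qed
  have "hp x - hm x = h' x" for x by (auto simp: hp_def hm_def max_def)
  then have "(LINT x:{..a}|lborel. hp x) - (LINT x:{..a}|lborel. hm x) = 0" for a
  proof (subst set_integral_diff(2)[symmetric])
    show "set_integrable lborel {..a} hp" "set_integrable lborel {..a} hm"
      unfolding set_integrable_def by (intro integrable_mult_indicator ip im; simp)+
  qed (use z' in simp)
  then have eq: "density lborel (\<lambda>x. ennreal (hp x)) = density lborel (\<lambda>x. ennreal (hm x))"
  proof (intro cdf_unique' fin ip im ext)
    show "0 \<le> hp x" "0 \<le> hm x" for x by (auto simp: hp_def hm_def)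
    then show "cdf (density lborel (\<lambda>x. ennreal (hp x))) a = cdf (density lborel (\<lambda>x. ennreal (hm x))) a"
      if "\<And>a. (LINT x:{..a}|lborel. hp x) - (LINT x:{..a}|lborel. hm x) = 0" for a
      using that ip im by (simp add: cdfk)
  qed
  have "AE x in lborel. ennreal (hp x) = ennreal (hm x)"
    using eq by (subst (asm) sigma_finite_measure.density_unique_iff[OF sigma_finite_lborel]) auto
  then have "AE x in lborel. h' x = 0"
    by eventually_elim (auto simp: hp_def hm_def max_def split: if_splits)
  then show ?thesis
    by (subst AE_restrict_space_iff) (auto simp: h'_def)
qed

text \<open>By the Weierstrass theorem the moments may be replaced by arbitrary continuous functions of \<open>v\<close>. As \<open>v\<close> is
  strictly decreasing, the initial segments of the half-line are the sets where \<open>v\<close> exceeds a level, and their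
  indicators are limits of ramps in \<open>v\<close>.\<close>

lemma vanishing_moments_real:
  fixes h v :: "real \<Rightarrow> real"
  assumes h: "integrable leb_pos h" and v: "v \<in> borel_measurable leb_pos"
    and range: "\<And>x. 0 < x \<Longrightarrow> 0 \<le> v x \<and> v x \<le> 1" and mono: "\<And>x y. 0 < x \<Longrightarrow> x < y \<Longrightarrow> v y < v x"
    and moments: "\<And>n. (LINT x|leb_pos. h x * v x ^ n) = 0"
  shows "AE x in leb_pos. h x = 0"
proof (rule AE_zero_if_integral_Ioc_zero[OF h])
  note [measurable] = v borel_measurable_integrable[OF h]
  have hb: "integrable leb_pos (\<lambda>x. h x * k x)"
    if "k \<in> borel_measurable leb_pos" "\<And>x. 0 < x \<Longrightarrow> \<bar>k x\<bar> \<le> B" for k :: "real \<Rightarrow> real" and B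
  proof (rule integrable_leb_pos_bound)
    show "integrable leb_pos (\<lambda>x. B * \<bar>h x\<bar>)" using h by simp
    show "norm (h x * k x) \<le> B * \<bar>h x\<bar>" if "0 < x" for x
      using mult_left_mono[OF \<open>\<And>x. 0 < x \<Longrightarrow> \<bar>k x\<bar> \<le> B\<close>[OF that], of "\<bar>h x\<bar>"] by (simp add: abs_mult mult.commute)
  qed (use that in measurable)
  have cont: "(LINT x|leb_pos. h x * \<phi> (v x)) = 0"
    if \<phi>: "continuous_on {0..1} \<phi>" and [measurable]: "\<phi> \<in> borel_measurable borel" for \<phi> :: "real \<Rightarrow> real"
  proof -
    have "\<bar>LINT x|leb_pos. h x * \<phi> (v x)\<bar> \<le> e * (LINT x|leb_pos. \<bar>h x\<bar>)" if e: "0 < e" for e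
    proof -
      obtain g where g: "real_polynomial_function g" "\<And>x. x \<in> {0..1} \<Longrightarrow> \<bar>\<phi> x - g x\<bar> < e"
        using Stone_Weierstrass_real_polynomial_function[OF _ \<phi> e] by (metis compact_Icc)
      then obtain a n where ga: "g = (\<lambda>x. \<Sum>i\<le>n. a i * x ^ i)"
        using real_polynomial_function_iff_sum by blast
      have "integrable leb_pos (\<lambda>x. h x * v x ^ i)" for i
        using range by (intro hb[of _ 1]) (auto intro: power_le_one)
      then have ip: "integrable leb_pos (\<lambda>x. a i * (h x * v x ^ i))" for i
        by simp
      have hg: "h x * g (v x) = (\<Sum>i\<le>n. a i * (h x * v x ^ i))" for x
        by (simp add: ga sum_distrib_left mult.left_commute)
      have ig: "integrable leb_pos (\<lambda>x. h x * g (v x))"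
        unfolding hg using ip by (intro Bochner_Integration.integrable_sum)
      have "(LINT x|leb_pos. h x * g (v x)) = 0"
        unfolding hg using ip by (subst Bochner_Integration.integral_sum) (auto simp: moments)
      moreover have "integrable leb_pos (\<lambda>x. h x * (\<phi> (v x) - g (v x)))"
        using g(2) range by (intro hb[of _ e]) (auto simp: ga less_imp_le)
      then have id: "integrable leb_pos (\<lambda>x. h x * g (v x) + h x * (\<phi> (v x) - g (v x)))" 
        "integrable leb_pos (\<lambda>x. h x * (\<phi> (v x) - g (v x)))"
        using ig by auto
      ultimately have "(LINT x|leb_pos. h x * \<phi> (v x)) = (LINT x|leb_pos. h x * (\<phi> (v x) - g (v x)))"
        using Bochner_Integration.integral_add[OF ig id(2)] by (simp add: algebra_simps)
      also have "\<bar>\<dots>\<bar> \<le> (LINT x|leb_pos. \<bar>h x * (\<phi> (v x) - g (v x))\<bar>)"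
        by (rule integral_abs_bound)
      also have "\<dots> \<le> (LINT x|leb_pos. e * \<bar>h x\<bar>)"
      proof (rule integral_mono_AE)
        show "AE x in leb_pos. \<bar>h x * (\<phi> (v x) - g (v x))\<bar> \<le> e * \<bar>h x\<bar>"
        proof (rule AE_leb_pos)
          fix x :: real assume "0 < x"
          then have "\<bar>\<phi> (v x) - g (v x)\<bar> \<le> e" using g(2) range by (auto simp: less_imp_le)
          from mult_left_mono[OF this, of "\<bar>h x\<bar>"]
          show "\<bar>h x * (\<phi> (v x) - g (v x))\<bar> \<le> e * \<bar>h x\<bar>" by (simp add: abs_mult mult.commute)
        qed
      qed (use id h in auto)
      finally show ?thesis using h by simp
    qed
    note bound = this
    let ?I = "LINT x|leb_pos. \<bar>h x\<bar>"
    have I: "0 < ?I + 1" by (intro add_nonneg_pos) auto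
    have "\<bar>LINT x|leb_pos. h x * \<phi> (v x)\<bar> \<le> 0"
    proof (rule field_le_epsilon)
      fix e :: real assume e: "0 < e"
      have "\<bar>LINT x|leb_pos. h x * \<phi> (v x)\<bar> \<le> e / (?I + 1) * ?I"
        using e I by (intro bound) simp
      also have "\<dots> \<le> 0 + e"
        using e I by (simp add: field_simps)
      finally show "\<bar>LINT x|leb_pos. h x * \<phi> (v x)\<bar> \<le> 0 + e" .
    qed
    then show ?thesis by simp
  qed
  fix a :: real assume a: "0 < a"
  \<comment> \<open>Ramps that decrease to the indicator of \<open>{v a..}\<close>.\<close>
  define \<phi> where "\<phi> k u = max 0 (min 1 (1 + real k * (u - v a)))" for k :: nat and u :: real
  have "(\<lambda>k. LINT x|leb_pos. h x * \<phi> k (v x)) \<longlonglongrightarrow> (LINT x|leb_pos. h x * indicat_real {..a} x)"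
  proof (rule integral_dominated_convergence[where w = "\<lambda>x. \<bar>h x\<bar>"])
    show "AE x in leb_pos. (\<lambda>k. h x * \<phi> k (v x)) \<longlonglongrightarrow> h x * indicat_real {..a} x"
    proof (rule AE_leb_pos, rule tendsto_mult_left)
      fix x :: real assume x: "0 < x"
      show "(\<lambda>k. \<phi> k (v x)) \<longlonglongrightarrow> indicat_real {..a} x"
      proof (cases "x \<le> a")
        case True
        then have "v a \<le> v x" using mono[OF x, of a] by (cases "x = a") auto
        then have "\<phi> k (v x) = 1" for k by (simp add: \<phi>_def)
        then show ?thesis using True by simp
      next
        case False
        then have d: "0 < v a - v x" using mono[OF a, of x] by simp
        have "\<forall>\<^sub>F k in sequentially. \<phi> k (v x) = 0"
        proof -
          have "\<forall>\<^sub>F k in sequentially. 1 / (v a - v x) \<le> real k"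
            by real_asymp
          then show ?thesis
          proof eventually_elim
            case (elim k)
            then have "1 \<le> real k * (v a - v x)" using d by (simp add: field_simps)
            then show ?case by (simp add: \<phi>_def algebra_simps)
          qed
        qed
        then show ?thesis using False by (simp add: tendsto_eventually)
      qed
    qed
    show "AE x in leb_pos. norm (h x * \<phi> k (v x)) \<le> \<bar>h x\<bar>" for k
      by (rule AE_leb_pos) (auto simp: \<phi>_def abs_mult intro!: mult_left_le)
    show "(\<lambda>x. h x * indicat_real {..a} x) \<in> borel_measurable leb_pos"
      by (intro borel_measurable_times borel_measurable_integrable[OF h]
          borel_measurable_leb_pos[of "indicat_real {..a}"]) auto
    show "(\<lambda>x. h x * \<phi> k (v x)) \<in> borel_measurable leb_pos" for k
      unfolding \<phi>_def by measurable
  qed (use h in simp)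
  moreover have "(LINT x|leb_pos. h x * \<phi> k (v x)) = 0" for k
    unfolding \<phi>_def by (rule cont) (auto intro!: continuous_intros)
  ultimately show "(LINT x|leb_pos. indicat_real {..a} x * h x) = 0"
    using LIMSEQ_unique[OF _ tendsto_const[of 0]] by (simp add: mult.commute)
qed

lemma vanishing_moments:
  fixes h :: "real \<Rightarrow> complex" and v :: "real \<Rightarrow> real"
  assumes h: "integrable leb_pos h" and v: "v \<in> borel_measurable leb_pos"
    and range: "\<And>x. 0 < x \<Longrightarrow> 0 \<le> v x \<and> v x \<le> 1" and mono: "\<And>x y. 0 < x \<Longrightarrow> x < y \<Longrightarrow> v y < v x"
    and moments: "\<And>n. (LINT x|leb_pos. h x * of_real (v x) ^ n) = 0"
  shows "AE x in leb_pos. h x = 0"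
proof -
  have i: "integrable leb_pos (\<lambda>x. h x * of_real (v x) ^ n)" for n
  proof (rule integrable_leb_pos_bound)
    show "integrable leb_pos (\<lambda>x. norm (h x))" using h by simp
    show "norm (h x * of_real (v x) ^ n) \<le> norm (h x)" if "0 < x" for x
      using range[OF that] by (auto simp: norm_mult norm_power intro!: mult_left_le power_le_one)
  qed (use v borel_measurable_integrable[OF h] in measurable)
  have "AE x in leb_pos. Re (h x) = 0"
    using integral_Re[OF i] moments
    by (intro vanishing_moments_real[OF _ v range mono] integrable_Re h) (auto simp flip: of_real_power)
  moreover have "AE x in leb_pos. Im (h x) = 0"
    using integral_Im[OF i] moments
    by (intro vanishing_moments_real[OF _ v range mono] integrable_Im h) (auto simp flip: of_real_power)
  ultimately show ?thesis by eventually_elim (simp add: complex_eq_iff)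
qed

text \<open>The Laplace transform at the points \<open>1, 2, 3, \<dots>\<close> lists the moments of \<open>exp (- x) * h x\<close> with respect to
  \<open>v x = exp (- x)\<close>.\<close>

lemma laplace_unique:
  fixes h :: "real \<Rightarrow> complex"
  assumes h[measurable]: "h \<in> borel_measurable leb_pos" and B: "\<And>x. 0 < x \<Longrightarrow> norm (h x) \<le> B"
    and z: "\<And>b. 0 < b \<Longrightarrow> (LINT x|leb_pos. of_real (exp (- b * x)) * h x) = 0"
  shows "AE x in leb_pos. h x = 0"
proof -
  have [measurable]: "(\<lambda>x. exp (- x)) \<in> borel_measurable leb_pos"
    by (rule borel_measurable_leb_pos) simp
  have "AE x in leb_pos. of_real (exp (- x)) * h x = 0"
  proof (rule vanishing_moments[where v = "\<lambda>x. exp (- x)"])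
    show "integrable leb_pos (\<lambda>x. of_real (exp (- x)) * h x)"
    proof (rule integrable_leb_pos_bound)
      show "integrable leb_pos (\<lambda>x. exp (- 1 * x) * B)" using laplace_integrals(1)[of 1] by simp
    qed (use B in \<open>auto simp: norm_mult\<close>)
    have "exp (- (real n + 1) * x) = exp (-x) * exp (- x) ^ n" for n x
      by (simp flip: exp_of_nat_mult exp_add) (simp add: algebra_simps)
    then show "(LINT x|leb_pos. of_real (exp (- x)) * h x * of_real (exp (- x)) ^ n) = 0" for n
      using z[of "real n + 1"] by (simp add: mult_ac)
  qed auto
  then show ?thesis by eventually_elim simp
qed

section \<open>The Mittag-Leffler function as a cosine transform\<close>

context
  fixes \<alpha> :: real
  assumes \<alpha>: "1 < \<alpha>" "\<alpha> < 2"
begin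

definition ml_denom :: "real \<Rightarrow> real" where
  "ml_denom \<xi> = 1 + 2 * cos (pi * \<alpha> / 2) * \<xi> powr \<alpha> + (\<xi> powr \<alpha>)\<^sup>2"

text \<open>Up to the factor \<open>2 / \<pi>\<close> this is the density whose cosine transform is \<open>x \<mapsto> E\<^sub>\<alpha>(- x\<^sup>\<alpha>)\<close>, with \<open>E\<^sub>\<alpha>\<close> the
  one-parameter Mittag-Leffler function. It arises as the real part of the Laplace transform of that function on
  the imaginary axis; see \<open>Re_ml_symbol_imaginary\<close>.\<close>

definition ml_density :: "real \<Rightarrow> real" where
  "ml_density \<xi> = sin (pi * \<alpha> / 2) * \<xi> powr (\<alpha> - 1) / ml_denom \<xi>"

text \<open>This is \<open>x \<mapsto> E\<^sub>\<alpha>(- x\<^sup>\<alpha>)\<close> for \<open>x \<ge> 0\<close>. The power series of \<open>E\<^sub>\<alpha>\<close> would hide the decay at infinity, which the cosine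
  transform shows after one integration by parts.\<close>

definition mittag_leffler :: "real \<Rightarrow> real" where
  "mittag_leffler x = 2 / pi * (LINT \<xi>|leb_pos. cos (x * \<xi>) * ml_density \<xi>)"

lemma sin_half_pos: "0 < sin (pi * \<alpha> / 2)"
  using \<alpha> by (intro sin_gt_zero) (auto simp: field_simps)

text \<open>The denominator is the squared modulus of \<open>1 + y * cis (\<pi> \<alpha> / 2)\<close> with \<open>y = \<xi> powr \<alpha>\<close>; completing the square in either of the two possible ways
  leaves a multiple of the squared sine.\<close>

lemma ml_denom_ge:
  "(sin (pi * \<alpha> / 2))\<^sup>2 \<le> ml_denom \<xi>" "(sin (pi * \<alpha> / 2))\<^sup>2 * (\<xi> powr \<alpha>)\<^sup>2 \<le> ml_denom \<xi>"
proof -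
  let ?s = "sin (pi * \<alpha> / 2)" and ?c = "cos (pi * \<alpha> / 2)" and ?y = "\<xi> powr \<alpha>"
  have sc: "?s\<^sup>2 = 1 - ?c\<^sup>2" by (simp add: sin_squared_eq)
  have "ml_denom \<xi> = ?s\<^sup>2 + (?y + ?c)\<^sup>2"
    by (simp add: ml_denom_def sc power2_eq_square algebra_simps)
  moreover have "?s\<^sup>2 * ?y\<^sup>2 = (1 - ?c\<^sup>2) * ?y\<^sup>2" by (simp only: sc)
  then have "ml_denom \<xi> = ?s\<^sup>2 * ?y\<^sup>2 + (1 + ?c * ?y)\<^sup>2"
    by (simp add: ml_denom_def power2_eq_square algebra_simps)
  ultimately show "?s\<^sup>2 \<le> ml_denom \<xi>" "?s\<^sup>2 * ?y\<^sup>2 \<le> ml_denom \<xi>"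
    using zero_le_power2[of "?y + ?c"] zero_le_power2[of "1 + ?c * ?y"] by linarith+
qed

lemma ml_denom_pos: "0 < ml_denom \<xi>"
  using ml_denom_ge(1)[of \<xi>] sin_half_pos by (meson less_le_trans zero_less_power)

text \<open>One integrable function that dominates, up to constants, the density, its first moment and its derivative. It
  is a multiple of the derivative of the bounded function \<open>- 1 / (1 + \<xi> powr (\<alpha> - 1))\<close> and behaves like
  \<open>\<xi> powr (\<alpha> - 2)\<close> at \<open>0\<close> and like \<open>\<xi> powr (- \<alpha>)\<close> at infinity.\<close>

definition ml_majorant :: "real \<Rightarrow> real" where
  "ml_majorant \<xi> = \<xi> powr (\<alpha> - 2) / (1 + \<xi> powr (\<alpha> - 1))\<^sup>2"

lemma integrable_ml_majorant: "integrable leb_pos ml_majorant"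
proof -
  let ?F = "\<lambda>\<xi>. (1 - 1 / (1 + \<xi> powr (\<alpha> - 1))) / (\<alpha> - 1)"
  have a: "0 < 1 + x powr (\<alpha> - 1)" for x :: real
    by (intro add_pos_nonneg) auto
  have 1: "(?F has_real_derivative ml_majorant x) (at x)" if "0 < x" for x
  proof -
    have "((\<lambda>\<xi>. \<xi> powr (\<alpha> - 1)) has_real_derivative (\<alpha> - 1) * x powr (\<alpha> - 1 - 1)) (at x)"
      using that by (rule has_real_derivative_powr)
    then have "((\<lambda>\<xi>. (1 - 1 / (1 + \<xi> powr (\<alpha> - 1))) / (\<alpha> - 1)) has_real_derivative
      (0 - (0 * (1 + x powr (\<alpha> - 1)) - 1 * (0 + (\<alpha> - 1) * x powr (\<alpha> - 1 - 1)))
        / ((1 + x powr (\<alpha> - 1)) * (1 + x powr (\<alpha> - 1)))) / (\<alpha> - 1)) (at x)"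
      using a[of x] by (intro DERIV_cdivide DERIV_diff DERIV_divide DERIV_add DERIV_const) auto
    then show ?thesis using \<alpha> by (simp add: ml_majorant_def power2_eq_square)
  qed
  have 2: "isCont ml_majorant x" if "0 < x" for x
    unfolding ml_majorant_def[abs_def] using that a[of x]
    by (intro continuous_intros) auto
  have 3: "(?F \<longlongrightarrow> 0) (at_right 0)"
  proof -
    have "((\<lambda>x::real. x powr (\<alpha> - 1)) \<longlongrightarrow> 0) (at_right 0)"
      using \<alpha> by real_asymp
    then have "(?F \<longlongrightarrow> (1 - 1 / (1 + 0)) / (\<alpha> - 1)) (at_right 0)"
      using \<alpha> by (intro tendsto_intros) auto
    then show ?thesis by simp
  qed
  have 4: "(?F \<longlongrightarrow> 1 / (\<alpha> - 1)) at_top"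
  proof -
    have "((\<lambda>x::real. 1 / (1 + x powr (\<alpha> - 1))) \<longlongrightarrow> 0) at_top"
      using \<alpha> by real_asymp
    then have "(?F \<longlongrightarrow> (1 - 0) / (\<alpha> - 1)) at_top"
      using \<alpha> by (intro tendsto_intros) auto
    then show ?thesis by simp
  qed
  show ?thesis
    by (rule FTC_leb_pos(1)[OF 1 2 3 4]) (auto simp: ml_majorant_def)
qed

lemma ml_majorant_ge:
  assumes "0 < \<xi>"
  shows "\<xi> powr (\<alpha> - 2) / ml_denom \<xi> \<le> 4 / (sin (pi * \<alpha> / 2))\<^sup>2 * ml_majorant \<xi>"
    and "\<xi>\<^sup>2 * (\<xi> powr (\<alpha> - 2) / ml_denom \<xi>) \<le> 4 / (sin (pi * \<alpha> / 2))\<^sup>2 * ml_majorant \<xi>"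
    and "\<xi> * (\<xi> powr (\<alpha> - 2) / ml_denom \<xi>) \<le> 4 / (sin (pi * \<alpha> / 2))\<^sup>2 * ml_majorant \<xi>"
proof -
  let ?s = "sin (pi * \<alpha> / 2)" and ?e = "\<xi> powr (\<alpha> - 2) / ml_denom \<xi>"
    and ?M = "4 / (sin (pi * \<alpha> / 2))\<^sup>2 * ml_majorant \<xi>"
  have s: "0 < ?s\<^sup>2" using sin_half_pos by simp
  have e0: "0 \<le> ?e" using ml_denom_pos[of \<xi>] by simp
  have "max 1 (\<xi>\<^sup>2) * ?e \<le> ?M"
  proof (cases "\<xi> \<le> 1")
    case True
    then have "\<xi> powr (\<alpha> - 1) \<le> 1 powr (\<alpha> - 1)"
      using \<alpha> assms by (intro powr_mono2) auto
    then have "(1 + \<xi> powr (\<alpha> - 1))\<^sup>2 \<le> 2\<^sup>2" by (intro power_mono) auto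
    then have "\<xi> powr (\<alpha> - 2) / 4 \<le> ml_majorant \<xi>"
      unfolding ml_majorant_def using assms
      by (intro divide_left_mono mult_pos_pos zero_less_power add_pos_nonneg) auto
    moreover have "?e \<le> \<xi> powr (\<alpha> - 2) / ?s\<^sup>2"
      using ml_denom_ge(1)[of \<xi>] s ml_denom_pos[of \<xi>] by (intro divide_left_mono mult_pos_pos) auto
    moreover have "max 1 (\<xi>\<^sup>2) = 1"
      using True assms by (simp add: power_le_one)
    ultimately show ?thesis
      using s mult_left_mono[of "\<xi> powr (\<alpha> - 2) / 4" "ml_majorant \<xi>" "4 / ?s\<^sup>2"] by simp
  next
    case False
    then have "1 \<le> \<xi> powr (\<alpha> - 1)" using \<alpha> by (intro ge_one_powr_ge_zero) auto
    then have "(1 + \<xi> powr (\<alpha> - 1))\<^sup>2 \<le> (2 * \<xi> powr (\<alpha> - 1))\<^sup>2" by (intro power_mono) auto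
    then have "\<xi> powr (\<alpha> - 2) / (2 * \<xi> powr (\<alpha> - 1))\<^sup>2 \<le> ml_majorant \<xi>"
      unfolding ml_majorant_def using False
      by (intro divide_left_mono mult_pos_pos zero_less_power add_pos_nonneg) auto
    moreover have "\<xi> powr (\<alpha> - 2) / (2 * \<xi> powr (\<alpha> - 1))\<^sup>2 = \<xi> powr (- \<alpha>) / 4"
      using assms by (simp add: powr_diff powr_minus power2_eq_square field_simps powr_numeral)
    ultimately have 1: "\<xi> powr (- \<alpha>) / 4 \<le> ml_majorant \<xi>" by simp
    have "?e \<le> \<xi> powr (\<alpha> - 2) / (?s\<^sup>2 * (\<xi> powr \<alpha>)\<^sup>2)"
      using ml_denom_ge(2)[of \<xi>] s ml_denom_pos[of \<xi>] assms by (intro divide_left_mono mult_pos_pos) auto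
    then have "\<xi>\<^sup>2 * ?e \<le> \<xi>\<^sup>2 * (\<xi> powr (\<alpha> - 2) / (?s\<^sup>2 * (\<xi> powr \<alpha>)\<^sup>2))"
      by (rule mult_left_mono) simp
    also have "\<dots> = \<xi> powr (- \<alpha>) / ?s\<^sup>2"
      using assms s by (simp add: powr_diff powr_minus power2_eq_square field_simps powr_numeral)
    moreover have "max 1 (\<xi>\<^sup>2) = \<xi>\<^sup>2"
      using False by (simp add: max_def)
    ultimately show ?thesis
      using s mult_left_mono[OF 1, of "4 / ?s\<^sup>2"] by simp
  qed
  moreover have "\<xi> \<le> max 1 (\<xi>\<^sup>2)"
    using assms mult_left_mono[of 1 \<xi> \<xi>] by (cases "\<xi> \<le> 1") (auto simp: power2_eq_square le_max_iff_disj)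
  then have "1 * ?e \<le> max 1 (\<xi>\<^sup>2) * ?e" "\<xi>\<^sup>2 * ?e \<le> max 1 (\<xi>\<^sup>2) * ?e" "\<xi> * ?e \<le> max 1 (\<xi>\<^sup>2) * ?e"
    by (intro mult_right_mono e0; simp)+
  ultimately show "?e \<le> ?M" "\<xi>\<^sup>2 * ?e \<le> ?M" "\<xi> * ?e \<le> ?M" by linarith+
qed

lemma ml_density_eq: "0 < \<xi> \<Longrightarrow> ml_density \<xi> = sin (pi * \<alpha> / 2) * (\<xi> * (\<xi> powr (\<alpha> - 2) / ml_denom \<xi>))"
  by (simp add: ml_density_def powr_diff field_simps power2_eq_square powr_numeral)

lemma ml_density_nonneg: "0 \<le> ml_density \<xi>"
  using sin_half_pos ml_denom_pos[of \<xi>] by (simp add: ml_density_def)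

lemma borel_measurable_ml_density [measurable]: "ml_density \<in> borel_measurable borel"
  unfolding ml_density_def[abs_def] ml_denom_def[abs_def] by measurable

lemma ml_density_le:
  assumes "0 < \<xi>"
  shows "ml_density \<xi> \<le> 4 / sin (pi * \<alpha> / 2) * ml_majorant \<xi>"
    and "\<xi> * ml_density \<xi> \<le> 4 / sin (pi * \<alpha> / 2) * ml_majorant \<xi>"
proof -
  let ?s = "sin (pi * \<alpha> / 2)"
  have "?s * (4 / ?s\<^sup>2 * ml_majorant \<xi>) = 4 / ?s * ml_majorant \<xi>"
    using sin_half_pos by (simp add: power2_eq_square)
  then show "ml_density \<xi> \<le> 4 / ?s * ml_majorant \<xi>" "\<xi> * ml_density \<xi> \<le> 4 / ?s * ml_majorant \<xi>"
    using mult_left_mono[OF ml_majorant_ge(3)[OF assms], of ?s]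
      mult_left_mono[OF ml_majorant_ge(2)[OF assms], of ?s] sin_half_pos assms
    by (auto simp: ml_density_eq power2_eq_square mult_ac)
qed

lemma integrable_ml_density: "integrable leb_pos ml_density"
proof (rule integrable_leb_pos_bound)
  show "integrable leb_pos (\<lambda>\<xi>. 4 / sin (pi * \<alpha> / 2) * ml_majorant \<xi>)"
    using integrable_ml_majorant by simp
  show "ml_density \<in> borel_measurable leb_pos"
    by (intro borel_measurable_leb_pos borel_measurable_ml_density)
  show "norm (ml_density \<xi>) \<le> 4 / sin (pi * \<alpha> / 2) * ml_majorant \<xi>" if "0 < \<xi>" for \<xi>
    unfolding real_norm_def abs_of_nonneg[OF ml_density_nonneg] by (rule ml_density_le(1)[OF that])
qed

lemma integrable_ml_density_moment: "integrable leb_pos (\<lambda>\<xi>. \<xi> * ml_density \<xi>)"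
proof (rule integrable_leb_pos_bound)
  show "integrable leb_pos (\<lambda>\<xi>. 4 / sin (pi * \<alpha> / 2) * ml_majorant \<xi>)"
    using integrable_ml_majorant by simp
  show "(\<lambda>\<xi>. \<xi> * ml_density \<xi>) \<in> borel_measurable leb_pos"
    by (rule borel_measurable_leb_pos) measurable
  fix \<xi> :: real assume \<xi>: "0 < \<xi>"
  then have "0 \<le> \<xi> * ml_density \<xi>" using ml_density_nonneg[of \<xi>] by simp
  then show "norm (\<xi> * ml_density \<xi>) \<le> 4 / sin (pi * \<alpha> / 2) * ml_majorant \<xi>"
    unfolding real_norm_def by (simp only: abs_of_nonneg ml_density_le(2)[OF \<xi>])
qed

lemma integrable_cos_ml_density: "integrable leb_pos (\<lambda>\<xi>. cos (x * \<xi>) * ml_density \<xi>)"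
  by (rule integrable_leb_pos_bounded_mult[OF integrable_ml_density, where B = 1])
    (auto intro!: borel_measurable_leb_pos)

text \<open>The density has a finite first moment, because it decays like \<open>\<xi> powr (- 1 - \<alpha>)\<close> and \<open>\<alpha> > 1\<close>.\<close>

lemma mittag_leffler_lipschitz:
  "\<exists>L. \<forall>x y. \<bar>mittag_leffler x - mittag_leffler y\<bar> \<le> L * \<bar>x - y\<bar>"
proof (intro exI allI)
  fix x y :: real
  let ?I = "LINT \<xi>|leb_pos. \<xi> * ml_density \<xi>"
  have cosd: "\<bar>cos a - cos b\<bar> \<le> \<bar>a - b\<bar>" for a b :: real
  proof -
    have "\<bar>cos a - cos b\<bar> = 2 * (\<bar>sin ((a + b) / 2)\<bar> * \<bar>sin ((b - a) / 2)\<bar>)"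
      by (simp add: cos_diff_cos abs_mult)
    also have "\<dots> \<le> 2 * (1 * \<bar>(b - a) / 2\<bar>)"
      by (intro mult_left_mono mult_mono abs_sin_x_le_abs_x) auto
    finally show ?thesis by simp
  qed
  have "mittag_leffler x - mittag_leffler y
      = 2 / pi * (LINT \<xi>|leb_pos. cos (x * \<xi>) * ml_density \<xi> - cos (y * \<xi>) * ml_density \<xi>)"
    by (simp add: mittag_leffler_def integrable_cos_ml_density Bochner_Integration.integral_diff right_diff_distrib)
  also have "\<bar>\<dots>\<bar> = 2 / pi * \<bar>LINT \<xi>|leb_pos. cos (x * \<xi>) * ml_density \<xi> - cos (y * \<xi>) * ml_density \<xi>\<bar>"
    by (simp add: abs_mult)
  also have "\<dots> \<le> 2 / pi * (LINT \<xi>|leb_pos. \<bar>x - y\<bar> * (\<xi> * ml_density \<xi>))"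
  proof (intro mult_left_mono order_trans[OF integral_abs_bound] integral_mono_AE AE_leb_pos)
    fix \<xi> :: real assume \<xi>: "0 < \<xi>"
    have "\<bar>cos (x * \<xi>) - cos (y * \<xi>)\<bar> \<le> \<bar>x - y\<bar> * \<xi>"
      using cosd[of "x * \<xi>" "y * \<xi>"] \<xi> by (simp add: abs_mult flip: left_diff_distrib)
    from mult_right_mono[OF this ml_density_nonneg[of \<xi>]]
    show "\<bar>cos (x * \<xi>) * ml_density \<xi> - cos (y * \<xi>) * ml_density \<xi>\<bar> \<le> \<bar>x - y\<bar> * (\<xi> * ml_density \<xi>)"
      using ml_density_nonneg[of \<xi>] by (simp add: abs_mult mult.assoc flip: left_diff_distrib)
  qed (auto intro!: integrable_abs Bochner_Integration.integrable_diff integrable_cos_ml_density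
      integrable_ml_density_moment)
  also have "\<dots> = 2 / pi * (\<bar>x - y\<bar> * ?I)" by simp
  finally show "\<bar>mittag_leffler x - mittag_leffler y\<bar> \<le> (2 / pi * ?I) * \<bar>x - y\<bar>"
    by (simp add: mult_ac)
qed

lemma continuous_mittag_leffler: "continuous_on UNIV mittag_leffler"
  using mittag_leffler_lipschitz continuous_on_if_abs_lipschitz by blast

lemma mittag_leffler_bounded: "\<exists>B. \<forall>x. \<bar>mittag_leffler x\<bar> \<le> B"
proof (intro exI allI)
  fix x
  have "\<bar>LINT \<xi>|leb_pos. cos (x * \<xi>) * ml_density \<xi>\<bar> \<le> (LINT \<xi>|leb_pos. ml_density \<xi>)"
    using abs_integral_leb_pos_mult_le[OF integrable_ml_density, of "\<lambda>\<xi>. cos (x * \<xi>)"]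
    by (simp add: borel_measurable_leb_pos ml_density_nonneg)
  from mult_left_mono[OF this, of "2 / pi"]
  show "\<bar>mittag_leffler x\<bar> \<le> 2 / pi * (LINT \<xi>|leb_pos. ml_density \<xi>)"
    by (simp add: mittag_leffler_def abs_mult)
qed

definition ml_density_deriv :: "real \<Rightarrow> real" where
  "ml_density_deriv \<xi> = sin (pi * \<alpha> / 2) * (\<xi> powr (\<alpha> - 2) / ml_denom \<xi>) *
     ((\<alpha> - 1) - 2 * \<alpha> * \<xi> powr \<alpha> * (cos (pi * \<alpha> / 2) + \<xi> powr \<alpha>) / ml_denom \<xi>)"

lemma has_derivative_ml_density:
  assumes "0 < \<xi>"
  shows "(ml_density has_real_derivative ml_density_deriv \<xi>) (at \<xi>)"
proof -
  let ?s = "sin (pi * \<alpha> / 2)" and ?c = "cos (pi * \<alpha> / 2)"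
  have p: "((\<lambda>\<xi>. \<xi> powr r) has_real_derivative r * \<xi> powr (r - 1)) (at \<xi>)" for r
    using assms by (rule has_real_derivative_powr)
  have "(ml_denom has_real_derivative 2 * ?c * (\<alpha> * \<xi> powr (\<alpha> - 1))
      + 2 * \<xi> powr \<alpha> * (\<alpha> * \<xi> powr (\<alpha> - 1))) (at \<xi>)"
    unfolding ml_denom_def[abs_def]
    by (rule DERIV_cong[OF DERIV_add[OF DERIV_add[OF DERIV_const DERIV_cmult[OF p]] DERIV_power[OF p, where n = 2]]])
      simp
  then have "(ml_density has_real_derivative
     (?s * ((\<alpha> - 1) * \<xi> powr (\<alpha> - 1 - 1)) * ml_denom \<xi> - ?s * \<xi> powr (\<alpha> - 1) * (2 * ?c * (\<alpha> * \<xi> powr (\<alpha> - 1))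
      + 2 * \<xi> powr \<alpha> * (\<alpha> * \<xi> powr (\<alpha> - 1)))) / (ml_denom \<xi> * ml_denom \<xi>)) (at \<xi>)"
    unfolding ml_density_def[abs_def] using ml_denom_pos[of \<xi>]
    by (intro DERIV_divide DERIV_cmult p) auto
  moreover have "\<xi> powr (\<alpha> - 1) * \<xi> powr (\<alpha> - 1) = \<xi> powr (\<alpha> - 2) * \<xi> powr \<alpha>"
    using assms by (simp flip: powr_add)
  then have "?s * (\<xi> powr (\<alpha> - 1) * \<xi> powr (\<alpha> - 1)) * (2 * \<alpha> * (?c + \<xi> powr \<alpha>))
     = ?s * (\<xi> powr (\<alpha> - 2) * \<xi> powr \<alpha>) * (2 * \<alpha> * (?c + \<xi> powr \<alpha>))" by simp
  then have "?s * \<xi> powr (\<alpha> - 1) * (2 * ?c * (\<alpha> * \<xi> powr (\<alpha> - 1)) + 2 * \<xi> powr \<alpha> * (\<alpha> * \<xi> powr (\<alpha> - 1)))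
     = ?s * \<xi> powr (\<alpha> - 2) * (2 * \<alpha> * \<xi> powr \<alpha> * (?c + \<xi> powr \<alpha>))"
    by (simp add: algebra_simps)
  ultimately show ?thesis
    using ml_denom_pos[of \<xi>] by (simp add: ml_density_deriv_def field_simps)
qed

lemma integrable_ml_density_deriv: "integrable leb_pos ml_density_deriv"
proof (rule integrable_leb_pos_bound)
  let ?s = "sin (pi * \<alpha> / 2)" and ?c = "cos (pi * \<alpha> / 2)"
  let ?K = "?s * (1 + 12 / ?s\<^sup>2)"
  show "integrable leb_pos (\<lambda>\<xi>. 4 / ?s\<^sup>2 * ml_majorant \<xi> * ?K)"
    using integrable_ml_majorant by simp
  show "ml_density_deriv \<in> borel_measurable leb_pos"
    unfolding ml_density_deriv_def[abs_def] ml_denom_def[abs_def] by (rule borel_measurable_leb_pos) measurable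
  fix \<xi> :: real assume \<xi>: "0 < \<xi>"
  let ?y = "\<xi> powr \<alpha>" and ?D = "ml_denom \<xi>"
  note D = ml_denom_pos[of \<xi>]
  have s: "0 < ?s\<^sup>2" using sin_half_pos by simp
  have "\<bar>?c + ?y\<bar> \<le> 1 + ?y" using abs_cos_le_one[of "pi * \<alpha> / 2"] by (intro order_trans[OF abs_triangle_ineq]) auto
  then have "?y * \<bar>?c + ?y\<bar> \<le> ?y * (1 + ?y)" by (rule mult_left_mono) simp
  also have "\<dots> \<le> 1 + 2 * ?y\<^sup>2"
  proof -
    have "?y * (1 + ?y) = ?y + ?y\<^sup>2" "(?y - 1)\<^sup>2 = ?y\<^sup>2 - 2 * ?y + 1"
      by (simp_all add: power2_eq_square algebra_simps)
    then show ?thesis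
      using zero_le_power2[of "?y - 1"] powr_ge_zero[of \<xi> \<alpha>] zero_le_power2[of ?y] by linarith
  qed
  finally have 1: "?y * \<bar>?c + ?y\<bar> \<le> 1 + 2 * ?y\<^sup>2" .
  have "2 * \<alpha> * (?y * \<bar>?c + ?y\<bar>) \<le> 4 * (?y * \<bar>?c + ?y\<bar>)"
    using \<alpha> by (intro mult_right_mono) auto
  also have "\<dots> \<le> 4 * (1 + 2 * ?y\<^sup>2)" using 1 by simp
  also have "\<dots> \<le> 4 * (3 * (?D / ?s\<^sup>2))"
  proof -
    have "1 \<le> ?D / ?s\<^sup>2" "?y\<^sup>2 \<le> ?D / ?s\<^sup>2"
      using ml_denom_ge[of \<xi>] s by (auto simp: pos_le_divide_eq mult.commute)
    note bounds = this
    have "1 \<le> A \<Longrightarrow> B \<le> A \<Longrightarrow> 4 * (1 + 2 * B) \<le> 4 * (3 * A)" for A B :: real by simp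
    from this[OF bounds] show ?thesis .
  qed
  finally have 2: "2 * \<alpha> * (?y * \<bar>?c + ?y\<bar>) \<le> 12 / ?s\<^sup>2 * ?D" by simp
  have "\<bar>(\<alpha> - 1) - 2 * \<alpha> * ?y * (?c + ?y) / ?D\<bar> \<le> (\<alpha> - 1) + 2 * \<alpha> * (?y * \<bar>?c + ?y\<bar>) / ?D"
    using \<alpha> D by (intro order_trans[OF abs_triangle_ineq4]) (auto simp: abs_mult mult.assoc)
  also have "\<dots> \<le> 1 + 12 / ?s\<^sup>2"
    using 2 \<alpha> D by (intro add_mono) (auto simp: pos_divide_le_eq)
  finally have 3: "\<bar>(\<alpha> - 1) - 2 * \<alpha> * ?y * (?c + ?y) / ?D\<bar> \<le> 1 + 12 / ?s\<^sup>2" .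
  have "\<bar>ml_density_deriv \<xi>\<bar> = ?s * (\<xi> powr (\<alpha> - 2) / ?D) * \<bar>(\<alpha> - 1) - 2 * \<alpha> * ?y * (?c + ?y) / ?D\<bar>"
    using sin_half_pos D by (simp add: ml_density_deriv_def abs_mult)
  also have "\<dots> \<le> ?s * (4 / ?s\<^sup>2 * ml_majorant \<xi>) * (1 + 12 / ?s\<^sup>2)"
    using ml_majorant_ge(1)[OF \<xi>] 3 sin_half_pos s
    by (intro mult_mono mult_left_mono) (auto simp: ml_majorant_def)
  finally show "norm (ml_density_deriv \<xi>) \<le> 4 / ?s\<^sup>2 * ml_majorant \<xi> * (?s * (1 + 12 / ?s\<^sup>2))"
    by (simp only: mult_ac real_norm_def)
qed

text \<open>Integration by parts: the density vanishes at both ends of the half-line and has an integrable derivative.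
  Together with boundedness, decay of order \<open>1 / x\<close> puts the function into \<open>L\<^sup>2\<close> and into \<open>C\<^sub>0\<close>.\<close>

lemma mittag_leffler_decay: "\<exists>C. \<forall>x. \<bar>x * mittag_leffler x\<bar> \<le> C"
proof (intro exI allI)
  fix x
  let ?s = "sin (pi * \<alpha> / 2)"
  let ?f = "\<lambda>\<xi>. x * (cos (x * \<xi>) * ml_density \<xi>) + sin (x * \<xi>) * ml_density_deriv \<xi>"
  have i2: "integrable leb_pos (\<lambda>\<xi>. sin (x * \<xi>) * ml_density_deriv \<xi>)"
    by (rule integrable_leb_pos_bounded_mult[OF integrable_ml_density_deriv, where B = 1])
      (auto intro!: borel_measurable_leb_pos)
  have s: "0 < ?s" by (rule sin_half_pos)
  have b0: "ml_density \<xi> \<le> \<xi> powr (\<alpha> - 1) / ?s" for \<xi>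
  proof -
    have "ml_density \<xi> \<le> ?s * \<xi> powr (\<alpha> - 1) / ?s\<^sup>2"
      unfolding ml_density_def using ml_denom_ge(1)[of \<xi>] s ml_denom_pos[of \<xi>]
      by (intro divide_left_mono) auto
    then show ?thesis using s by (simp add: power2_eq_square)
  qed
  have binf: "ml_density \<xi> \<le> \<xi> powr (- 1 - \<alpha>) / ?s" if "0 < \<xi>" for \<xi>
  proof -
    have "ml_density \<xi> \<le> ?s * \<xi> powr (\<alpha> - 1) / (?s\<^sup>2 * (\<xi> powr \<alpha>)\<^sup>2)"
      unfolding ml_density_def using ml_denom_ge(2)[of \<xi>] s ml_denom_pos[of \<xi>] that
      by (intro divide_left_mono) auto
    also have "\<dots> = \<xi> powr (- 1 - \<alpha>) / ?s"
      using s that by (simp add: powr_diff power2_eq_square powr_minus field_simps)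
    finally show ?thesis .
  qed
  have l0: "(ml_density \<longlongrightarrow> 0) (at_right 0)"
  proof (rule tendsto_sandwich[where f = "\<lambda>_. 0"])
    have "((\<lambda>\<xi>::real. \<xi> powr (\<alpha> - 1)) \<longlongrightarrow> 0) (at_right 0)" using \<alpha> by real_asymp
    then show "((\<lambda>\<xi>. \<xi> powr (\<alpha> - 1) / ?s) \<longlongrightarrow> 0) (at_right 0)" by (rule tendsto_divide_zero)
  qed (use b0 ml_density_nonneg in auto)
  have linf: "(ml_density \<longlongrightarrow> 0) at_top"
  proof (rule tendsto_sandwich[where f = "\<lambda>_. 0"])
    have "((\<lambda>\<xi>::real. \<xi> powr (- 1 - \<alpha>)) \<longlongrightarrow> 0) at_top" using \<alpha> by real_asymp
    then show "((\<lambda>\<xi>. \<xi> powr (- 1 - \<alpha>) / ?s) \<longlongrightarrow> 0) at_top" by (rule tendsto_divide_zero)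
    show "\<forall>\<^sub>F \<xi> in at_top. ml_density \<xi> \<le> \<xi> powr (- 1 - \<alpha>) / ?s"
      using eventually_gt_at_top[of 0] by eventually_elim (rule binf)
  qed (use ml_density_nonneg in auto)
  have zero: "((\<lambda>\<xi>. sin (x * \<xi>) * ml_density \<xi>) \<longlongrightarrow> 0) G" if "(ml_density \<longlongrightarrow> 0) G" for G
    using that ml_density_nonneg
    by (intro Lim_null_comparison[OF _ that]) (auto simp: abs_mult intro!: always_eventually mult_left_le_one_le)
  have "(LINT \<xi>|leb_pos. ?f \<xi>) = 0 - 0"
  proof (rule FTC_leb_pos_integrable[where F = "\<lambda>\<xi>. sin (x * \<xi>) * ml_density \<xi>"])
    show "((\<lambda>\<xi>. sin (x * \<xi>) * ml_density \<xi>) has_real_derivative ?f \<xi>) (at \<xi>)" if "0 < \<xi>" for \<xi>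
      by (auto intro!: derivative_eq_intros has_derivative_ml_density that simp: algebra_simps)
    show "isCont ?f \<xi>" if "0 < \<xi>" for \<xi>
      unfolding ml_density_deriv_def ml_density_def ml_denom_def
      using that ml_denom_pos[of \<xi>]
      by (intro continuous_intros) (auto simp: ml_denom_def)
    show "integrable leb_pos ?f"
      using i2 integrable_cos_ml_density[of x] by simp
  qed (use zero l0 linf in auto)
  then have "x * (LINT \<xi>|leb_pos. cos (x * \<xi>) * ml_density \<xi>) = - (LINT \<xi>|leb_pos. sin (x * \<xi>) * ml_density_deriv \<xi>)"
    using i2 integrable_cos_ml_density[of x] by simp
  moreover have "\<bar>LINT \<xi>|leb_pos. sin (x * \<xi>) * ml_density_deriv \<xi>\<bar> \<le> (LINT \<xi>|leb_pos. \<bar>ml_density_deriv \<xi>\<bar>)"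
    by (rule abs_integral_leb_pos_mult_le[OF integrable_ml_density_deriv])
      (auto intro!: borel_measurable_leb_pos)
  ultimately have "\<bar>x * (LINT \<xi>|leb_pos. cos (x * \<xi>) * ml_density \<xi>)\<bar> \<le> (LINT \<xi>|leb_pos. \<bar>ml_density_deriv \<xi>\<bar>)"
    by simp
  from mult_left_mono[OF this, of "2 / pi"]
  show "\<bar>x * mittag_leffler x\<bar> \<le> 2 / pi * (LINT \<xi>|leb_pos. \<bar>ml_density_deriv \<xi>\<bar>)"
    by (simp add: mittag_leffler_def abs_mult mult_ac)
qed

section \<open>The Laplace transform of the Mittag-Leffler function\<close>

definition ml_symbol :: "complex \<Rightarrow> complex" where
  "ml_symbol w = w powr of_real (\<alpha> - 1) / (w powr of_real \<alpha> + 1)"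

text \<open>The argument of \<open>w\<^sup>\<alpha>\<close> is at most \<open>\<alpha> \<pi> / 2 < \<pi>\<close> in absolute value, so \<open>w\<^sup>\<alpha>\<close> avoids \<open>-1\<close>.\<close>

lemma ml_symbol_denom_nonzero:
  assumes "0 \<le> Re w"
  shows "w powr of_real \<alpha> + 1 \<noteq> 0"
proof (cases "w = 0")
  case False
  define \<theta> where "\<theta> = \<alpha> * Im (Ln w)"
  have "\<bar>Im (Ln w)\<bar> \<le> pi / 2" using Re_Ln_pos_le[OF False] assms by iprover
  then have "\<alpha> * \<bar>Im (Ln w)\<bar> \<le> \<alpha> * (pi / 2)" using \<alpha> by (intro mult_left_mono) auto
  also have "\<dots> < 2 * (pi / 2)" using \<alpha> by (intro mult_strict_right_mono) auto
  finally have \<theta>: "\<bar>\<theta>\<bar> < pi" using \<alpha> by (simp add: \<theta>_def abs_mult)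
  have wp: "w powr of_real \<alpha> = exp (of_real \<alpha> * Ln w)"
    using False by (simp add: powr_def)
  show ?thesis
  proof
    assume "w powr of_real \<alpha> + 1 = 0"
    then have "w powr of_real \<alpha> = -1" by (rule eq_neg_iff_add_eq_0[THEN iffD2])
    then have re: "exp (\<alpha> * Re (Ln w)) * cos \<theta> = -1" and im: "exp (\<alpha> * Re (Ln w)) * sin \<theta> = 0"
      unfolding wp by (auto simp: complex_eq_iff Re_exp Im_exp \<theta>_def)
    from im have "sin \<theta> = 0" by simp
    then have "\<theta> = 0" using \<theta> sin_gt_zero[of \<theta>] sin_gt_zero[of "- \<theta>"] by (cases "\<theta> > 0"; cases "\<theta> < 0") auto
    then have "exp (\<alpha> * Re (Ln w)) = -1" using re by simp
    moreover have "0 < exp (\<alpha> * Re (Ln w))" by (rule exp_gt_zero)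
    ultimately show False by linarith
  qed
qed simp

lemma continuous_on_ml_symbol: "continuous_on {w. 0 \<le> Re w} ml_symbol"
  unfolding ml_symbol_def[abs_def] using \<alpha> ml_symbol_denom_nonzero
  by (intro continuous_intros) auto

lemma holomorphic_on_ml_symbol: "ml_symbol holomorphic_on {w. 0 < Re w}"
  unfolding ml_symbol_def[abs_def] using ml_symbol_denom_nonzero
  by (intro holomorphic_intros) (auto simp: complex_nonpos_Reals_iff)

lemma tendsto_ml_symbol: "(ml_symbol \<longlongrightarrow> 0) at_infinity"
proof (rule Lim_null_comparison)
  have "\<forall>\<^sub>F w :: complex in at_infinity. 2 \<le> norm w"
    by (auto simp: eventually_at_infinity)
  then show "\<forall>\<^sub>F w in at_infinity. norm (ml_symbol w) \<le> norm w powr (\<alpha> - 1) / (norm w powr \<alpha> - 1)"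
  proof eventually_elim
    case (elim w)
    have "1 < norm w powr \<alpha>" using elim \<alpha> by (intro gr_one_powr) auto
    moreover have "norm w powr \<alpha> - 1 \<le> norm (w powr of_real \<alpha> + 1)"
      using norm_triangle_ineq2[of "w powr of_real \<alpha>" "-1"] by (simp add: norm_powr_real_powr')
    ultimately show ?case
      by (simp add: ml_symbol_def norm_divide norm_powr_real_powr' frac_le flip: of_real_diff)
  qed
  have "((\<lambda>r. r powr (\<alpha> - 1) / (r powr \<alpha> - 1)) \<longlongrightarrow> 0) at_top" using \<alpha> by real_asymp
  then show "((\<lambda>w::complex. norm w powr (\<alpha> - 1) / (norm w powr \<alpha> - 1)) \<longlongrightarrow> 0) at_infinity"
    by (rule filterlim_compose[OF _ filterlim_norm_at_top])
qed

text \<open>The conformal map of the unit disc onto the right half-plane that sends \<open>0\<close> to \<open>b\<close> and \<open>1\<close> to infinity.\<close>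

definition cayley :: "real \<Rightarrow> complex \<Rightarrow> complex" where
  "cayley b \<zeta> = of_real b * (1 + \<zeta>) / (1 - \<zeta>)"

lemma Re_cayley: "Re (cayley b \<zeta>) = b * (1 - (norm \<zeta>)\<^sup>2) / (norm (1 - \<zeta>))\<^sup>2"
proof -
  have "cayley b \<zeta> = of_real b * ((1 + \<zeta>) * cnj (1 - \<zeta>)) / of_real ((norm (1 - \<zeta>))\<^sup>2)"
    unfolding cayley_def by (subst complex_div_cnj) (simp add: mult.assoc)
  also have "Re \<dots> = Re (of_real b * ((1 + \<zeta>) * cnj (1 - \<zeta>))) / (norm (1 - \<zeta>))\<^sup>2"
    by (rule Re_divide_of_real)
  also have "Re (of_real b * ((1 + \<zeta>) * cnj (1 - \<zeta>))) = b * (1 - (norm \<zeta>)\<^sup>2)"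
    by (simp add: cmod_power2) (simp add: power2_eq_square algebra_simps)
  finally show ?thesis .
qed

text \<open>Transported to the disc, the symbol is holomorphic inside and continuous up to the boundary, the value at \<open>1\<close>
  being its limit \<open>0\<close> at infinity. Hence its value at the centre is its mean over the circle.\<close>

lemma circle_mean_ml_symbol:
  assumes b: "0 < b"
  defines "g \<equiv> \<lambda>\<tau>. if \<tau> \<in> {0, 1} then 0 else ml_symbol (cayley b (exp (2 * of_real pi * \<i> * of_real \<tau>)))"
  shows "continuous_on {0..1} g" "(g has_integral ml_symbol (of_real b)) {0..1}"
proof -
  define G where "G \<zeta> = (if \<zeta> = 1 then 0 else ml_symbol (cayley b \<zeta>))" for \<zeta>
  have inH: "0 \<le> Re (cayley b \<zeta>)" if "norm \<zeta> \<le> 1" for \<zeta>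
    using that b by (auto simp: Re_cayley abs_square_le_1 intro!: divide_nonneg_nonneg mult_nonneg_nonneg)
  have inH': "0 < Re (cayley b \<zeta>)" if "norm \<zeta> < 1" for \<zeta>
    using that b by (auto simp: Re_cayley power_less_one_iff abs_square_less_1 intro!: divide_pos_pos mult_pos_pos)
  have cc: "continuous_on (cball 0 1 - {1}) (\<lambda>\<zeta>. ml_symbol (cayley b \<zeta>))"
    by (rule continuous_on_compose2[OF continuous_on_ml_symbol])
      (auto simp: cayley_def intro!: continuous_intros inH[unfolded cayley_def])
  have contG: "continuous_on (cball 0 1) G"
    unfolding continuous_on_def
  proof
    fix z :: complex assume z: "z \<in> cball 0 1"
    show "(G \<longlongrightarrow> G z) (at z within cball 0 1)"
    proof (cases "z = 1")
      case False
      have "at z within cball 0 1 = at z within (cball 0 1 - {1})"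
        using False by (intro at_within_nhd[of z "- {1}"]) auto
      moreover have "((\<lambda>\<zeta>. ml_symbol (cayley b \<zeta>)) \<longlongrightarrow> ml_symbol (cayley b z)) (at z within (cball 0 1 - {1}))"
        using cc z False by (auto simp: continuous_on_def)
      then have "(G \<longlongrightarrow> G z) (at z within (cball 0 1 - {1}))"
        using False by (rule_tac Lim_transform_eventually)
          (auto simp: G_def eventually_at_filter)
      ultimately show ?thesis by simp
    next
      case True
      have "filterlim (\<lambda>\<zeta>. 1 - \<zeta>) (at 0) (at (1::complex))"
        by (rule filterlim_atI) (auto intro!: tendsto_eq_intros simp: eventually_at_filter)
      then have inf: "filterlim (\<lambda>\<zeta>. inverse (1 - \<zeta>)) at_infinity (at (1::complex))"
        by (rule filterlim_compose[OF filterlim_inverse_at_infinity])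
      have lim: "((\<lambda>\<zeta>. of_real b * (1 + \<zeta>)) \<longlongrightarrow> of_real b * (1 + 1)) (at (1::complex))"
        by (intro tendsto_intros)
      have "filterlim (\<lambda>\<zeta>. (of_real b * (1 + \<zeta>)) * inverse (1 - \<zeta>)) at_infinity (at (1::complex))"
        using b by (intro tendsto_mult_filterlim_at_infinity[OF lim _ inf]) auto
      then have "filterlim (cayley b) at_infinity (at 1)"
        by (simp add: cayley_def[abs_def] divide_inverse)
      then have "((\<lambda>\<zeta>. ml_symbol (cayley b \<zeta>)) \<longlongrightarrow> 0) (at 1)"
        by (rule filterlim_compose[OF tendsto_ml_symbol])
      then have "(G \<longlongrightarrow> 0) (at 1)"
        by (rule Lim_transform_eventually) (auto simp: G_def eventually_at_filter)
      then show ?thesis using True by (auto simp: G_def intro: tendsto_within_subset)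
    qed
  qed
  have "(\<lambda>\<zeta>. ml_symbol (cayley b \<zeta>)) holomorphic_on ball 0 1"
  proof (rule holomorphic_on_compose_gen[OF _ holomorphic_on_ml_symbol, unfolded comp_def])
    show "cayley b holomorphic_on ball 0 1"
      unfolding cayley_def[abs_def] by (intro holomorphic_intros) auto
    show "cayley b ` ball 0 1 \<subseteq> {w. 0 < Re w}" using inH' by auto
  qed
  then have "G holomorphic_on ball 0 1"
    by (rule holomorphic_transform) (auto simp: G_def)
  from Cauchy_integral_circlepath[OF contG this, of 0]
  have "((\<lambda>u. G u / u) has_contour_integral (2 * of_real pi * \<i> * G 0)) (circlepath 0 1)" by simp
  then have "((\<lambda>x. G (circlepath 0 1 x) / circlepath 0 1 x * vector_derivative (circlepath 0 1) (at x within {0..1}))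
      has_integral (2 * of_real pi * \<i> * G 0)) {0..1}"
    by (simp add: has_contour_integral_def)
  then have "((\<lambda>x. 2 * of_real pi * \<i> * G (exp (2 * of_real pi * \<i> * of_real x)))
      has_integral (2 * of_real pi * \<i> * G 0)) {0..1}"
  proof (rule has_integral_eq[rotated])
    fix x :: real assume x: "x \<in> {0..1}"
    have vd: "vector_derivative (circlepath 0 1) (at x within {0..1}) = 2 * of_real pi * \<i> * exp (2 * of_real pi * \<i> * of_real x)"
      using vector_derivative_circlepath01[of x 0 1] x by simp
    show "G (circlepath 0 1 x) / circlepath 0 1 x * vector_derivative (circlepath 0 1) (at x within {0..1})
      = 2 * of_real pi * \<i> * G (exp (2 * of_real pi * \<i> * of_real x))"
      unfolding vd by (simp add: circlepath)
  qed
  then have "((\<lambda>x. inverse (2 * of_real pi * \<i>) * (2 * of_real pi * \<i> * G (exp (2 * of_real pi * \<i> * of_real x))))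
      has_integral inverse (2 * of_real pi * \<i>) * (2 * of_real pi * \<i> * G 0)) {0..1}"
    by (rule has_integral_mult_right)
  note scaled = this
  have cancel: "c \<noteq> 0 \<Longrightarrow> inverse c * (c * z) = z" for c z :: complex
    by simp
  have "inverse (2 * of_real pi * \<i>) * (2 * of_real pi * \<i> * z) = z" for z :: complex
    by (rule cancel) simp
  from scaled[unfolded this]
  have I: "((\<lambda>x. G (exp (2 * of_real pi * \<i> * of_real x))) has_integral G 0) {0..1}" .
  have G0: "G 0 = ml_symbol (of_real b)" by (simp add: G_def cayley_def)
  have gG: "g \<tau> = G (exp (2 * of_real pi * \<i> * of_real \<tau>))" if "\<tau> \<in> {0..1}" for \<tau>
  proof -
    have "exp (2 * of_real pi * \<i> * of_real \<tau>) = 1 \<longleftrightarrow> \<tau> \<in> {0, 1}"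
    proof -
      have "exp (2 * of_real pi * \<i> * of_real \<tau>) = (1::complex) \<longleftrightarrow> (\<exists>n::int. 2 * pi * \<tau> = of_int (2 * n) * pi)"
        by (simp add: exp_eq_1)
      also have "\<dots> \<longleftrightarrow> (\<exists>n::int. \<tau> = of_int n)"
        by (auto simp: field_simps)
      also have "\<dots> \<longleftrightarrow> \<tau> \<in> {0, 1}"
      proof
        assume "\<exists>n::int. \<tau> = of_int n"
        then obtain n :: int where n: "\<tau> = of_int n" by auto
        with that have "n = 0 \<or> n = 1" by auto
        with n show "\<tau> \<in> {0, 1}" by auto
      next
        assume "\<tau> \<in> {0, 1}"
        then show "\<exists>n::int. \<tau> = of_int n" by (auto intro: exI[of _ 0] exI[of _ 1])
      qed
      finally show ?thesis .
    qed
    then show ?thesis by (simp add: g_def G_def)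
  qed
  have "continuous_on {0..1} (\<lambda>\<tau>. G (exp (2 * of_real pi * \<i> * of_real \<tau>)))"
    by (rule continuous_on_compose2[OF contG]) (auto intro!: continuous_intros)
  then show "continuous_on {0..1} g"
    by (rule continuous_on_eq) (simp add: gG)
  show "(g has_integral ml_symbol (of_real b)) {0..1}"
    by (rule has_integral_eq[OF _ I[unfolded G0]]) (simp add: gG)
qed

text \<open>The arc that corresponds to the positive imaginary axis, parametrised by the point \<open>\<i> \<xi>\<close> itself.\<close>

lemma cayley_of_arctan:
  assumes "0 < b"
  shows "cayley b (exp (2 * of_real pi * \<i> * of_real (1 / 2 - arctan (\<xi> / b) / pi))) = \<i> * of_real \<xi>"
proof -
  define \<theta> where "\<theta> = arctan (\<xi> / b)"
  define z where "z = exp (\<i> * of_real \<theta>)"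
  have c: "cos \<theta> \<noteq> 0" unfolding \<theta>_def by (rule cos_arctan_not_zero)
  have t: "sin \<theta> = \<xi> / b * cos \<theta>"
    using tan_arctan[of "\<xi> / b"] c by (simp add: \<theta>_def tan_def field_simps)
  have zc: "z = Complex (cos \<theta>) (sin \<theta>)" "inverse z = Complex (cos \<theta>) (- sin \<theta>)"
    by (auto simp: z_def complex_eq_iff Re_exp Im_exp simp flip: exp_minus)
  have z: "z \<noteq> 0" "z * inverse z = 1" by (auto simp: z_def)
  have "exp (2 * of_real pi * \<i> * of_real (1 / 2 - \<theta> / pi)) = exp (of_real pi * \<i> + (- (\<i> * of_real \<theta>) + - (\<i> * of_real \<theta>)))"
    by (rule arg_cong[of _ _ exp]) (simp add: complex_eq_iff field_simps)
  also have "\<dots> = - (inverse z * inverse z)"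
    by (simp only: exp_add exp_minus exp_pi_i z_def) simp
  finally have e: "exp (2 * of_real pi * \<i> * of_real (1 / 2 - \<theta> / pi)) = - (inverse z * inverse z)" .
  have "cayley b (- (inverse z * inverse z)) = of_real b * (z - inverse z) / (z + inverse z)"
  proof -
    have "1 + - (inverse z * inverse z) = inverse z * (z - inverse z)" "1 - - (inverse z * inverse z) = inverse z * (z + inverse z)"
      using z(1) by (simp_all add: algebra_simps)
    then show ?thesis
      unfolding cayley_def using z(1) by simp
  qed
  also have "z + inverse z = of_real (2 * cos \<theta>)" by (simp add: zc complex_eq_iff)
  also have "z - inverse z = \<i> * of_real (2 * sin \<theta>)" by (simp add: zc complex_eq_iff)
  also have "of_real b * (\<i> * of_real (2 * sin \<theta>)) / of_real (2 * cos \<theta>) = \<i> * of_real (b * sin \<theta> / cos \<theta>)"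
    using c by simp
  also have "b * sin \<theta> / cos \<theta> = \<xi>" using c assms by (simp add: t)
  finally show ?thesis unfolding e \<theta>_def[symmetric] .
qed

lemma Re_ml_symbol_imaginary:
  assumes "0 < \<xi>"
  shows "Re (ml_symbol (\<i> * of_real \<xi>)) = ml_density \<xi>"
proof -
  let ?w = "\<i> * complex_of_real \<xi>"
  let ?s = "sin (pi * \<alpha> / 2)" and ?c = "cos (pi * \<alpha> / 2)"
  have ln: "Ln ?w = of_real (ln \<xi>) + \<i> * of_real (pi / 2)"
    using assms by (simp add: Ln_times_ii Ln_of_real)
  have pw: "?w powr of_real \<alpha> = of_real (\<xi> powr \<alpha>) * Complex ?c ?s"
    using assms by (simp add: powr_def ln complex_eq_iff Re_exp Im_exp algebra_simps)
  have pm: "?w powr of_real (\<alpha> - 1) = ?w powr of_real \<alpha> / ?w"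
    using assms powr_diff[of ?w "of_real \<alpha>" 1] by simp
  define y where "y = \<xi> powr \<alpha>"
  have Re_div: "Re (z / ?w) = Im z / \<xi>" for z
    using assms by (simp add: Re_divide power2_eq_square)
  have "(y * c + 1)\<^sup>2 + (y * s)\<^sup>2 = y\<^sup>2 * (s\<^sup>2 + c\<^sup>2) + 2 * c * y + 1" for s c :: real
    by (simp add: power2_eq_square algebra_simps)
  then have D: "(y * ?c + 1)\<^sup>2 + (y * ?s)\<^sup>2 = 1 + 2 * ?c * y + y\<^sup>2"
    by simp
  have "ml_symbol ?w = (of_real y * Complex ?c ?s) / (of_real y * Complex ?c ?s + 1) / ?w"
    by (simp add: ml_symbol_def pm pw y_def flip: of_real_diff)
  also have "of_real y * Complex ?c ?s = Complex (y * ?c) (y * ?s)" by (simp add: complex_eq_iff)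
  also have "Re (Complex (y * ?c) (y * ?s) / (Complex (y * ?c) (y * ?s) + 1) / ?w)
     = Im (Complex (y * ?c) (y * ?s) / (Complex (y * ?c) (y * ?s) + 1)) / \<xi>"
    by (rule Re_div)
  also have "Im (Complex (y * ?c) (y * ?s) / (Complex (y * ?c) (y * ?s) + 1)) = y * ?s / ((y * ?c + 1)\<^sup>2 + (y * ?s)\<^sup>2)"
    by (simp add: Im_divide) (simp add: algebra_simps)
  finally have "Re (ml_symbol ?w) = y * ?s / (1 + 2 * ?c * y + y\<^sup>2) / \<xi>" by (simp only: D)
  then show ?thesis
    using assms by (simp add: y_def powr_diff ml_density_def ml_denom_def mult_ac)
qed

lemma has_derivative_arctan_param:
  assumes "0 < b"
  shows "((\<lambda>\<xi>. 1 / 2 - arctan (\<xi> / b) / pi) has_real_derivative - (1 / pi) * (b / (b\<^sup>2 + \<xi>\<^sup>2))) (at \<xi> within S)"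
proof -
  have "((\<lambda>\<xi>. 1 / 2 - arctan (\<xi> / b) / pi) has_real_derivative 0 - inverse (1 + (\<xi> / b)\<^sup>2) * (1 / b) / pi) (at \<xi> within S)"
    by (intro DERIV_diff DERIV_const DERIV_cdivide DERIV_chain2[OF DERIV_arctan] DERIV_ident)
  moreover have "b * b + \<xi> * \<xi> \<noteq> 0"
    using assms by (intro less_imp_neq[symmetric] add_pos_nonneg) auto
  then have "inverse (1 + (\<xi> / b)\<^sup>2) * (1 / b) = b / (b\<^sup>2 + \<xi>\<^sup>2)"
    using assms by (simp add: power2_eq_square field_simps)
  ultimately show ?thesis by (elim DERIV_cong) simp
qed

text \<open>Poisson's formula for the half-plane: the mean over the circle, rewritten as an integral along the imaginary
  axis. Conjugation symmetry reduces it to the positive half of the axis.\<close>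

lemma poisson_ml_symbol:
  assumes b: "0 < b"
  shows "(LINT \<xi>|leb_pos. b / (b\<^sup>2 + \<xi>\<^sup>2) * ml_density \<xi>) = pi / 2 * (b powr (\<alpha> - 1) / (b powr \<alpha> + 1))"
proof -
  define g where "g \<tau> = (if \<tau> \<in> {0, 1} then 0 else ml_symbol (cayley b (exp (2 * of_real pi * \<i> * of_real \<tau>))))" for \<tau>
  define m where "m = b powr (\<alpha> - 1) / (b powr \<alpha> + 1)"
  have cg: "continuous_on {0..1} g" and Ig: "(g has_integral ml_symbol (of_real b)) {0..1}"
    using circle_mean_ml_symbol[OF b] by (simp_all add: g_def[abs_def])
  have mb: "ml_symbol (of_real b) = of_real m"
    using b by (simp add: ml_symbol_def m_def powr_of_real flip: of_real_diff)
  define r where "r \<tau> = Re (g \<tau>)" for \<tau>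
  have cr: "continuous_on {0..1} r" unfolding r_def[abs_def] using cg by (intro continuous_intros)
  have Ir: "(r has_integral m) {0..1}"
    using has_integral_linear[OF Ig bounded_linear_Re] by (simp add: mb r_def[abs_def] comp_def)
  \<comment> \<open>The symbol commutes with conjugation, which on the circle is the reflection \<open>\<tau> \<mapsto> 1 - \<tau>\<close>.\<close>
  have sym: "r (1 - \<tau>) = r \<tau>" for \<tau>
  proof (cases "\<tau> \<in> {0, 1}")
    case False
    have cnj_sym: "ml_symbol (cnj w) = cnj (ml_symbol w)" if "0 \<le> Re w" for w
    proof (cases "w = 0")
      case False
      have "w \<notin> \<real>\<^sub>\<le>\<^sub>0" using that False by (auto simp: complex_nonpos_Reals_iff complex_eq_iff)
      then show ?thesis using that by (simp add: ml_symbol_def powr_def cnj_Ln exp_cnj)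
    qed (simp add: ml_symbol_def)
    have "exp (2 * of_real pi * \<i> * of_real (1 - \<tau>)) = cnj (exp (2 * of_real pi * \<i> * of_real \<tau>))"
      by (simp add: complex_eq_iff Re_exp Im_exp right_diff_distrib cos_diff sin_diff)
    moreover have "cayley b (cnj \<zeta>) = cnj (cayley b \<zeta>)" for \<zeta> by (simp add: cayley_def)
    moreover have "0 \<le> Re (cayley b (exp (2 * of_real pi * \<i> * of_real \<tau>)))"
      by (simp add: Re_cayley)
    ultimately show ?thesis using False by (simp add: r_def g_def cnj_sym)
  qed (auto simp: r_def g_def)
  have ir: "r integrable_on {0..1/2}" "r integrable_on {1/2..1}"
    using cr by (auto intro!: integrable_continuous_interval elim: continuous_on_subset)
  have "integral {1/2..1} r = integral {0..1/2} r"
  proof -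
    have "((\<lambda>x. r (1 - x)) has_integral integral {0..1/2} r) {1/2..1}"
      using has_integral_affinity[OF integrable_integral[OF ir(1), unfolded box_real(2)[symmetric]],
          where m = "-1" and c = 1] image_affinity_atLeastAtMost[of "-1" 1 0 "1/2::real"]
      by (simp add: image_affinity_atLeastAtMost algebra_simps)
    then show ?thesis by (simp add: sym integral_unique)
  qed
  moreover have "integral {0..1/2} r + integral {1/2..1} r = m"
    using Ir Henstock_Kurzweil_Integration.integral_combine[where a = 0 and c = "1/2" and b = 1 and f = r] by (simp add: has_integral_integrable_integral)
  ultimately have half: "integral {0..1/2} r = m / 2" by simp
  have abs: "r absolutely_integrable_on {0<..<1/2}"
  proof -
    have "r absolutely_integrable_on {0..1/2}"
      using cr by (intro absolutely_integrable_continuous_real) (auto elim: continuous_on_subset)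
    then show ?thesis by (rule set_integrable_subset) auto
  qed
  have halfo: "integral {0<..<1/2} r = m / 2"
    using half by (simp add: integral_open_interval_real)
  let ?p = "\<lambda>\<xi>. 1 / 2 - arctan (\<xi> / b) / pi"
  have img: "?p ` {0<..} = {0<..<1/2}"
  proof safe
    fix \<xi> :: real assume "0 < \<xi>"
    then have "0 < arctan (\<xi> / b)" "arctan (\<xi> / b) < pi / 2" using b arctan_ubound by auto
    then show "?p \<xi> \<in> {0<..<1/2}" by (auto simp: field_simps)
  next
    fix \<tau> :: real assume \<tau>: "\<tau> \<in> {0<..<1/2}"
    let ?\<theta> = "pi * (1 / 2 - \<tau>)"
    have r: "0 < ?\<theta>" "?\<theta> < pi / 2" using \<tau> by auto
    have "arctan (tan ?\<theta>) = ?\<theta>" by (rule arctan_tan) (use r in linarith)+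
    then have "arctan (b * tan ?\<theta> / b) = ?\<theta>" using b by simp
    then have "?p (b * tan ?\<theta>) = \<tau>" by simp
    then have p: "\<tau> = ?p (b * tan ?\<theta>)" ..
    have "0 < b * tan ?\<theta>" by (intro mult_pos_pos tan_gt_zero b r)
    then have "b * tan ?\<theta> \<in> {0<..}" unfolding greaterThan_iff .
    with p show "\<tau> \<in> ?p ` {0<..}" by (rule image_eqI)
  qed
  have inj: "inj_on ?p {0<..}"
    using b by (auto simp: inj_on_def arctan_eq_iff)
  have key: "(\<lambda>x. \<bar>- (1 / pi) * (b / (b\<^sup>2 + x\<^sup>2))\<bar> * r (?p x)) absolutely_integrable_on {0<..} \<and>
      integral {0<..} (\<lambda>x. \<bar>- (1 / pi) * (b / (b\<^sup>2 + x\<^sup>2))\<bar> * r (?p x)) = m / 2"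
    using abs halfo unfolding img[symmetric]
    by (subst has_absolute_integral_change_of_variables_1'[OF _ has_derivative_arctan_param[OF b] inj]) auto
  have eq: "\<bar>- (1 / pi) * (b / (b\<^sup>2 + x\<^sup>2))\<bar> * r (?p x) = 1 / pi * (b / (b\<^sup>2 + x\<^sup>2) * ml_density x)"
    if "0 < x" for x
  proof -
    have "?p x \<in> {0<..<1/2}" using img that by blast
    then have "r (?p x) = ml_density x"
      using cayley_of_arctan[OF b, of x] Re_ml_symbol_imaginary[OF that] by (auto simp: r_def g_def)
    moreover have "\<bar>- (1 / pi) * (b / (b\<^sup>2 + x\<^sup>2))\<bar> = 1 / pi * (b / (b\<^sup>2 + x\<^sup>2))"
      using b by (simp add: abs_mult)
    ultimately show ?thesis by (simp only: mult.assoc)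
  qed
  let ?k = "\<lambda>x. 1 / pi * (b / (b\<^sup>2 + x\<^sup>2) * ml_density x)"
  have k: "?k absolutely_integrable_on {0<..}" "integral {0<..} ?k = m / 2"
  proof -
    have "?k absolutely_integrable_on {0<..} \<longleftrightarrow> (\<lambda>x. \<bar>- (1 / pi) * (b / (b\<^sup>2 + x\<^sup>2))\<bar> * r (?p x)) absolutely_integrable_on {0<..}"
      by (rule set_integrable_cong[OF refl refl]) (simp only: eq greaterThan_iff)
    then show "?k absolutely_integrable_on {0<..}" using key by (rule iffD2[OF _ conjunct1])
    have "integral {0<..} ?k = integral {0<..} (\<lambda>x. \<bar>- (1 / pi) * (b / (b\<^sup>2 + x\<^sup>2))\<bar> * r (?p x))"
      by (rule Henstock_Kurzweil_Integration.integral_cong) (simp only: eq greaterThan_iff)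
    then show "integral {0<..} ?k = m / 2" using key by (rule trans[OF _ conjunct2])
  qed
  have "set_borel_measurable borel {0<..} ?k"
    by (simp add: set_borel_measurable_def)
  then have "set_integrable lborel {0<..} ?k"
    using k(1) by (simp add: set_integrable_def set_borel_measurable_def integrable_completion)
  then have "(LINT x:{0<..}|lborel. ?k x) = m / 2"
    using k(2) by (simp add: set_borel_integral_eq_integral)
  moreover have "(LINT x|leb_pos. ?k x) = 1 / pi * (LINT x|leb_pos. b / (b\<^sup>2 + x\<^sup>2) * ml_density x)"
    by (rule Bochner_Integration.integral_mult_right_zero)
  ultimately have "1 / pi * (LINT x|leb_pos. b / (b\<^sup>2 + x\<^sup>2) * ml_density x) = m / 2"
    by (simp only: integral_leb_pos_eq)
  then have "pi * (1 / pi * (LINT x|leb_pos. b / (b\<^sup>2 + x\<^sup>2) * ml_density x)) = pi * (m / 2)"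
    by (simp only:)
  then show ?thesis unfolding m_def[symmetric] by simp
qed

text \<open>The Laplace transform of \<open>x \<mapsto> cos (x \<xi>)\<close> is the Poisson kernel.\<close>

lemma laplace_mittag_leffler:
  assumes b: "0 < b"
  shows "(LINT x|leb_pos. exp (- b * x) * mittag_leffler x) = b powr (\<alpha> - 1) / (b powr \<alpha> + 1)"
proof -
  let ?f = "\<lambda>(x, \<xi>). exp (- b * x) * (cos (x * \<xi>) * ml_density \<xi>)"
  have int: "integrable (leb_pos \<Otimes>\<^sub>M leb_pos) ?f"
  proof (rule leb_pos_pair.Fubini_integrable)
    show m: "?f \<in> borel_measurable (leb_pos \<Otimes>\<^sub>M leb_pos)"
      by (rule borel_measurable_leb_pos_pair) measurable
    have i: "integrable leb_pos (\<lambda>\<xi>. exp (- b * x) * (cos (x * \<xi>) * ml_density \<xi>))" for x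
      using integrable_cos_ml_density[of x] by simp
    then show "AE x in leb_pos. integrable leb_pos (\<lambda>\<xi>. ?f (x, \<xi>))" by simp
    show "integrable leb_pos (\<lambda>x. LINT \<xi>|leb_pos. norm (?f (x, \<xi>)))"
    proof (rule integrable_leb_pos_bound)
      show "integrable leb_pos (\<lambda>x. exp (- b * x) * (LINT \<xi>|leb_pos. ml_density \<xi>))"
        using laplace_integrals(1)[OF b] by simp
      show "(\<lambda>x. LINT \<xi>|leb_pos. norm (?f (x, \<xi>))) \<in> borel_measurable leb_pos"
        using m by (intro leb_pos.borel_measurable_lebesgue_integral) (simp add: split_beta')
      fix x :: real assume "0 < x"
      have "(LINT \<xi>|leb_pos. norm (?f (x, \<xi>))) \<le> (LINT \<xi>|leb_pos. exp (- b * x) * ml_density \<xi>)"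
      proof (rule integral_mono_AE)
        show "integrable leb_pos (\<lambda>\<xi>. norm (?f (x, \<xi>)))" using i[of x] by (simp only: prod.case integrable_norm)
        show "AE \<xi> in leb_pos. norm (?f (x, \<xi>)) \<le> exp (- b * x) * ml_density \<xi>"
          using ml_density_nonneg by (intro AE_leb_pos) (auto simp: abs_mult intro!: mult_left_le_one_le)
      qed (use integrable_ml_density in simp)
      then show "norm (LINT \<xi>|leb_pos. norm (?f (x, \<xi>))) \<le> exp (- b * x) * (LINT \<xi>|leb_pos. ml_density \<xi>)"
        by simp
    qed
  qed
  have "(LINT x|leb_pos. exp (- b * x) * mittag_leffler x)
      = (LINT x|leb_pos. 2 / pi * (LINT \<xi>|leb_pos. exp (- b * x) * (cos (x * \<xi>) * ml_density \<xi>)))"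
    by (rule Bochner_Integration.integral_cong[OF refl]) (simp add: mittag_leffler_def)
  also have "\<dots> = 2 / pi * (LINT x|leb_pos. (LINT \<xi>|leb_pos. exp (- b * x) * (cos (x * \<xi>) * ml_density \<xi>)))"
    by simp
  also have "(LINT x|leb_pos. (LINT \<xi>|leb_pos. exp (- b * x) * (cos (x * \<xi>) * ml_density \<xi>)))
      = (LINT \<xi>|leb_pos. (LINT x|leb_pos. exp (- b * x) * (cos (x * \<xi>) * ml_density \<xi>)))"
    using leb_pos_pair.Fubini_integral[OF int] by simp
  also have "\<dots> = (LINT \<xi>|leb_pos. b / (b\<^sup>2 + \<xi>\<^sup>2) * ml_density \<xi>)"
  proof (rule Bochner_Integration.integral_cong[OF refl])
    fix \<xi>
    have "(LINT x|leb_pos. exp (- b * x) * (cos (x * \<xi>) * ml_density \<xi>))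
        = (LINT x|leb_pos. (exp (- b * x) * cos (x * \<xi>)) * ml_density \<xi>)" by (simp only: mult.assoc)
    also have "\<dots> = (LINT x|leb_pos. exp (- b * x) * cos (x * \<xi>)) * ml_density \<xi>" by simp
    finally show "(LINT x|leb_pos. exp (- b * x) * (cos (x * \<xi>) * ml_density \<xi>)) = b / (b\<^sup>2 + \<xi>\<^sup>2) * ml_density \<xi>"
      using laplace_integrals(3)[OF b, of \<xi>] by simp
  qed
  also have "\<dots> = pi / 2 * (b powr (\<alpha> - 1) / (b powr \<alpha> + 1))" by (rule poisson_ml_symbol[OF b])
  finally show ?thesis by (simp only: mult.assoc[symmetric]) simp
qed

end

section \<open>Completeness of the eigenfunctions\<close>

lemma integrable_inverse_1_plus_square_leb_pos: "integrable leb_pos (\<lambda>x. 1 / (1 + x\<^sup>2))"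
proof (rule FTC_leb_pos(1)[where F = arctan and A = 0 and B = "pi / 2"])
  show "(arctan has_real_derivative 1 / (1 + x\<^sup>2)) (at x)" for x
    using DERIV_arctan[of x] by (simp add: inverse_eq_divide)
  show "isCont (\<lambda>x. 1 / (1 + x\<^sup>2)) x" for x :: real
  proof -
    have "1 + x\<^sup>2 \<noteq> 0" using zero_le_power2[of x] by linarith
    then show ?thesis by (intro continuous_intros) auto
  qed
  have "(arctan \<longlongrightarrow> arctan 0) (at_right 0)" by (intro tendsto_intros)
  then show "(arctan \<longlongrightarrow> 0) (at_right 0)" by simp
  show "(arctan \<longlongrightarrow> pi / 2) at_top" by (rule tendsto_arctan_at_top)
qed simp

text \<open>The second part is the Cauchy-Schwarz inequality before optimising over the weight \<open>s\<close>. Choosing \<open>s\<close> as an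
  explicit function of a parameter keeps square roots of integrals out of the estimates.\<close>

lemma integrable_mult_square_integrable:
  fixes g :: "real \<Rightarrow> complex" and k :: "real \<Rightarrow> real"
  assumes g: "square_integrable g" and k: "k \<in> borel_measurable leb_pos" "integrable leb_pos (\<lambda>x. (k x)\<^sup>2)"
  shows "integrable leb_pos (\<lambda>x. of_real (k x) * g x)"
    and "0 < s \<Longrightarrow> (LINT x|leb_pos. \<bar>k x\<bar> * norm (g x)) \<le> s / 2 * (LINT x|leb_pos. (k x)\<^sup>2) + 1 / (2 * s) * (LINT x|leb_pos. (norm (g x))\<^sup>2)"
proof -
  have gi: "g \<in> borel_measurable leb_pos" "integrable leb_pos (\<lambda>x. (norm (g x))\<^sup>2)"
    using g by (auto simp: square_integrable_def)
  have b: "\<bar>k x\<bar> * norm (g x) \<le> s / 2 * (k x)\<^sup>2 + 1 / (2 * s) * (norm (g x))\<^sup>2" if "0 < s" for x s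
  proof -
    have "0 \<le> (s * \<bar>k x\<bar> - norm (g x))\<^sup>2 / (2 * s)" using that by simp
    also have "(s * \<bar>k x\<bar> - norm (g x))\<^sup>2 / (2 * s) = s / 2 * (\<bar>k x\<bar>)\<^sup>2 + 1 / (2 * s) * (norm (g x))\<^sup>2 - \<bar>k x\<bar> * norm (g x)"
      using that by (simp add: power2_diff field_simps) (simp add: power2_eq_square)
    finally show ?thesis by simp
  qed
  show i: "integrable leb_pos (\<lambda>x. of_real (k x) * g x)"
  proof (rule integrable_leb_pos_bound)
    show "integrable leb_pos (\<lambda>x. 1 / 2 * (k x)\<^sup>2 + 1 / (2 * 1) * (norm (g x))\<^sup>2)" using gi k by simp
    show "(\<lambda>x. of_real (k x) * g x) \<in> borel_measurable leb_pos" using gi k by measurable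
  qed (use b[of 1] in \<open>simp add: norm_mult\<close>)
  assume s: "0 < s"
  have "(LINT x|leb_pos. \<bar>k x\<bar> * norm (g x)) \<le> (LINT x|leb_pos. s / 2 * (k x)\<^sup>2 + 1 / (2 * s) * (norm (g x))\<^sup>2)"
  proof (rule integral_mono_AE)
    show "integrable leb_pos (\<lambda>x. \<bar>k x\<bar> * norm (g x))"
      using integrable_norm[OF i] by (simp add: norm_mult)
    show "integrable leb_pos (\<lambda>x. s / 2 * (k x)\<^sup>2 + 1 / (2 * s) * (norm (g x))\<^sup>2)" using gi k by simp
  qed (use b[OF s] in simp)
  then show "(LINT x|leb_pos. \<bar>k x\<bar> * norm (g x)) \<le> s / 2 * (LINT x|leb_pos. (k x)\<^sup>2) + 1 / (2 * s) * (LINT x|leb_pos. (norm (g x))\<^sup>2)"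
    using gi k by simp
qed

text \<open>With \<open>u = 1 / (1 + x\<^sup>\<alpha>)\<close>, a decreasing function of \<open>x\<close>, partial fractions express \<open>u ^ Suc n / (\<mu> + x\<^sup>\<alpha>)\<close> through
  \<open>u ^ Suc n\<close> and \<open>u ^ n / (\<mu> + x\<^sup>\<alpha>)\<close> when \<open>\<mu> \<noteq> 1\<close>, and \<open>\<mu> = 1\<close> follows by dominated convergence. So all integrals
  of \<open>g\<close> against \<open>u ^ Suc n\<close> vanish, and these are the moments of \<open>u * g\<close> with respect to \<open>u\<close>.\<close>

lemma vanishing_stieltjes_transform:
  fixes g :: "real \<Rightarrow> complex" and \<alpha> :: real
  assumes g: "square_integrable g" and \<alpha>: "1 < \<alpha>"
    and z: "\<And>\<mu>. 0 < \<mu> \<Longrightarrow> (LINT x|leb_pos. g x / of_real (\<mu> + x powr \<alpha>)) = 0"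
  shows "AE x in leb_pos. g x = 0"
proof -
  define u where "u x = 1 / (1 + x powr \<alpha>)" for x
  have u: "0 < u x" "u x \<le> 1" for x :: real
  proof -
    have "0 < 1 + x powr \<alpha>" by (intro add_pos_nonneg) auto
    then show "0 < u x" "u x \<le> 1" by (simp_all add: u_def pos_divide_le_eq)
  qed
  have umeas: "u \<in> borel_measurable leb_pos"
    unfolding u_def[abs_def] by (rule borel_measurable_leb_pos) measurable
  have u2: "integrable leb_pos (\<lambda>x. (u x)\<^sup>2)"
  proof (rule integrable_leb_pos_bound)
    show "integrable leb_pos (\<lambda>x. 2 * (1 / (1 + x\<^sup>2)))"
      by (intro Bochner_Integration.integrable_mult_right integrable_inverse_1_plus_square_leb_pos)
    fix x :: real assume x: "0 < x"
    have "1 + x\<^sup>2 \<le> 2 * (1 + x powr \<alpha>)\<^sup>2"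
    proof (cases "x \<le> 1")
      case True
      then have "x\<^sup>2 \<le> 1" using x by (simp add: power_le_one)
      moreover have "1 \<le> (1 + x powr \<alpha>)\<^sup>2" by (intro one_le_power) simp
      ultimately show ?thesis by linarith
    next
      case False
      then have "x powr 1 \<le> x powr \<alpha>" using \<alpha> by (intro powr_mono) auto
      then have "x \<le> 1 + x powr \<alpha>" using x by simp
      then have "x\<^sup>2 \<le> (1 + x powr \<alpha>)\<^sup>2" using x by (intro power_mono) auto
      moreover have "1 \<le> (1 + x powr \<alpha>)\<^sup>2" by (intro one_le_power) simp
      ultimately show ?thesis by linarith
    qed
    moreover have "0 < 1 + x powr \<alpha>" "0 < 1 + x\<^sup>2"
      by (intro add_pos_nonneg; simp)+
    moreover from this have "0 < (1 + x powr \<alpha>)\<^sup>2" by (intro zero_less_power)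
    ultimately show "norm ((u x)\<^sup>2) \<le> 2 * (1 / (1 + x\<^sup>2))"
      by (simp add: u_def power_divide field_simps)
  qed (use umeas in measurable)
  have gu: "integrable leb_pos (\<lambda>x. of_real (u x) * g x)"
    by (rule integrable_mult_square_integrable(1)[OF g umeas u2])
  define r where "r n \<mu> x = u x ^ n / (\<mu> + x powr \<alpha>)" for n and \<mu> x :: real
  have rb: "\<bar>r n \<mu> x / u x\<bar> \<le> max 1 (1 / \<mu>)" if "0 < \<mu>" for n \<mu> x
  proof -
    have p: "0 < \<mu> + x powr \<alpha>" "0 < 1 + x powr \<alpha>" using that by (auto intro: add_pos_nonneg)
    have "(1 + x powr \<alpha>) \<le> max 1 (1 / \<mu>) * (\<mu> + x powr \<alpha>)"
    proof -
      have "1 \<le> max 1 (1 / \<mu>) * \<mu>" using that by (auto simp: max_def field_simps)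
      moreover have "1 * x powr \<alpha> \<le> max 1 (1 / \<mu>) * x powr \<alpha>" by (intro mult_right_mono) auto
      ultimately show ?thesis by (simp add: distrib_left)
    qed
    then have "1 / (\<mu> + x powr \<alpha>) / u x \<le> max 1 (1 / \<mu>)"
      using p by (simp add: u_def pos_divide_le_eq)
    moreover have "u x ^ n \<le> 1" using u[of x] by (auto intro: power_le_one)
    then have "u x ^ n * (1 / (\<mu> + x powr \<alpha>) / u x) \<le> 1 * (1 / (\<mu> + x powr \<alpha>) / u x)"
      using p u[of x] by (intro mult_right_mono) auto
    ultimately have "u x ^ n * (1 / (\<mu> + x powr \<alpha>) / u x) \<le> max 1 (1 / \<mu>)" by linarith
    moreover have "0 \<le> u x ^ n * (1 / (\<mu> + x powr \<alpha>) / u x)" using p u[of x] by simp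
    moreover have "r n \<mu> x / u x = u x ^ n * (1 / (\<mu> + x powr \<alpha>) / u x)" by (simp add: r_def)
    ultimately show ?thesis by linarith
  qed
  have rmeas: "r n \<mu> \<in> borel_measurable leb_pos" for n \<mu>
    unfolding r_def[abs_def] u_def[abs_def] by (rule borel_measurable_leb_pos) measurable
  have ri: "integrable leb_pos (\<lambda>x. of_real (r n \<mu> x) * g x)" if "0 < \<mu>" for n \<mu>
  proof -
    have "integrable leb_pos (\<lambda>x. of_real (r n \<mu> x / u x) * (of_real (u x) * g x))"
      using rb[OF that] rmeas umeas
      by (intro integrable_leb_pos_bounded_mult[OF gu, where B = "max 1 (1 / \<mu>)"]) (auto simp: norm_divide)
    moreover have "of_real (r n \<mu> x / u x) * (of_real (u x) * g x) = of_real (r n \<mu> x) * g x" for x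
      using u[of x] by simp
    ultimately show ?thesis by simp
  qed
  have main: "\<forall>\<mu>>0. (LINT x|leb_pos. of_real (r n \<mu> x) * g x) = 0" for n
  proof (induction n)
    case 0
    show ?case using z by (simp add: r_def field_simps)
  next
    case (Suc n)
    have ne: "(LINT x|leb_pos. of_real (r (Suc n) \<mu> x) * g x) = 0" if \<mu>: "0 < \<mu>" "\<mu> \<noteq> 1" for \<mu>
    proof -
      have "of_real (r (Suc n) \<mu> x) * g x = (1 / of_real (\<mu> - 1)) * (of_real (r n 1 x) * g x - of_real (r n \<mu> x) * g x)" for x
      proof -
        have p: "0 < \<mu> + x powr \<alpha>" "0 < 1 + x powr \<alpha>" using \<mu> by (auto intro: add_pos_nonneg)
        have "u x * (1 / (\<mu> + x powr \<alpha>)) = 1 / (\<mu> - 1) * (1 / (1 + x powr \<alpha>) - 1 / (\<mu> + x powr \<alpha>))"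
        proof -
          have "1 / (1 + x powr \<alpha>) - 1 / (\<mu> + x powr \<alpha>) = (\<mu> - 1) / ((1 + x powr \<alpha>) * (\<mu> + x powr \<alpha>))"
            using p by (simp add: diff_frac_eq)
          then show ?thesis using \<mu> by (simp add: u_def)
        qed
        then have "u x ^ n * (u x * (1 / (\<mu> + x powr \<alpha>))) = u x ^ n * (1 / (\<mu> - 1) * (1 / (1 + x powr \<alpha>) - 1 / (\<mu> + x powr \<alpha>)))"
          by simp
        then have "r (Suc n) \<mu> x = 1 / (\<mu> - 1) * (r n 1 x - r n \<mu> x)"
          by (simp add: r_def right_diff_distrib mult_ac)
        then show ?thesis by (simp add: left_diff_distrib)
      qed
      then have "(LINT x|leb_pos. of_real (r (Suc n) \<mu> x) * g x)
        = (1 / of_real (\<mu> - 1)) * (LINT x|leb_pos. of_real (r n 1 x) * g x - of_real (r n \<mu> x) * g x)"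
        by (simp only: integral_mult_right_zero)
      then show ?thesis using \<mu> Suc.IH ri[of 1 n] ri[of \<mu> n] by simp
    qed
    moreover have "(LINT x|leb_pos. of_real (r (Suc n) 1 x) * g x) = 0"
    proof -
      let ?m = "\<lambda>k. 1 + 1 / real (Suc k)"
      have lim: "?m \<longlonglongrightarrow> 1"
        using tendsto_add[OF tendsto_const LIMSEQ_Suc[OF lim_1_over_n], of 1] by simp
      have "(\<lambda>k. LINT x|leb_pos. of_real (r (Suc n) (?m k) x) * g x) \<longlonglongrightarrow> (LINT x|leb_pos. of_real (r (Suc n) 1 x) * g x)"
      proof (rule integral_dominated_convergence[where w = "\<lambda>x. norm (of_real (u x) * g x)"])
        show "AE x in leb_pos. (\<lambda>k. of_real (r (Suc n) (?m k) x) * g x) \<longlonglongrightarrow> of_real (r (Suc n) 1 x) * g x"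
        proof (rule AE_leb_pos)
          fix x :: real
          have "1 + x powr \<alpha> \<noteq> 0" using powr_ge_zero[of x \<alpha>] by linarith
          then show "(\<lambda>k. of_real (r (Suc n) (?m k) x) * g x) \<longlonglongrightarrow> of_real (r (Suc n) 1 x) * g x"
            unfolding r_def by (intro tendsto_intros lim)
        qed
        show "AE x in leb_pos. norm (of_real (r (Suc n) (?m k) x) * g x) \<le> norm (of_real (u x) * g x)" for k
        proof (rule AE_leb_pos)
          fix x :: real
          have "\<bar>r (Suc n) (?m k) x / u x\<bar> \<le> 1" using rb[of "?m k" "Suc n" x] by (simp add: add_pos_nonneg)
          then have "\<bar>r (Suc n) (?m k) x\<bar> \<le> u x" using u[of x] by (simp add: abs_divide pos_divide_le_eq)
          then show "norm (of_real (r (Suc n) (?m k) x) * g x) \<le> norm (of_real (u x) * g x)"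
            using u[of x] by (simp add: norm_mult mult_right_mono)
        qed
      qed (use ri gu rmeas g in \<open>auto simp: square_integrable_def\<close>)
      moreover have "(LINT x|leb_pos. of_real (r (Suc n) (?m k) x) * g x) = 0" for k
        by (rule ne) (auto simp: add_pos_nonneg)
      ultimately show ?thesis using LIMSEQ_unique[OF _ tendsto_const[of 0]] by simp
    qed
    ultimately show ?case by metis
  qed
  have "AE x in leb_pos. of_real (u x) * g x = 0"
  proof (rule vanishing_moments[OF gu umeas])
    show "0 \<le> u x \<and> u x \<le> 1" for x using u[of x] by simp
    show "u y < u x" if "0 < x" "x < y" for x y
      unfolding u_def using that \<alpha> powr_less_mono2[of \<alpha> x y]
      by (intro divide_strict_left_mono mult_pos_pos add_pos_nonneg) auto
    fix n
    have "of_real (u x) * g x * of_real (u x) ^ n = of_real (r n 1 x) * g x" for x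
      by (simp add: r_def u_def mult_ac)
    then show "(LINT x|leb_pos. of_real (u x) * g x * of_real (u x) ^ n) = 0" using main[of n] by (simp only: zero_less_one)
  qed
  then show ?thesis by eventually_elim (use u in \<open>simp add: less_imp_neq[symmetric]\<close>)
qed

context
  fixes \<alpha> :: real
  assumes \<alpha>: "1 < \<alpha>" "\<alpha> < 2"
begin

abbreviation "J \<equiv> mittag_leffler \<alpha>"

lemma borel_measurable_mittag_leffler [measurable]: "J \<in> borel_measurable borel"
  by (rule borel_measurable_continuous_onI[OF continuous_mittag_leffler[OF \<alpha>]])

lemma integrable_mittag_leffler_square:
  assumes "0 < q"
  shows "integrable leb_pos (\<lambda>x. (J (q * x))\<^sup>2)"
proof (rule integrable_leb_pos_scale[OF assms])
  obtain B where B: "\<And>x. \<bar>J x\<bar> \<le> B" using mittag_leffler_bounded[OF \<alpha>] by blast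
  obtain C where C: "\<And>x. \<bar>x * J x\<bar> \<le> C" using mittag_leffler_decay[OF \<alpha>] by blast
  show "integrable leb_pos (\<lambda>x. (J x)\<^sup>2)"
  proof (rule integrable_leb_pos_bound)
    show "integrable leb_pos (\<lambda>x. (B\<^sup>2 + C\<^sup>2) * (1 / (1 + x\<^sup>2)))"
      by (intro Bochner_Integration.integrable_mult_right integrable_inverse_1_plus_square_leb_pos)
    show "(\<lambda>x. (J x)\<^sup>2) \<in> borel_measurable leb_pos" by (rule borel_measurable_leb_pos) measurable
    fix x :: real
    have "(J x)\<^sup>2 \<le> B\<^sup>2" "(x * J x)\<^sup>2 \<le> C\<^sup>2"
      using power_mono[OF B[of x], of 2] power_mono[OF C[of x], of 2] by simp_all
    then have "(1 + x\<^sup>2) * (J x)\<^sup>2 \<le> B\<^sup>2 + C\<^sup>2" by (simp add: power_mult_distrib algebra_simps)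
    moreover have "0 < 1 + x\<^sup>2" by (simp add: add_pos_nonneg)
    ultimately show "norm ((J x)\<^sup>2) \<le> (B\<^sup>2 + C\<^sup>2) * (1 / (1 + x\<^sup>2))"
      by (simp add: field_simps)
  qed
qed

lemma square_integrable_mittag_leffler:
  "0 < q \<Longrightarrow> square_integrable (\<lambda>x. of_real (J (q * x)))"
  unfolding square_integrable_def using integrable_mittag_leffler_square[of q]
  by (auto intro!: borel_measurable_leb_pos)

lemma laplace_mittag_leffler_scale:
  assumes "0 < b" "0 < q"
  shows "(LINT x|leb_pos. exp (- b * x) * J (q * x)) = b powr (\<alpha> - 1) / (b powr \<alpha> + q powr \<alpha>)"
proof -
  have "(LINT x|leb_pos. exp (- b * x) * J (q * x)) = (LINT x|leb_pos. (\<lambda>x. exp (- (b / q) * x) * J x) (q * x))"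
    using assms by simp
  also have "\<dots> = 1 / q * (LINT x|leb_pos. exp (- (b / q) * x) * J x)"
    by (subst integral_leb_pos_scale[OF assms(2)]) simp
  also have "\<dots> = 1 / q * ((b / q) powr (\<alpha> - 1) / ((b / q) powr \<alpha> + 1))"
    using assms by (subst laplace_mittag_leffler[OF \<alpha>]) auto
  also have "\<dots> = b powr (\<alpha> - 1) / (b powr \<alpha> + q powr \<alpha>)"
  proof -
    have "0 < q powr \<alpha>" using assms by simp
    have "(b / q) powr \<alpha> + 1 = (b powr \<alpha> + q powr \<alpha>) / q powr \<alpha>"
      using assms by (simp add: powr_divide field_simps)
    moreover have "1 / q * (b / q) powr (\<alpha> - 1) = b powr (\<alpha> - 1) / q powr \<alpha>"
      using assms by (simp add: powr_divide powr_diff)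
    moreover have "1 / q * ((b / q) powr (\<alpha> - 1) / ((b / q) powr \<alpha> + 1)) = (1 / q * (b / q) powr (\<alpha> - 1)) / ((b / q) powr \<alpha> + 1)"
      by simp
    ultimately show ?thesis using \<open>0 < q powr \<alpha>\<close> by (simp only:) simp
  qed
  finally show ?thesis .
qed

text \<open>Integrating the hypothesis against \<open>exp (- p q)\<close> in the dilation parameter \<open>q\<close> replaces the Mittag-Leffler function
  by its Laplace transform and leaves the Stieltjes transform of \<open>g\<close> in the variable \<open>x\<^sup>\<alpha>\<close>. By scaling, the inner
  integral of the absolute values is of order \<open>q powr (- 1 / 2)\<close>, which is why the order of integration may be exchanged.\<close>

theorem mittag_leffler_complete:
  assumes g: "square_integrable g"
    and z: "AE q in leb_pos. (LINT x|leb_pos. of_real (J (q * x)) * g x) = 0"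
  shows "AE x in leb_pos. g x = 0"
proof (rule vanishing_stieltjes_transform[OF g \<alpha>(1)])
  fix \<mu> :: real assume \<mu>: "0 < \<mu>"
  define p where "p = \<mu> powr (1 / \<alpha>)"
  have p: "0 < p" "p powr \<alpha> = \<mu>" using \<mu> \<alpha> by (auto simp: p_def powr_powr)
  have gm: "g \<in> borel_measurable leb_pos" and gi: "integrable leb_pos (\<lambda>x. (norm (g x))\<^sup>2)"
    using g by (auto simp: square_integrable_def)
  let ?f = "\<lambda>(q, x). of_real (exp (- p * q) * J (q * x)) * g x"
  have fm: "?f \<in> borel_measurable (leb_pos \<Otimes>\<^sub>M leb_pos)"
  proof -
    have "(\<lambda>(q, x). complex_of_real (exp (- p * q) * J (q * x))) \<in> borel_measurable (leb_pos \<Otimes>\<^sub>M leb_pos)"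
      by (rule borel_measurable_leb_pos_pair) measurable
    from borel_measurable_times[OF this measurable_compose[OF measurable_snd gm]]
    show ?thesis by (simp add: split_beta')
  qed
  have sm: "(\<lambda>x. J (q * x)) \<in> borel_measurable leb_pos" for q
    by (rule borel_measurable_leb_pos) measurable
  note J2 = integrable_mittag_leffler_square
  have ijg: "integrable leb_pos (\<lambda>x. of_real (J (q * x)) * g x)" if "0 < q" for q
    by (rule integrable_mult_square_integrable(1)[OF g sm J2[OF that]])
  define K where "K = 1 / 2 * (LINT x|leb_pos. (J x)\<^sup>2) + 1 / 2 * (LINT x|leb_pos. (norm (g x))\<^sup>2)"
  have K: "0 \<le> K" by (simp add: K_def)
  have bound: "(LINT x|leb_pos. \<bar>J (q * x)\<bar> * norm (g x)) \<le> K * q powr (- 1 / 2)" if q: "0 < q" for q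
  proof -
    let ?s = "q powr (1 / 2)"
    have s: "?s / 2 * (1 / q) = 1 / 2 * q powr (- 1 / 2)"
      using q powr_diff[of q "1/2" 1] by simp
    have "(LINT x|leb_pos. \<bar>J (q * x)\<bar> * norm (g x))
      \<le> ?s / 2 * (LINT x|leb_pos. (J (q * x))\<^sup>2) + 1 / (2 * ?s) * (LINT x|leb_pos. (norm (g x))\<^sup>2)"
      using q by (intro integrable_mult_square_integrable(2)[OF g sm J2]) auto
    also have "(LINT x|leb_pos. (J (q * x))\<^sup>2) = 1 / q * (LINT x|leb_pos. (J x)\<^sup>2)"
      using integral_leb_pos_scale[OF q, of "\<lambda>x. (J x)\<^sup>2"] by simp
    also have "?s / 2 * (1 / q * (LINT x|leb_pos. (J x)\<^sup>2)) = (1 / 2 * q powr (- 1 / 2)) * (LINT x|leb_pos. (J x)\<^sup>2)"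
      by (simp only: s mult.assoc[symmetric])
    also have "1 / (2 * ?s) = 1 / 2 * q powr (- 1 / 2)"
      using q by (simp add: powr_minus_divide)
    finally show ?thesis by (simp add: K_def algebra_simps)
  qed
  \<comment> \<open>The majorant of the density for the exponent \<open>3 / 2\<close> has exactly the singularity \<open>q powr (- 1 / 2)\<close> at \<open>0\<close>.\<close>
  have maj: "exp (- p * q) * q powr (- 1 / 2) \<le> 2 * (1 + 1 / p) * ml_majorant (3 / 2) q" if q: "0 < q" for q
  proof -
    have "p * q \<le> exp (p * q)" using exp_ge_add_one_self[of "p * q"] by linarith
    then have "q * exp (- p * q) \<le> 1 / p" using p by (simp add: exp_minus field_simps)
    moreover have "exp (- p * q) \<le> 1" using p q by simp
    moreover have "exp (- p * q) * (1 + q) = exp (- p * q) + q * exp (- p * q)" by (simp add: algebra_simps)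
    ultimately have 1: "exp (- p * q) * (1 + q) \<le> 1 + 1 / p" by linarith
    have "(1 + q powr (1 / 2))\<^sup>2 \<le> 2 * (1 + q)"
      using zero_le_power2[of "1 - q powr (1/2)"] q powr_half_sqrt[of q] by (simp add: power2_sum power2_diff)
    then have "exp (- p * q) * (1 + q powr (1 / 2))\<^sup>2 \<le> exp (- p * q) * (2 * (1 + q))"
      by (intro mult_left_mono) auto
    also have "\<dots> = 2 * (exp (- p * q) * (1 + q))" by (rule mult.left_commute)
    also have "\<dots> \<le> 2 * (1 + 1 / p)" using 1 by (rule mult_left_mono) simp
    finally have 2: "exp (- p * q) * (1 + q powr (1 / 2))\<^sup>2 \<le> 2 * (1 + 1 / p)" .
    have pos: "0 < (1 + q powr (1 / 2))\<^sup>2" by (intro zero_less_power add_pos_nonneg) auto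
    have "exp (- p * q) \<le> 2 * (1 + 1 / p) / (1 + q powr (1 / 2))\<^sup>2"
      using 2 pos by (simp only: pos_le_divide_eq)
    from mult_right_mono[OF this, of "q powr (- 1 / 2)"]
    show ?thesis by (simp add: ml_majorant_def)
  qed
  have int: "integrable (leb_pos \<Otimes>\<^sub>M leb_pos) ?f"
  proof (rule leb_pos_pair.Fubini_integrable[OF fm])
    show "AE q in leb_pos. integrable leb_pos (\<lambda>x. ?f (q, x))"
      using ijg by (intro AE_leb_pos) (simp add: mult.assoc)
    show "integrable leb_pos (\<lambda>q. LINT x|leb_pos. norm (?f (q, x)))"
    proof (rule integrable_leb_pos_bound)
      show "integrable leb_pos (\<lambda>q. K * (2 * (1 + 1 / p) * ml_majorant (3 / 2) q))"
        using integrable_ml_majorant[of "3/2"] by simp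
      show "(\<lambda>q. LINT x|leb_pos. norm (?f (q, x))) \<in> borel_measurable leb_pos"
        using fm by (intro leb_pos.borel_measurable_lebesgue_integral) (simp add: split_beta')
      fix q :: real assume q: "0 < q"
      have "(LINT x|leb_pos. norm (?f (q, x))) = exp (- p * q) * (LINT x|leb_pos. \<bar>J (q * x)\<bar> * norm (g x))"
        by (simp add: norm_mult mult.assoc)
      also have "\<dots> \<le> exp (- p * q) * (K * q powr (- 1 / 2))"
        by (intro mult_left_mono bound q) auto
      also have "\<dots> = K * (exp (- p * q) * q powr (- 1 / 2))" by simp
      also have "\<dots> \<le> K * (2 * (1 + 1 / p) * ml_majorant (3 / 2) q)"
        by (intro mult_left_mono maj q K)
      finally show "norm (LINT x|leb_pos. norm (?f (q, x))) \<le> K * (2 * (1 + 1 / p) * ml_majorant (3 / 2) q)"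
        by simp
    qed
  qed
  have "(LINT x|leb_pos. (LINT q|leb_pos. of_real (exp (- p * q) * J (q * x)) * g x))
      = (LINT q|leb_pos. (LINT x|leb_pos. of_real (exp (- p * q) * J (q * x)) * g x))"
    by (rule leb_pos_pair.Fubini_integral[OF int])
  also have "\<dots> = (LINT q|leb_pos. of_real (exp (- p * q)) * (LINT x|leb_pos. of_real (J (q * x)) * g x))"
    by (simp add: mult.assoc)
  also have "\<dots> = 0"
    by (rule integral_eq_zero_AE) (use z in eventually_elim, simp)
  finally have 0: "(LINT x|leb_pos. (LINT q|leb_pos. of_real (exp (- p * q) * J (q * x)) * g x)) = 0" .
  have "(LINT x|leb_pos. (LINT q|leb_pos. of_real (exp (- p * q) * J (q * x)) * g x))
      = (LINT x|leb_pos. of_real (p powr (\<alpha> - 1)) * (g x / of_real (\<mu> + x powr \<alpha>)))"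
  proof (rule Bochner_Integration.integral_cong[OF refl])
    fix x assume "x \<in> space leb_pos"
    then have x: "0 < x" by (simp add: space_restrict_space)
    have "(LINT q|leb_pos. of_real (exp (- p * q) * J (q * x)) * g x) = of_real (LINT q|leb_pos. exp (- p * q) * J (x * q)) * g x"
      by (simp only: integral_mult_left_zero integral_complex_of_real mult.commute[of x])
    then show "(LINT q|leb_pos. of_real (exp (- p * q) * J (q * x)) * g x) = of_real (p powr (\<alpha> - 1)) * (g x / of_real (\<mu> + x powr \<alpha>))"
      unfolding laplace_mittag_leffler_scale[OF p(1) x] p(2) by simp
  qed
  then have "of_real (p powr (\<alpha> - 1)) * (LINT x|leb_pos. g x / of_real (\<mu> + x powr \<alpha>)) = 0"
    unfolding 0 integral_mult_right_zero by (rule sym)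
  then show "(LINT x|leb_pos. g x / of_real (\<mu> + x powr \<alpha>)) = 0"
    using p(1) by (simp only: mult_eq_0_iff of_real_eq_0_iff powr_eq_0_iff) simp
qed

end

section \<open>The Lindley chain\<close>

text \<open>The transition operator of the Lindley recursion \<open>W \<mapsto> max 0 (W + \<xi>)\<close> with \<open>\<xi>\<close> distributed according to \<open>\<mu>\<close>.\<close>

definition lindley_op :: "real measure \<Rightarrow> (real \<Rightarrow> real) \<Rightarrow> real \<Rightarrow> real" where
  "lindley_op \<mu> f x = (LINT z|\<mu>. f (max 0 (x + z)))"

text \<open>The class of functions is preserved by the Lindley recursion with the same constants, because
  \<open>x \<mapsto> max 0 (x + z)\<close> is a contraction. This makes the one-step error below uniform along the chain.\<close>

locale bounded_lipschitz =
  fixes f :: "real \<Rightarrow> real" and B L :: real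
  assumes bounded: "\<bar>f x\<bar> \<le> B" and lipschitz: "\<bar>f x - f y\<bar> \<le> L * \<bar>x - y\<bar>"
begin

lemma B_nonneg: "0 \<le> B" using bounded[of 0] by linarith

lemma L_nonneg: "0 \<le> L" using lipschitz[of 0 1] by (simp add: order_trans[OF abs_ge_zero])

lemma cont: "continuous_on UNIV f"
  using lipschitz by (rule continuous_on_if_abs_lipschitz)

lemma measurable_borel [measurable]: "f \<in> borel_measurable borel"
  by (rule borel_measurable_continuous_onI[OF cont])

lemma integrable_exp_mult:
  assumes "0 < \<beta>"
  shows "integrable leb_pos (\<lambda>x. exp (- \<beta> * x) * f x)"
  using integrable_leb_pos_bounded_mult[OF laplace_integrals(1)[OF assms], of f B] bounded
  by (simp add: borel_measurable_leb_pos mult.commute)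

lemma laplace_minus_const:
  assumes "0 < \<beta>"
  shows "(LINT x|leb_pos. exp (- \<beta> * x) * (f x - c)) = (LINT x|leb_pos. exp (- \<beta> * x) * f x) - c / \<beta>"
proof -
  have "(LINT x|leb_pos. exp (- \<beta> * x) * (f x - c)) = (LINT x|leb_pos. exp (- \<beta> * x) * f x - exp (- \<beta> * x) * c)"
    by (simp add: right_diff_distrib)
  also have "\<dots> = (LINT x|leb_pos. exp (- \<beta> * x) * f x) - (LINT x|leb_pos. exp (- \<beta> * x) * c)"
    using integrable_exp_mult[OF assms] laplace_integrals(1)[OF assms]
    by (intro Bochner_Integration.integral_diff) auto
  finally show ?thesis using laplace_integrals(2)[OF assms] by simp
qed

lemma lindley_op:
  assumes "real_distribution \<mu>"
  shows "bounded_lipschitz (lindley_op \<mu> f) B L"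
proof -
  interpret \<mu>: real_distribution \<mu> by fact
  have [measurable]: "(\<lambda>z. f (max 0 (x + z))) \<in> borel_measurable \<mu>" for x
    by (subst measurable_cong_sets[OF \<mu>.events_eq_borel refl]) measurable
  have i: "integrable \<mu> (\<lambda>z. f (max 0 (x + z)))" for x
    using bounded by (intro \<mu>.integrable_const_bound[where B = B]) auto
  show ?thesis
  proof
    fix x y
    show "\<bar>lindley_op \<mu> f x\<bar> \<le> B"
      unfolding lindley_op_def using bounded
      by (intro order_trans[OF integral_abs_bound] \<mu>.integral_le_const integrable_abs i) auto
    have "lindley_op \<mu> f x - lindley_op \<mu> f y = (LINT z|\<mu>. f (max 0 (x + z)) - f (max 0 (y + z)))"
      unfolding lindley_op_def by (rule Bochner_Integration.integral_diff[OF i i, symmetric])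
    also have "\<bar>\<dots>\<bar> \<le> L * \<bar>x - y\<bar>"
    proof (intro order_trans[OF integral_abs_bound] \<mu>.integral_le_const integrable_abs Bochner_Integration.integrable_diff i AE_I2)
      fix z
      have "\<bar>max 0 (x + z) - max 0 (y + z)\<bar> \<le> \<bar>x - y\<bar>" by (auto simp: max_def)
      then show "\<bar>f (max 0 (x + z)) - f (max 0 (y + z))\<bar> \<le> L * \<bar>x - y\<bar>"
        using lipschitz[of "max 0 (x + z)" "max 0 (y + z)"] L_nonneg
        by (meson mult_left_mono order_trans)
    qed
    finally show "\<bar>lindley_op \<mu> f x - lindley_op \<mu> f y\<bar> \<le> L * \<bar>x - y\<bar>" .
  qed
qed

text \<open>Substitution turns the left integral into \<open>exp (\<beta> z)\<close> times an integral over \<open>y > z\<close>. It differs from the one over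
  \<open>y > 0\<close> only on an interval of length \<open>max 0 z\<close>, where the integrand is at most \<open>L z\<close>. For negative \<open>z\<close> the
  two integrals agree, since the integrand vanishes for \<open>y \<le> 0\<close>.\<close>

lemma shifted_laplace:
  assumes \<beta>: "0 < \<beta>"
  shows "\<bar>(LINT x|leb_pos. exp (- \<beta> * x) * (f (max 0 (x + z)) - f 0))
     - exp (\<beta> * z) * (LINT x|leb_pos. exp (- \<beta> * x) * (f x - f 0))\<bar> \<le> exp (\<beta> * z) * (L * (max 0 z)\<^sup>2)"
proof -
  let ?G = "\<lambda>y. f (max 0 y) - f 0"
  let ?p = "\<lambda>y. exp (\<beta> * z) * (exp (- \<beta> * y) * ?G y)"
  have Gb: "\<bar>?G y\<bar> \<le> 2 * B" for y using bounded[of "max 0 y"] bounded[of 0] by linarith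
  have ie: "integrable leb_pos (\<lambda>x. exp (- \<beta> * x) * ?G (x + c))" for c
  proof -
    have "integrable leb_pos (\<lambda>x. ?G (x + c) * exp (- \<beta> * x))"
      using Gb by (intro integrable_leb_pos_bounded_mult[OF laplace_integrals(1)[OF \<beta>], where B = "2 * B"])
        (auto intro!: borel_measurable_leb_pos)
    then show ?thesis by (simp only: mult.commute)
  qed
  have e1: "(LINT x|leb_pos. exp (- \<beta> * x) * ?G (x + z)) = (LINT y|lborel. indicat_real {z<..} y * ?p y)"
  proof -
    have "(LINT x|leb_pos. exp (- \<beta> * x) * ?G (x + z)) = (LINT x|lborel. indicat_real {0<..} x * (exp (- \<beta> * x) * ?G (x + z)))"
      by (simp add: integral_leb_pos_eq set_lebesgue_integral_def)
    also have "\<dots> = (LINT y|lborel. indicat_real {0<..} (- z + 1 * y) * (exp (- \<beta> * (- z + 1 * y)) * ?G ((- z + 1 * y) + z)))"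
      by (subst lborel_integral_real_affine[where c = 1 and t = "- z"]) auto
    also have "\<dots> = (LINT y|lborel. indicat_real {z<..} y * ?p y)"
      by (intro Bochner_Integration.integral_cong refl) (auto simp: indicator_def algebra_simps simp flip: exp_add)
    finally show ?thesis .
  qed
  have i1: "integrable lborel (\<lambda>y. indicat_real {z<..} y * ?p y)"
  proof -
    have "integrable lborel (\<lambda>x. indicat_real {0<..} x * (exp (- \<beta> * x) * ?G (x + z)))"
      using ie[of z] by (simp add: integrable_leb_pos_iff set_integrable_def)
    from lborel_integrable_real_affine[OF this, of 1 "- z"]
    have "integrable lborel (\<lambda>y. indicat_real {0<..} (- z + 1 * y) * (exp (- \<beta> * (- z + 1 * y)) * ?G ((- z + 1 * y) + z)))" by simp
    then show ?thesis
      by (rule Bochner_Integration.integrable_cong[THEN iffD1, OF refl, rotated])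
        (auto simp: indicator_def algebra_simps simp flip: exp_add)
  qed
  have e2: "exp (\<beta> * z) * (LINT x|leb_pos. exp (- \<beta> * x) * (f x - f 0)) = (LINT y|lborel. indicat_real {0<..} y * ?p y)"
  proof -
    have "exp (\<beta> * z) * (LINT x|leb_pos. exp (- \<beta> * x) * (f x - f 0)) = (LINT x|leb_pos. exp (\<beta> * z) * (exp (- \<beta> * x) * (f x - f 0)))"
      by simp
    also have "\<dots> = (LINT x|lborel. indicat_real {0<..} x * ?p x)"
      unfolding integral_leb_pos_eq set_lebesgue_integral_def
      by (intro Bochner_Integration.integral_cong refl) (auto simp: indicator_def)
    finally show ?thesis .
  qed
  have i2: "integrable lborel (\<lambda>y. indicat_real {0<..} y * ?p y)"
  proof -
    have "integrable lborel (\<lambda>y. indicat_real {0<..} y * (exp (- \<beta> * y) * ?G y))"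
      using ie[of 0] by (simp add: integrable_leb_pos_iff set_integrable_def)
    from Bochner_Integration.integrable_mult_right[OF this, of "exp (\<beta> * z)"]
    show ?thesis by (subst mult.left_commute)
  qed
  have "\<bar>(LINT y|lborel. indicat_real {z<..} y * ?p y) - (LINT y|lborel. indicat_real {0<..} y * ?p y)\<bar>
     = \<bar>LINT y|lborel. indicat_real {z<..} y * ?p y - indicat_real {0<..} y * ?p y\<bar>"
    by (simp only: Bochner_Integration.integral_diff[OF i1 i2])
  also have "\<dots> \<le> (LINT y|lborel. indicat_real {0<..max 0 z} y * (exp (\<beta> * z) * (L * max 0 z)))"
  proof (intro order_trans[OF integral_abs_bound] integral_mono_AE AE_I2)
    show "integrable lborel (\<lambda>y. indicat_real {0<..max 0 z} y * (exp (\<beta> * z) * (L * max 0 z)))"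
      by (intro integrable_mult_left) (auto simp: max_def)
    fix y :: real
    show "\<bar>indicat_real {z<..} y * ?p y - indicat_real {0<..} y * ?p y\<bar>
       \<le> indicat_real {0<..max 0 z} y * (exp (\<beta> * z) * (L * max 0 z))"
    proof (cases "0 < y \<and> y \<le> z")
      case True
      then have "\<bar>?G y\<bar> \<le> L * z"
        using lipschitz[of y 0] L_nonneg mult_left_mono[of y z L] by (auto simp: max_def)
      moreover have "exp (- \<beta> * y) \<le> 1" using True \<beta> by simp
      ultimately have "exp (- \<beta> * y) * \<bar>?G y\<bar> \<le> 1 * (L * z)"
        by (intro mult_mono) auto
      then show ?thesis using True by (simp add: indicator_def abs_mult max_def)
    next
      case False
      then have eq: "indicat_real {z<..} y * ?p y = indicat_real {0<..} y * ?p y"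
        by (cases "0 < y") (auto simp: indicator_def max_def)
      have "indicat_real {0<..max 0 z} y = 0" using False by (auto simp: indicator_def max_def)
      then show ?thesis by (simp only: eq diff_self abs_zero mult_zero_left order_refl)
    qed
  qed (use i1 i2 in auto)
  also have "\<dots> = exp (\<beta> * z) * (L * (max 0 z)\<^sup>2)"
    by (simp add: power2_eq_square max_def)
  finally show ?thesis unfolding e1 e2 .
qed

text \<open>The factor \<open>2 / \<delta>\<^sup>2\<close> comes from \<open>z\<^sup>2 \<le> 2 / \<delta>\<^sup>2 * exp (\<delta> z)\<close> for \<open>z \<ge> 0\<close>. For an increment over time \<open>h\<close> of the stable process the
  choice \<open>\<delta> = h powr (- 1 / \<alpha>)\<close> makes the error of order \<open>h powr (2 / \<alpha>)\<close>, hence \<open>o(h)\<close>.\<close>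

lemma lindley_laplace_step:
  assumes \<mu>: "real_distribution \<mu>" and \<beta>: "0 < \<beta>" and \<delta>: "0 < \<delta>"
    and i\<beta>: "integrable \<mu> (\<lambda>z. exp (\<beta> * z))" and i\<delta>: "integrable \<mu> (\<lambda>z. exp ((\<beta> + \<delta>) * z))"
  shows "\<bar>(LINT x|leb_pos. exp (- \<beta> * x) * (lindley_op \<mu> f x - f 0))
     - (LINT z|\<mu>. exp (\<beta> * z)) * (LINT x|leb_pos. exp (- \<beta> * x) * (f x - f 0))\<bar>
    \<le> 2 * L / \<delta>\<^sup>2 * (LINT z|\<mu>. exp ((\<beta> + \<delta>) * z))"
proof -
  interpret \<mu>: real_distribution \<mu> by fact
  interpret pair_sigma_finite leb_pos \<mu> ..
  have sets: "sets \<mu> = sets borel" by simp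
  let ?H = "\<lambda>x z. exp (- \<beta> * x) * (f (max 0 (x + z)) - f 0)"
  define I where "I z = (LINT x|leb_pos. ?H x z)" for z
  define A where "A = (LINT x|leb_pos. exp (- \<beta> * x) * (f x - f 0))"
  have Hm: "(\<lambda>(x, z). ?H x z) \<in> borel_measurable (leb_pos \<Otimes>\<^sub>M \<mu>)"
    by (rule borel_measurable_leb_pos_pair_sets[OF sets]) measurable
  have fm: "(\<lambda>z. f (max 0 (x + z))) \<in> borel_measurable \<mu>" for x
    by (subst measurable_cong_sets[OF sets refl]) measurable
  have fi: "integrable \<mu> (\<lambda>z. f (max 0 (x + z)))" for x
    using bounded fm by (intro \<mu>.integrable_const_bound[where B = B]) auto
  have Hi: "integrable \<mu> (\<lambda>z. ?H x z)" for x
    using fi by (intro Bochner_Integration.integrable_mult_right Bochner_Integration.integrable_diff) auto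
  have int: "integrable (leb_pos \<Otimes>\<^sub>M \<mu>) (\<lambda>(x, z). ?H x z)"
  proof (rule Fubini_integrable[OF Hm])
    show "AE x in leb_pos. integrable \<mu> (\<lambda>z. case (x, z) of (x, z) \<Rightarrow> ?H x z)" using Hi by simp
    show "integrable leb_pos (\<lambda>x. LINT z|\<mu>. norm (case (x, z) of (x, z) \<Rightarrow> ?H x z))"
    proof (rule integrable_leb_pos_bound)
      show "integrable leb_pos (\<lambda>x. exp (- \<beta> * x) * (2 * B))" using laplace_integrals(1)[OF \<beta>] by simp
      show "(\<lambda>x. LINT z|\<mu>. norm (case (x, z) of (x, z) \<Rightarrow> ?H x z)) \<in> borel_measurable leb_pos"
        using Hm by (intro \<mu>.borel_measurable_lebesgue_integral) (simp add: split_beta')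
      fix x :: real
      have "(LINT z|\<mu>. \<bar>?H x z\<bar>) \<le> exp (- \<beta> * x) * (2 * B)"
      proof (intro \<mu>.integral_le_const integrable_abs Hi AE_I2)
        fix z
        have "\<bar>f (max 0 (x + z)) - f 0\<bar> \<le> 2 * B" using bounded[of "max 0 (x + z)"] bounded[of 0] by linarith
        then show "\<bar>?H x z\<bar> \<le> exp (- \<beta> * x) * (2 * B)" by (simp add: abs_mult)
      qed
      then show "norm (LINT z|\<mu>. norm (case (x, z) of (x, z) \<Rightarrow> ?H x z)) \<le> exp (- \<beta> * x) * (2 * B)" by simp
    qed
  qed
  have eq: "(LINT x|leb_pos. exp (- \<beta> * x) * (lindley_op \<mu> f x - f 0)) = (LINT z|\<mu>. I z)"
  proof -
    have "exp (- \<beta> * x) * (lindley_op \<mu> f x - f 0) = (LINT z|\<mu>. ?H x z)" for x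
      using fi[of x] using \<mu>.prob_space by (simp add: lindley_op_def)
    then show ?thesis unfolding I_def using Fubini_integral[OF int] by simp
  qed
  have Ii: "integrable \<mu> I"
    unfolding I_def[abs_def] using integrable_snd[OF int] by simp
  have "(LINT z|\<mu>. I z) - (LINT z|\<mu>. exp (\<beta> * z)) * A = (LINT z|\<mu>. I z - exp (\<beta> * z) * A)"
    using Ii i\<beta> by simp
  also have "\<bar>\<dots>\<bar> \<le> (LINT z|\<mu>. 2 * L / \<delta>\<^sup>2 * exp ((\<beta> + \<delta>) * z))"
  proof (intro order_trans[OF integral_abs_bound] integral_mono_AE AE_I2)
    show "integrable \<mu> (\<lambda>z. \<bar>I z - exp (\<beta> * z) * A\<bar>)" using Ii i\<beta> by simp
    show "integrable \<mu> (\<lambda>z. 2 * L / \<delta>\<^sup>2 * exp ((\<beta> + \<delta>) * z))" using i\<delta> by simp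
    fix z
    have "(max 0 z)\<^sup>2 \<le> 2 / \<delta>\<^sup>2 * exp (\<delta> * z)"
    proof (cases "0 \<le> z")
      case True
      then have "(\<delta> * z)\<^sup>2 / 2 \<le> exp (\<delta> * z)"
        using exp_lower_Taylor_quadratic[of "\<delta> * z"] mult_nonneg_nonneg[of \<delta> z] \<delta> by linarith
      then show ?thesis using True \<delta> by (simp add: max_def field_simps power_mult_distrib)
    next
      case False
      then show ?thesis by (simp add: max_def)
    qed
    then have "exp (\<beta> * z) * (L * (max 0 z)\<^sup>2) \<le> exp (\<beta> * z) * (L * (2 / \<delta>\<^sup>2 * exp (\<delta> * z)))"
      using L_nonneg by (intro mult_left_mono) auto
    also have "\<dots> = 2 * L / \<delta>\<^sup>2 * exp ((\<beta> + \<delta>) * z)"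
      by (simp add: distrib_right exp_add)
    finally show "\<bar>I z - exp (\<beta> * z) * A\<bar> \<le> 2 * L / \<delta>\<^sup>2 * exp ((\<beta> + \<delta>) * z)"
      using shifted_laplace[OF \<beta>, of z] unfolding I_def A_def by linarith
  qed
  also have "\<dots> = 2 * L / \<delta>\<^sup>2 * (LINT z|\<mu>. exp ((\<beta> + \<delta>) * z))"
    by (rule integral_mult_right_zero)
  finally show ?thesis unfolding eq A_def .
qed

lemma funpow_lindley_op:
  "real_distribution \<mu> \<Longrightarrow> bounded_lipschitz ((lindley_op \<mu> ^^ k) f) B L"
proof (induction k)
  case 0
  show ?case by (simp add: bounded_lipschitz_axioms)
next
  case (Suc k)
  then interpret g: bounded_lipschitz "(lindley_op \<mu> ^^ k) f" B L by simp
  show ?case using g.lindley_op[OF Suc.prems] by simp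
qed

text \<open>The discounted one-step relations telescope, and discounting does not increase the errors.\<close>

lemma lindley_laplace_chain:
  assumes \<mu>: "real_distribution \<mu>" and \<beta>: "0 < \<beta>" and \<delta>: "0 < \<delta>" and c: "0 \<le> c"
    and i\<beta>: "integrable \<mu> (\<lambda>z. exp (\<beta> * z))" and i\<delta>: "integrable \<mu> (\<lambda>z. exp ((\<beta> + \<delta>) * z))"
    and m: "(LINT z|\<mu>. exp (\<beta> * z)) = exp c"
  defines "F \<equiv> \<lambda>k. (lindley_op \<mu> ^^ k) f"
  defines "\<epsilon> \<equiv> 2 * L / \<delta>\<^sup>2 * (LINT z|\<mu>. exp ((\<beta> + \<delta>) * z))"
  shows "\<bar>exp (- real N * c) * (LINT x|leb_pos. exp (- \<beta> * x) * F N x) - (LINT x|leb_pos. exp (- \<beta> * x) * f x)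
     + 1 / \<beta> * (\<Sum>k<N. F k 0 * (exp (- real k * c) - exp (- real (Suc k) * c)))\<bar> \<le> real N * \<epsilon>"
proof (induction N)
  case 0
  show ?case by (simp add: F_def)
next
  case (Suc N)
  interpret g: bounded_lipschitz "F N" B L unfolding F_def by (rule funpow_lindley_op[OF \<mu>])
  interpret g': bounded_lipschitz "F (Suc N)" B L unfolding F_def by (rule funpow_lindley_op[OF \<mu>])
  define a where "a k = (LINT x|leb_pos. exp (- \<beta> * x) * F k x)" for k
  have FS: "F (Suc N) = lindley_op \<mu> (F N)" by (simp add: F_def)
  have "\<bar>(a (Suc N) - F N 0 / \<beta>) - exp c * (a N - F N 0 / \<beta>)\<bar> \<le> \<epsilon>"
    using g.lindley_laplace_step[OF \<mu> \<beta> \<delta> i\<beta> i\<delta>] unfolding FS[symmetric] m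
      g.laplace_minus_const[OF \<beta>] g'.laplace_minus_const[OF \<beta>] a_def \<epsilon>_def .
  moreover have "0 \<le> real (Suc N) * c" using c by simp
  then have "exp (- real (Suc N) * c) \<le> 1" unfolding mult_minus_left by (simp del: of_nat_Suc)
  ultimately have 1: "exp (- real (Suc N) * c) * \<bar>(a (Suc N) - F N 0 / \<beta>) - exp c * (a N - F N 0 / \<beta>)\<bar> \<le> 1 * \<epsilon>"
    by (intro mult_mono) auto
  have ex: "exp (- real (Suc N) * c) * exp c = exp (- real N * c)"
    by (simp add: algebra_simps flip: exp_add)
  let ?X = "exp (- real N * c) * a N - (LINT x|leb_pos. exp (- \<beta> * x) * f x)
     + 1 / \<beta> * (\<Sum>k<N. F k 0 * (exp (- real k * c) - exp (- real (Suc k) * c)))"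
  let ?Y = "exp (- real (Suc N) * c) * ((a (Suc N) - F N 0 / \<beta>) - exp c * (a N - F N 0 / \<beta>))"
  have step: "exp (- real (Suc N) * c) * a (Suc N) - (LINT x|leb_pos. exp (- \<beta> * x) * f x)
     + 1 / \<beta> * (\<Sum>k<Suc N. F k 0 * (exp (- real k * c) - exp (- real (Suc k) * c)))
     = ?X + exp (- real (Suc N) * c) * ((a (Suc N) - F N 0 / \<beta>) - exp c * (a N - F N 0 / \<beta>))"
  proof -
    have "E1 * a' - A + 1 / \<beta> * (S + U * (E0 - E1)) = (E0 * a - A + 1 / \<beta> * S) + E1 * ((a' - U / \<beta>) - ec * (a - U / \<beta>))"
      if "E1 * ec = E0" for E1 E0 ec a a' A S U :: real
      unfolding that[symmetric] by (simp add: algebra_simps)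
    from this[OF ex] show ?thesis unfolding sum.lessThan_Suc .
  qed
  have X: "\<bar>?X\<bar> \<le> real N * \<epsilon>" unfolding a_def by (rule Suc.IH)
  have Y: "\<bar>?Y\<bar> \<le> 1 * \<epsilon>" unfolding abs_mult abs_exp_cancel by (rule 1)
  have "\<bar>?X + ?Y\<bar> \<le> real N * \<epsilon> + 1 * \<epsilon>"
    by (rule order_trans[OF abs_triangle_ineq add_mono[OF X Y]])
  also have "\<dots> = real (Suc N) * \<epsilon>" by (simp add: algebra_simps)
  finally show ?case unfolding step[unfolded a_def, symmetric] a_def .
qed

end

section \<open>Reflection at the infimum as a limit of Lindley chains\<close>

fun lindley_chain :: "real \<Rightarrow> (nat \<Rightarrow> real) \<Rightarrow> nat \<Rightarrow> real" where
  "lindley_chain x v 0 = x"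
| "lindley_chain x v (Suc k) = max 0 (lindley_chain x v k + v k)"

text \<open>The unfolded Lindley recursion is the partial sum, corrected by the running minimum; this is the discrete form
  of reflection at the infimum.\<close>

lemma lindley_chain_increments:
  assumes "0 \<le> x" "a 0 = 0"
  shows "lindley_chain x (\<lambda>k. a (Suc k) - a k) k = a k + max x (- Min (a ` {..k}))"
proof (induction k)
  case 0
  show ?case using assms by simp
next
  case (Suc k)
  have "Min (a ` {..Suc k}) = min (a (Suc k)) (Min (a ` {..k}))"
    by (simp add: atMost_Suc)
  moreover have "max 0 (b + max x (- m) + (b' - b)) = b' + max x (- min b' m)" for b b' m :: real
    by (simp add: max_def min_def)
  ultimately show ?case by (simp only: lindley_chain.simps Suc)
qed

text \<open>The path is bounded near each point on both sides, and the interval is compact.\<close>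

lemma cadlag_bdd_below:
  fixes \<zeta> :: "real \<Rightarrow> real"
  assumes right: "\<And>t. 0 \<le> t \<Longrightarrow> continuous (at_right t) \<zeta>"
    and left: "\<And>t. 0 < t \<Longrightarrow> \<exists>l. (\<zeta> \<longlongrightarrow> l) (at_left t)" and s: "0 \<le> s"
  shows "bdd_below (\<zeta> ` {0..s})"
proof -
  have "bdd_below (\<zeta> ` ({0..} \<inter> {0..s}))"
  proof (rule Bolzano[OF s, where P = "\<lambda>a b. bdd_below (\<zeta> ` ({0..} \<inter> {a..b}))"])
    fix a b c :: real
    assume "bdd_below (\<zeta> ` ({0..} \<inter> {a..b}))" "bdd_below (\<zeta> ` ({0..} \<inter> {b..c}))" "a \<le> b" "b \<le> c"
    moreover from this have "{0..} \<inter> {a..c} = ({0..} \<inter> {a..b}) \<union> ({0..} \<inter> {b..c})" by auto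
    ultimately show "bdd_below (\<zeta> ` ({0..} \<inter> {a..c}))" by (simp add: image_Un)
  next
    fix x assume x: "0 \<le> x" "x \<le> s"
    have "(\<zeta> \<longlongrightarrow> \<zeta> x) (at_right x)" using right[OF x(1)] by (simp add: continuous_within)
    then have "\<forall>\<^sub>F y in at_right x. \<zeta> x - 1 < \<zeta> y" by (rule order_tendstoD) simp
    then obtain d1 where d1: "x < d1" "\<And>y. x < y \<Longrightarrow> y < d1 \<Longrightarrow> \<zeta> x - 1 < \<zeta> y"
      by (auto simp: eventually_at_right_field)
    have "\<exists>m d. d < x \<and> (\<forall>y. 0 \<le> y \<and> d < y \<and> y < x \<longrightarrow> m < \<zeta> y)"
    proof (cases "0 < x")
      case True
      then obtain l where "(\<zeta> \<longlongrightarrow> l) (at_left x)" using left by blast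
      then have "\<forall>\<^sub>F y in at_left x. l - 1 < \<zeta> y" by (rule order_tendstoD) simp
      then show ?thesis by (auto simp: eventually_at_left_field)
    qed (auto intro!: exI[of _ "x - 1"])
    then obtain m d2 where d2: "d2 < x" "\<And>y. 0 \<le> y \<Longrightarrow> d2 < y \<Longrightarrow> y < x \<Longrightarrow> m < \<zeta> y" by blast
    show "\<exists>d>0. \<forall>a b. a \<le> x \<and> x \<le> b \<and> b - a < d \<longrightarrow> bdd_below (\<zeta> ` ({0..} \<inter> {a..b}))"
    proof (intro exI[of _ "min (d1 - x) (x - d2)"] conjI allI impI)
      show "0 < min (d1 - x) (x - d2)" using d1 d2 by simp
      fix a b assume ab: "a \<le> x \<and> x \<le> b \<and> b - a < min (d1 - x) (x - d2)"
      show "bdd_below (\<zeta> ` ({0..} \<inter> {a..b}))"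
      proof (rule bdd_belowI2[where m = "min m (\<zeta> x - 1)"])
        fix y assume "y \<in> {0..} \<inter> {a..b}"
        then show "min m (\<zeta> x - 1) \<le> \<zeta> y"
          using d1(2)[of y] d2(2)[of y] ab by (cases y x rule: linorder_cases) force+
      qed
    qed
  qed
  moreover have "{0..} \<inter> {0..s} = {0..s}" by auto
  ultimately show ?thesis by simp
qed

locale cadlag_path =
  fixes \<zeta> :: "real \<Rightarrow> real"
  assumes start: "\<zeta> 0 = 0"
    and right_cont: "\<And>t. 0 \<le> t \<Longrightarrow> continuous (at_right t) \<zeta>"
    and left_lim: "\<And>t. 0 < t \<Longrightarrow> \<exists>l. (\<zeta> \<longlongrightarrow> l) (at_left t)"
begin

definition reflected :: "real \<Rightarrow> real \<Rightarrow> real" where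
  "reflected x s = \<zeta> s + max x (- (INF u\<in>{0..s}. \<zeta> u))"

lemma bdd_below_path: "0 \<le> s \<Longrightarrow> bdd_below (\<zeta> ` {0..s})"
  by (rule cadlag_bdd_below[OF right_cont left_lim])

lemma right_neighbourhood:
  assumes "0 \<le> s" "0 < e"
  obtains d where "s < d" "\<And>y. s \<le> y \<Longrightarrow> y < d \<Longrightarrow> \<bar>\<zeta> y - \<zeta> s\<bar> < e"
proof -
  have "(\<zeta> \<longlongrightarrow> \<zeta> s) (at_right s)" using right_cont[OF assms(1)] by (simp add: continuous_within)
  then have "\<forall>\<^sub>F y in at_right s. dist (\<zeta> y) (\<zeta> s) < e" using assms(2) by (rule tendstoD)
  then obtain d where d: "s < d" "\<And>y. s < y \<Longrightarrow> y < d \<Longrightarrow> \<bar>\<zeta> y - \<zeta> s\<bar> < e"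
    by (auto simp: eventually_at_right_field dist_real_def)
  show thesis
  proof (rule that[OF d(1)])
    fix y assume "s \<le> y" "y < d"
    then show "\<bar>\<zeta> y - \<zeta> s\<bar> < e" using d(2)[of y] assms(2) by (cases "y = s") auto
  qed
qed

lemma tendsto_from_right:
  assumes "0 \<le> s" "\<And>n. s \<le> r n" "r \<longlonglongrightarrow> s"
  shows "(\<lambda>n. \<zeta> (r n)) \<longlonglongrightarrow> \<zeta> s"
proof (rule tendstoI)
  fix e :: real assume e: "0 < e"
  obtain d where d: "s < d" "\<And>y. s \<le> y \<Longrightarrow> y < d \<Longrightarrow> \<bar>\<zeta> y - \<zeta> s\<bar> < e"
    using right_neighbourhood[OF assms(1) e] by metis
  have "\<forall>\<^sub>F n in sequentially. r n < d" using assms(3) d(1) by (rule order_tendstoD)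
  then show "\<forall>\<^sub>F n in sequentially. dist (\<zeta> (r n)) (\<zeta> s) < e"
    by eventually_elim (use d(2) assms(2) in \<open>simp add: dist_real_def\<close>)
qed

text \<open>From above: a time that nearly attains the infimum is approached from the right by grid points. From below: the
  grid points beyond \<open>s\<close> are close to \<open>s\<close>, where the path is close to its value at \<open>s\<close>.\<close>

lemma tendsto_Min_grid:
  assumes s: "0 \<le> s" and h: "\<And>n. 0 < h n" "h \<longlonglongrightarrow> 0"
    and k: "\<And>n. s \<le> real (k n) * h n" "(\<lambda>n. real (k n) * h n) \<longlonglongrightarrow> s"
  shows "(\<lambda>n. Min ((\<lambda>j. \<zeta> (real j * h n)) ` {..k n})) \<longlonglongrightarrow> (INF u\<in>{0..s}. \<zeta> u)"
proof (rule tendstoI)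
  let ?I = "INF u\<in>{0..s}. \<zeta> u" and ?M = "\<lambda>n. Min ((\<lambda>j. \<zeta> (real j * h n)) ` {..k n})"
  have I: "?I \<le> \<zeta> u" if "0 \<le> u" "u \<le> s" for u
    using that by (intro cINF_lower bdd_below_path s) auto
  fix e :: real assume e: "0 < e"
  obtain d where d: "s < d" "\<And>y. s \<le> y \<Longrightarrow> y < d \<Longrightarrow> \<bar>\<zeta> y - \<zeta> s\<bar> < e"
    using right_neighbourhood[OF s e] by metis
  have "\<forall>\<^sub>F n in sequentially. real (k n) * h n < d" using k(2) d(1) by (rule order_tendstoD)
  then have lower: "\<forall>\<^sub>F n in sequentially. ?I - e < ?M n"
  proof eventually_elim
    case (elim n)
    have "?I - e < \<zeta> (real j * h n)" if "j \<le> k n" for j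
    proof (cases "real j * h n \<le> s")
      case True
      then show ?thesis using I[of "real j * h n"] h(1)[of n] e by simp
    next
      case False
      have "real j * h n \<le> real (k n) * h n" using that h(1)[of n] by (intro mult_right_mono) auto
      then show ?thesis using d(2)[of "real j * h n"] False elim I[of s] s by linarith
    qed
    then show ?case by (subst Min_gr_iff) auto
  qed
  have "?I < ?I + e" using e by simp
  then obtain u where u: "0 \<le> u" "u \<le> s" "\<zeta> u < ?I + e"
    using cINF_less_iff[OF _ bdd_below_path[OF s], of "?I + e"] s by auto
  define j where "j n = nat \<lceil>u / h n\<rceil>" for n
  have j: "u \<le> real (j n) * h n" "real (j n) * h n \<le> u + h n" for n
  proof -
    have "0 \<le> u / h n" using u(1) h(1)[of n] by simp
    then have "u / h n \<le> real (j n)" "real (j n) \<le> u / h n + 1"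
      by (auto simp: j_def)
    then show "u \<le> real (j n) * h n" "real (j n) * h n \<le> u + h n"
      using h(1)[of n] by (auto simp: field_simps)
  qed
  have jk: "j n \<le> k n" for n
  proof -
    have "u / h n \<le> real (k n)" using u(2) k(1)[of n] h(1)[of n] by (simp add: pos_divide_le_eq)
    then show ?thesis by (simp add: j_def ceiling_le_iff)
  qed
  have "(\<lambda>n. real (j n) * h n) \<longlonglongrightarrow> u"
  proof (rule tendsto_sandwich[where f = "\<lambda>_. u"])
    show "(\<lambda>n. u + h n) \<longlonglongrightarrow> u" using tendsto_add[OF tendsto_const h(2), of u] by simp
  qed (use j in auto)
  then have "(\<lambda>n. \<zeta> (real (j n) * h n)) \<longlonglongrightarrow> \<zeta> u"
    by (rule tendsto_from_right[OF u(1) j(1)])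
  then have "\<forall>\<^sub>F n in sequentially. \<zeta> (real (j n) * h n) < ?I + e"
    using u(3) by (rule order_tendstoD)
  with lower show "\<forall>\<^sub>F n in sequentially. dist (?M n) ?I < e"
  proof eventually_elim
    case (elim n)
    have "?M n \<le> \<zeta> (real (j n) * h n)" using jk[of n] by (intro Min_le) auto
    then show ?case using elim unfolding dist_real_def by linarith
  qed
qed

lemma lindley_chain_tendsto_reflected:
  assumes x: "0 \<le> x" and s: "0 \<le> s" and h: "\<And>n. 0 < h n" "h \<longlonglongrightarrow> 0"
    and k: "\<And>n. s \<le> real (k n) * h n" "(\<lambda>n. real (k n) * h n) \<longlonglongrightarrow> s"
  shows "(\<lambda>n. lindley_chain x (\<lambda>j. \<zeta> (real (Suc j) * h n) - \<zeta> (real j * h n)) (k n)) \<longlonglongrightarrow> reflected x s"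
proof -
  have "lindley_chain x (\<lambda>j. \<zeta> (real (Suc j) * h n) - \<zeta> (real j * h n)) (k n)
     = \<zeta> (real (k n) * h n) + max x (- Min ((\<lambda>j. \<zeta> (real j * h n)) ` {..k n}))" for n
    by (rule lindley_chain_increments[OF x]) (simp add: start)
  then show ?thesis unfolding reflected_def
    by (simp only:) (intro tendsto_intros tendsto_max tendsto_from_right[OF s k] tendsto_Min_grid[OF s h k])
qed

text \<open>Before the passage time the infimum of the path is at least \<open>- x\<close>, so the maximum is \<open>x\<close>. From the passage time on
  it is at most \<open>- x\<close>; if the passage time is \<open>t\<close> itself, this uses right continuity at \<open>t\<close>.\<close>

lemma reflected_path_eq:
  assumes x: "0 < x" and t: "0 \<le> t"
  shows "reflected_path (\<lambda>s. x + \<zeta> s) t = reflected x t"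
proof -
  let ?I = "INF u\<in>{0..t}. \<zeta> u" and ?S = "{s. 0 < s \<and> x + \<zeta> s \<le> 0}"
  have I: "?I \<le> \<zeta> u" if "0 \<le> u" "u \<le> t" for u
    using that by (intro cINF_lower bdd_below_path t) auto
  have inf: "(INF s\<in>{0..t}. x + \<zeta> s) = x + ?I"
  proof (rule antisym)
    have "(INF s\<in>{0..t}. x + \<zeta> s) - x \<le> ?I"
    proof (rule cINF_greatest)
      fix u assume u: "u \<in> {0..t}"
      have "bdd_below ((\<lambda>s. x + \<zeta> s) ` {0..t})"
        by (rule bdd_belowI2[where m = "x + ?I"]) (use I in auto)
      from cINF_lower[OF this u] show "(INF s\<in>{0..t}. x + \<zeta> s) - x \<le> \<zeta> u" by simp
    qed (use t in auto)
    then show "(INF s\<in>{0..t}. x + \<zeta> s) \<le> x + ?I" by simp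
    show "x + ?I \<le> (INF s\<in>{0..t}. x + \<zeta> s)"
      by (rule cINF_greatest) (use I t in auto)
  qed
  show ?thesis
  proof (cases "ereal t < passage_time (\<lambda>s. x + \<zeta> s)")
    case True
    have "- x \<le> ?I"
    proof (rule cINF_greatest)
      fix u assume u: "u \<in> {0..t}"
      show "- x \<le> \<zeta> u"
      proof (rule ccontr)
        assume "\<not> - x \<le> \<zeta> u"
        then have "u \<in> ?S" using u start x by (cases "u = 0") auto
        then have "passage_time (\<lambda>s. x + \<zeta> s) \<le> ereal u"
          unfolding passage_time_def by (intro Inf_lower) auto
        also have "\<dots> \<le> ereal t" using u by simp
        finally show False using True by simp
      qed
    qed (use t in auto)
    then show ?thesis using True by (simp add: reflected_path_def reflected_def max_def)
  next
    case False
    have "?I \<le> - x"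
    proof (cases "\<exists>u\<in>?S. u \<le> t")
      case True
      then obtain u where "0 < u" "x + \<zeta> u \<le> 0" "u \<le> t" by auto
      then show ?thesis using I[of u] by simp
    next
      case noS: False
      have "\<zeta> t \<le> - x"
      proof (rule field_le_epsilon)
        fix e :: real assume e: "0 < e"
        obtain d where d: "t < d" "\<And>y. t \<le> y \<Longrightarrow> y < d \<Longrightarrow> \<bar>\<zeta> y - \<zeta> t\<bar> < e"
          using right_neighbourhood[OF t e] by metis
        have "passage_time (\<lambda>s. x + \<zeta> s) < ereal d"
          using False d(1) by (meson ereal_less(2) le_less_trans less_ereal.simps(1) not_less)
        then obtain u where u: "u \<in> ?S" "u < d"
          unfolding passage_time_def by (auto simp: Inf_less_iff)
        with noS have "t \<le> u" by auto
        then show "\<zeta> t \<le> - x + e" using d(2)[of u] u by auto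
      qed
      then show ?thesis using I[of t] t by simp
    qed
    then show ?thesis using False by (simp add: reflected_path_def reflected_def inf max_def)
  qed
qed

end

section \<open>Independent increments\<close>

lemma lindley_chain_cong:
  "(\<And>i. i < k \<Longrightarrow> v i = w i) \<Longrightarrow> lindley_chain x v k = lindley_chain x w k"
  by (induction k) auto

lemma measurable_lindley_chain:
  "k \<le> n \<Longrightarrow> (\<lambda>v. lindley_chain x v k) \<in> borel_measurable (PiM {..<n} (\<lambda>_. borel))"
proof (induction k)
  case (Suc k)
  then have [measurable]: "(\<lambda>v. lindley_chain x v k) \<in> borel_measurable (PiM {..<n} (\<lambda>_. borel))" by simp
  have [measurable]: "(\<lambda>v. v k) \<in> borel_measurable (PiM {..<n} (\<lambda>_. borel))"
    using Suc by (intro measurable_component_singleton) auto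
  show ?case by simp
qed simp

text \<open>The last increment is independent of the chain up to then, so integrating it out replaces \<open>f\<close> by
  \<open>lindley_op \<mu> f\<close>.\<close>

lemma (in prob_space) expectation_lindley_chain:
  assumes indep: "\<And>n. indep_vars (\<lambda>_. borel) v {..<n :: nat}"
    and law: "\<And>i. distr M borel (v i) = \<mu>" and f: "bounded_lipschitz f B L"
  shows "(LINT \<omega>|M. f (lindley_chain x (\<lambda>i. v i \<omega>) k)) = (lindley_op \<mu> ^^ k) f x"
  using f
proof (induction k arbitrary: f)
  case 0
  show ?case by (simp add: prob_space)
next
  case (Suc k)
  interpret f: bounded_lipschitz f B L by fact
  have vm [measurable]: "v i \<in> borel_measurable M" for i
    using indep[of "Suc i"] by (auto simp: indep_vars_def)
  have \<mu>: "real_distribution \<mu>" unfolding law[of 0, symmetric] by (rule real_distribution_distr) simp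
  interpret \<mu>: real_distribution \<mu> by fact
  let ?X = "\<lambda>\<omega>. lindley_chain x (\<lambda>i. v i \<omega>) k"
  have "indep_var borel ((\<lambda>g. lindley_chain x g k) \<circ> (\<lambda>\<omega>. restrict (\<lambda>i. v i \<omega>) {..<k}))
      borel ((\<lambda>g. g k) \<circ> (\<lambda>\<omega>. restrict (\<lambda>i. v i \<omega>) {k}))"
    by (rule indep_var_compose[OF indep_var_restrict[OF indep[of "Suc k"]]])
      (auto intro: measurable_lindley_chain)
  moreover have "(\<lambda>g. lindley_chain x g k) \<circ> (\<lambda>\<omega>. restrict (\<lambda>i. v i \<omega>) {..<k}) = ?X"
    by (auto simp: fun_eq_iff intro!: lindley_chain_cong)
  moreover have "(\<lambda>g. g k) \<circ> (\<lambda>\<omega>. restrict (\<lambda>i. v i \<omega>) {k}) = v k" by auto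
  ultimately have iv: "indep_var borel ?X borel (v k)" by simp
  then have Xm [measurable]: "?X \<in> borel_measurable M"
    and pair: "distr M borel ?X \<Otimes>\<^sub>M \<mu> = distr M (borel \<Otimes>\<^sub>M borel) (\<lambda>\<omega>. (?X \<omega>, v k \<omega>))"
    unfolding indep_var_distribution_eq law by auto
  have X: "real_distribution (distr M borel ?X)" by (rule real_distribution_distr) simp
  interpret X: real_distribution "distr M borel ?X" by fact
  interpret XV: pair_prob_space "distr M borel ?X" \<mu> ..
  let ?g = "\<lambda>(a, b). f (max 0 (a + b))"
  have gm: "?g \<in> borel_measurable (borel \<Otimes>\<^sub>M borel)" by measurable
  have gm': "?g \<in> borel_measurable (distr M borel ?X \<Otimes>\<^sub>M \<mu>)"
    unfolding pair using gm by simp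
  have gi: "integrable (distr M borel ?X \<Otimes>\<^sub>M \<mu>) ?g"
    using f.bounded gm' by (intro XV.integrable_const_bound[where B = B]) auto
  have "(LINT \<omega>|M. f (lindley_chain x (\<lambda>i. v i \<omega>) (Suc k))) = (LINT \<omega>|M. ?g (?X \<omega>, v k \<omega>))" by simp
  also have "\<dots> = (LINT p|(distr M borel ?X \<Otimes>\<^sub>M \<mu>). ?g p)"
    unfolding pair by (rule integral_distr[symmetric]) (use gm in measurable)
  also have "\<dots> = (LINT a|(distr M borel ?X). lindley_op \<mu> f a)"
    using XV.integral_fst'[OF gi] by (simp add: lindley_op_def)
  also have "\<dots> = (LINT \<omega>|M. lindley_op \<mu> f (?X \<omega>))"
    using bounded_lipschitz.measurable_borel[OF f.lindley_op[OF \<mu>]] by (intro integral_distr) auto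
  also have "\<dots> = (lindley_op \<mu> ^^ k) (lindley_op \<mu> f) x"
    by (rule Suc.IH[OF f.lindley_op[OF \<mu>]])
  also have "\<dots> = (lindley_op \<mu> ^^ Suc k) f x" by (simp add: funpow_swap1)
  finally show ?case .
qed

section \<open>Laplace transform of the reflected semigroup\<close>

lemma integral_exp_Ioc:
  assumes "0 < b" "0 \<le> a" "a \<le> c"
  shows "integrable leb_pos (\<lambda>s. indicat_real {a<..c} s * (b * exp (- b * s)))"
    and "(LINT s|leb_pos. indicat_real {a<..c} s * (b * exp (- b * s))) = exp (- b * a) - exp (- b * c)"
proof -
  have "has_bochner_integral lborel (\<lambda>s. (b * exp (- b * s)) * indicator {a..c} s) (- exp (- b * c) - (- exp (- b * a)))"
    by (rule has_bochner_integral_FTC_Icc_real[where F = "\<lambda>s. - exp (- b * s)"])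
      (use assms in \<open>auto intro!: derivative_eq_intros continuous_intros\<close>)
  moreover have "AE s in lborel. indicat_real {0<..} s *\<^sub>R (indicat_real {a<..c} s * (b * exp (- b * s))) = (b * exp (- b * s)) * indicator {a..c} s"
    using AE_lborel_singleton[of a] by eventually_elim (use assms in \<open>auto simp: indicator_def\<close>)
  ultimately have "has_bochner_integral lborel (\<lambda>s. indicat_real {0<..} s *\<^sub>R (indicat_real {a<..c} s * (b * exp (- b * s)))) (exp (- b * a) - exp (- b * c))"
    by (subst has_bochner_integral_cong_AE[where g = "\<lambda>s. (b * exp (- b * s)) * indicator {a..c} s"]) auto
  then show "integrable leb_pos (\<lambda>s. indicat_real {a<..c} s * (b * exp (- b * s)))"
    and "(LINT s|leb_pos. indicat_real {a<..c} s * (b * exp (- b * s))) = exp (- b * a) - exp (- b * c)"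
    by (simp_all add: integrable_leb_pos_iff integral_leb_pos_eq set_integrable_def set_lebesgue_integral_def has_bochner_integral_iff)
qed

text \<open>A sum over the grid as the integral of a step function. Rounding up instead of down samples the chain at times to
  the right of \<open>s\<close>, so that right continuity of the paths gives convergence.\<close>

lemma integral_step_function:
  assumes b: "0 < b" and h: "0 < h"
  shows "(LINT s|leb_pos. indicat_real {..real N * h} s * (b * exp (- b * s) * U (nat \<lceil>s / h\<rceil>)))
    = (\<Sum>k<N. U (Suc k) * (exp (- real k * (h * b)) - exp (- real (Suc k) * (h * b))))"
proof -
  have "(LINT s|leb_pos. indicat_real {..real N * h} s * (b * exp (- b * s) * U (nat \<lceil>s / h\<rceil>)))
    = (LINT s|leb_pos. (\<Sum>k<N. U (Suc k) * (indicat_real {real k * h<..real (Suc k) * h} s * (b * exp (- b * s)))))"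
  proof (rule Bochner_Integration.integral_cong[OF refl])
    fix s assume "s \<in> space leb_pos"
    then have s: "0 < s" by (simp add: space_restrict_space)
    define m where "m = nat \<lceil>s / h\<rceil>"
    have m0: "0 < \<lceil>s / h\<rceil>" using s h by simp
    have ind: "indicat_real {real k * h<..real (Suc k) * h} s = (if m = Suc k then 1 else 0)" for k
    proof -
      have "m = Suc k \<longleftrightarrow> \<lceil>s / h\<rceil> = int (Suc k)" using m0 by (auto simp: m_def)
      also have "\<dots> \<longleftrightarrow> real k < s / h \<and> s / h \<le> real (Suc k)" by (simp add: ceiling_eq_iff)
      also have "\<dots> \<longleftrightarrow> s \<in> {real k * h<..real (Suc k) * h}" using h by (simp add: field_simps)
      finally show ?thesis by (simp add: indicator_def)
    qed
    have "s \<le> real N * h \<longleftrightarrow> m \<le> N"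
      using h by (simp add: m_def pos_divide_le_eq[symmetric] ceiling_le_iff nat_le_iff)
    moreover have "0 < m" using m0 by (simp add: m_def)
    moreover have "(\<Sum>k<N. U (Suc k) * ((if m = Suc k then 1 else 0) * (b * exp (- b * s))))
       = (\<Sum>k<N. if k = m - 1 then U m * (b * exp (- b * s)) else 0)"
      using \<open>0 < m\<close> by (intro sum.cong) auto
    ultimately show "indicat_real {..real N * h} s * (b * exp (- b * s) * U (nat \<lceil>s / h\<rceil>))
      = (\<Sum>k<N. U (Suc k) * (indicat_real {real k * h<..real (Suc k) * h} s * (b * exp (- b * s))))"
      unfolding ind m_def[symmetric] by (auto simp: indicator_def sum.delta)
  qed
  also have "\<dots> = (\<Sum>k<N. U (Suc k) * (LINT s|leb_pos. indicat_real {real k * h<..real (Suc k) * h} s * (b * exp (- b * s))))"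
    using h integral_exp_Ioc(1)[OF b]
    by (subst Bochner_Integration.integral_sum) (auto intro!: integrable_mult_right simp: mult_right_mono)
  also have "\<dots> = (\<Sum>k<N. U (Suc k) * (exp (- real k * (h * b)) - exp (- real (Suc k) * (h * b))))"
  proof (rule sum.cong[OF refl])
    fix k
    have "0 \<le> real k * h" "real k * h \<le> real (Suc k) * h" using h by (auto simp: mult_right_mono)
    note I = integral_exp_Ioc(2)[OF b this]
    have "- b * (r * h) = - r * (h * b)" for r by simp
    then show "U (Suc k) * (LINT s|leb_pos. indicat_real {real k * h<..real (Suc k) * h} s * (b * exp (- b * s)))
      = U (Suc k) * (exp (- real k * (h * b)) - exp (- real (Suc k) * (h * b)))"
      unfolding I by (simp only:)
  qed
  finally show ?thesis .
qed

locale stable_process = prob_space M for M :: "'a measure" +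
  fixes \<alpha> :: real and Z :: "real \<Rightarrow> 'a \<Rightarrow> real"
  assumes \<alpha>: "1 < \<alpha>" "\<alpha> < 2" and stable: "spectrally_negative_stable M \<alpha> Z"
begin

lemma levy: "levy_process M Z" using stable by (simp add: spectrally_negative_stable_def)

lemma measurable_Z: "0 \<le> t \<Longrightarrow> Z t \<in> borel_measurable M"
  using levy by (simp add: levy_process_def)

lemma cadlag: "\<omega> \<in> space M \<Longrightarrow> cadlag_path (\<lambda>s. Z s \<omega>)"
  using levy by (auto simp: levy_process_def cadlag_path_def)

definition law :: "real \<Rightarrow> real measure" where
  "law h = distr M borel (Z h)"

lemma law: "0 \<le> h \<Longrightarrow> real_distribution (law h)"
  unfolding law_def by (rule real_distribution_distr) (rule measurable_Z)

text \<open>The Bochner integral of a function that is not integrable is \<open>0\<close>, so the nonzero value of the Laplace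
  transform forces integrability.\<close>

lemma exp_moment:
  assumes h: "0 \<le> h" and \<beta>: "0 < \<beta>"
  shows "integrable (law h) (\<lambda>z. exp (\<beta> * z))" "(LINT z|law h. exp (\<beta> * z)) = exp (h * \<beta> powr \<alpha>)"
proof -
  note [measurable] = measurable_Z[OF h]
  have "(LINT \<omega>|M. exp (complex_of_real \<beta> * complex_of_real (Z h \<omega>))) = exp (complex_of_real h * complex_of_real \<beta> powr complex_of_real \<alpha>)"
    using stable h \<beta> by (simp add: spectrally_negative_stable_def)
  also have "complex_of_real \<beta> powr complex_of_real \<alpha> = complex_of_real (\<beta> powr \<alpha>)"
    using \<beta> by (simp add: powr_of_real)
  finally have "complex_of_real (LINT \<omega>|M. exp (\<beta> * Z h \<omega>)) = complex_of_real (exp (h * \<beta> powr \<alpha>))"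
    by (simp only: of_real_mult[symmetric] exp_of_real integral_complex_of_real)
  then have e: "(LINT \<omega>|M. exp (\<beta> * Z h \<omega>)) = exp (h * \<beta> powr \<alpha>)"
    by (simp only: of_real_eq_iff)
  have "integrable M (\<lambda>\<omega>. exp (\<beta> * Z h \<omega>))"
  proof (rule ccontr)
    assume "\<not> integrable M (\<lambda>\<omega>. exp (\<beta> * Z h \<omega>))"
    from not_integrable_integral_eq[OF this] show False using e by simp
  qed
  then show "integrable (law h) (\<lambda>z. exp (\<beta> * z))"
    unfolding law_def by (subst integrable_distr_eq) auto
  show "(LINT z|law h. exp (\<beta> * z)) = exp (h * \<beta> powr \<alpha>)"
    unfolding law_def using e by (subst integral_distr) auto
qed

lemma expectation_chain:
  assumes h: "0 < h" and f: "bounded_lipschitz f B L"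
  shows "(LINT \<omega>|M. f (lindley_chain x (\<lambda>j. Z (real (Suc j) * h) \<omega> - Z (real j * h) \<omega>) k)) = (lindley_op (law h) ^^ k) f x"
proof (rule expectation_lindley_chain[OF _ _ f])
  have ind: "\<forall>n. \<forall>\<tau> :: nat \<Rightarrow> real. 0 \<le> \<tau> 0 \<and> mono \<tau> \<longrightarrow>
        indep_vars (\<lambda>_. borel) (\<lambda>i \<omega>. Z (\<tau> (Suc i)) \<omega> - Z (\<tau> i) \<omega>) {..<n}"
    and stat: "\<forall>s\<ge>0. \<forall>t\<ge>0. distr M borel (\<lambda>\<omega>. Z (s + t) \<omega> - Z s \<omega>) = distr M borel (Z t)"
    using levy unfolding levy_process_def by blast+
  have "mono (\<lambda>i. real i * h)" using h by (intro monoI mult_right_mono) auto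
  then show "indep_vars (\<lambda>_. borel) (\<lambda>j \<omega>. Z (real (Suc j) * h) \<omega> - Z (real j * h) \<omega>) {..<n}" for n
    using ind[rule_format, of "\<lambda>i. real i * h" n] by simp
  show "distr M borel (\<lambda>\<omega>. Z (real (Suc i) * h) \<omega> - Z (real i * h) \<omega>) = law h" for i
    using stat[rule_format, of "real i * h" h] h by (simp add: law_def algebra_simps)
qed

definition reflected_mean :: "(real \<Rightarrow> real) \<Rightarrow> real \<Rightarrow> real \<Rightarrow> real" where
  "reflected_mean f s x = (LINT \<omega>|M. f (cadlag_path.reflected (\<lambda>s. Z s \<omega>) x s))"

lemma chain_tendsto_reflected_mean:
  assumes f: "bounded_lipschitz f B L" and x: "0 \<le> x" and s: "0 \<le> s" and h: "\<And>n. 0 < h n" "h \<longlonglongrightarrow> 0"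
    and k: "\<And>n. s \<le> real (k n) * h n" "(\<lambda>n. real (k n) * h n) \<longlonglongrightarrow> s"
  shows "(\<lambda>n. (lindley_op (law (h n)) ^^ k n) f x) \<longlonglongrightarrow> reflected_mean f s x"
proof -
  interpret f: bounded_lipschitz f B L by fact
  let ?W = "\<lambda>n \<omega>. lindley_chain x (\<lambda>j. Z (real (Suc j) * h n) \<omega> - Z (real j * h n) \<omega>) (k n)"
  have Wm: "?W n \<in> borel_measurable M" for n
  proof -
    have "(\<lambda>\<omega>. lindley_chain x (\<lambda>j. Z (real (Suc j) * h n) \<omega> - Z (real j * h n) \<omega>) m) \<in> borel_measurable M" for m
    proof (induction m)
      case (Suc m)
      have "0 \<le> real (Suc m) * h n" "0 \<le> real m * h n" using h(1)[of n] by auto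
      with Suc show ?case using measurable_Z by simp
    qed simp
    then show ?thesis .
  qed
  have lim: "(\<lambda>n. ?W n \<omega>) \<longlonglongrightarrow> cadlag_path.reflected (\<lambda>s. Z s \<omega>) x s" if "\<omega> \<in> space M" for \<omega>
    using cadlag_path.lindley_chain_tendsto_reflected[OF cadlag[OF that] x s h k] .
  \<comment> \<open>An infimum over uncountably many times; measurability comes from the limit.\<close>
  have Rm: "(\<lambda>\<omega>. cadlag_path.reflected (\<lambda>s. Z s \<omega>) x s) \<in> borel_measurable M"
    by (rule borel_measurable_LIMSEQ_real[OF lim Wm])
  have "(\<lambda>n. LINT \<omega>|M. f (?W n \<omega>)) \<longlonglongrightarrow> reflected_mean f s x"
    unfolding reflected_mean_def
  proof (rule integral_dominated_convergence[where w = "\<lambda>_. B"])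
    show "AE \<omega> in M. (\<lambda>n. f (?W n \<omega>)) \<longlonglongrightarrow> f (cadlag_path.reflected (\<lambda>s. Z s \<omega>) x s)"
    proof (rule AE_I2)
      fix \<omega> assume "\<omega> \<in> space M"
      then show "(\<lambda>n. f (?W n \<omega>)) \<longlonglongrightarrow> f (cadlag_path.reflected (\<lambda>s. Z s \<omega>) x s)"
        using f.cont by (intro isCont_tendsto_compose[OF _ lim]) (auto simp: continuous_on_eq_continuous_at)
    qed
    show "AE \<omega> in M. norm (f (?W n \<omega>)) \<le> B" for n using f.bounded by simp
    show "(\<lambda>\<omega>. f (cadlag_path.reflected (\<lambda>s. Z s \<omega>) x s)) \<in> borel_measurable M"
      by (rule measurable_compose[OF Rm f.measurable_borel])
    show "(\<lambda>\<omega>. f (?W n \<omega>)) \<in> borel_measurable M" for n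
      using measurable_compose[OF Wm f.measurable_borel] .
  qed simp
  then show ?thesis using expectation_chain[OF h(1) f] by simp
qed

lemma chain_at_time_tendsto:
  assumes f: "bounded_lipschitz f B L" and x: "0 \<le> x" and s: "0 \<le> s" and h: "\<And>n. 0 < h n" "h \<longlonglongrightarrow> 0"
  shows "(\<lambda>n. (lindley_op (law (h n)) ^^ nat \<lceil>s / h n\<rceil>) f x) \<longlonglongrightarrow> reflected_mean f s x"
proof (rule chain_tendsto_reflected_mean[OF f x s h])
  have b: "s \<le> real (nat \<lceil>s / h n\<rceil>) * h n \<and> real (nat \<lceil>s / h n\<rceil>) * h n \<le> s + h n" for n
  proof -
    have "0 \<le> s / h n" using s h(1)[of n] by simp
    then have "s / h n \<le> real (nat \<lceil>s / h n\<rceil>)" "real (nat \<lceil>s / h n\<rceil>) \<le> s / h n + 1" by auto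
    then show ?thesis using h(1)[of n] by (auto simp: field_simps)
  qed
  then show "s \<le> real (nat \<lceil>s / h n\<rceil>) * h n" for n by simp
  show "(\<lambda>n. real (nat \<lceil>s / h n\<rceil>) * h n) \<longlonglongrightarrow> s"
  proof (rule tendsto_sandwich[where f = "\<lambda>_. s"])
    show "(\<lambda>n. s + h n) \<longlonglongrightarrow> s" using tendsto_add[OF tendsto_const h(2), of s] by simp
  qed (use b in auto)
qed

lemma lim_1_over_Suc: "0 < t \<Longrightarrow> 0 < t / real (Suc n)" "(\<lambda>n. t / real (Suc n)) \<longlonglongrightarrow> 0"
  using LIMSEQ_Suc[OF lim_const_over_n, of t] by auto

lemma abs_reflected_mean_le:
  assumes f: "bounded_lipschitz f B L" and x: "0 \<le> x" and s: "0 \<le> s"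
  shows "\<bar>reflected_mean f s x\<bar> \<le> B"
proof (rule LIMSEQ_le_const2[OF tendsto_rabs[OF chain_at_time_tendsto[OF f x s lim_1_over_Suc[of 1]]]])
  interpret f: bounded_lipschitz f B L by fact
  have "\<bar>(lindley_op (law (1 / real (Suc n))) ^^ k) f x\<bar> \<le> B" for n k
    using f.funpow_lindley_op[OF law, of "1 / real (Suc n)" k] by (simp add: bounded_lipschitz_def)
  then show "\<exists>N. \<forall>n\<ge>N. \<bar>(lindley_op (law (1 / real (Suc n))) ^^ nat \<lceil>s / (1 / real (Suc n))\<rceil>) f x\<bar> \<le> B" by blast
qed simp

lemma measurable_reflected_mean:
  assumes f: "bounded_lipschitz f B L"
  shows "(\<lambda>s. reflected_mean f s 0) \<in> borel_measurable leb_pos" 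
    and "0 \<le> s \<Longrightarrow> (\<lambda>x. reflected_mean f s x) \<in> borel_measurable leb_pos"
proof -
  interpret f: bounded_lipschitz f B L by fact
  let ?h = "\<lambda>n. 1 / real (Suc n)"
  have h: "0 < ?h n" "?h \<longlonglongrightarrow> 0" for n using lim_1_over_Suc[of 1] by auto
  show "(\<lambda>s. reflected_mean f s 0) \<in> borel_measurable leb_pos"
  proof (rule borel_measurable_LIMSEQ_real)
    show "(\<lambda>n. (lindley_op (law (?h n)) ^^ nat \<lceil>s / ?h n\<rceil>) f 0) \<longlonglongrightarrow> reflected_mean f s 0"
      if "s \<in> space leb_pos" for s
      using that by (intro chain_at_time_tendsto[OF f _ _ h]) (auto simp: space_restrict_space)
    show "(\<lambda>s. (lindley_op (law (?h n)) ^^ nat \<lceil>s / ?h n\<rceil>) f 0) \<in> borel_measurable leb_pos" for n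
    proof (rule borel_measurable_leb_pos)
      have "(\<lambda>s. nat \<lceil>s / ?h n\<rceil>) \<in> borel \<rightarrow>\<^sub>M count_space UNIV" by measurable
      from measurable_compose[OF this, of "\<lambda>k. (lindley_op (law (?h n)) ^^ k) f 0" borel]
      show "(\<lambda>s. (lindley_op (law (?h n)) ^^ nat \<lceil>s / ?h n\<rceil>) f 0) \<in> borel_measurable borel" by simp
    qed
  qed
  assume s: "0 \<le> s"
  show "(\<lambda>x. reflected_mean f s x) \<in> borel_measurable leb_pos"
  proof (rule borel_measurable_LIMSEQ_real)
    show "(\<lambda>n. (lindley_op (law (?h n)) ^^ nat \<lceil>s / ?h n\<rceil>) f x) \<longlonglongrightarrow> reflected_mean f s x"
      if "x \<in> space leb_pos" for x
      using that by (intro chain_at_time_tendsto[OF f _ s h]) (auto simp: space_restrict_space)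
    show "(\<lambda>x. (lindley_op (law (?h n)) ^^ nat \<lceil>s / ?h n\<rceil>) f x) \<in> borel_measurable leb_pos" for n
      by (intro borel_measurable_leb_pos bounded_lipschitz.measurable_borel[OF f.funpow_lindley_op[OF law]]) simp
  qed
qed

text \<open>The integrated form of the evolution equation \<open>\<partial>\<^sub>t u = D\<^sup>\<alpha> u\<close> with the Caputo derivative \<open>D\<^sup>\<alpha>\<close>, after a Laplace
  transform in the starting point: the only trace of the reflection is the boundary value of \<open>u\<close>. It is the limit
  of \<open>lindley_laplace_chain\<close> with \<open>n + 1\<close> steps of size \<open>t / (n + 1)\<close>, whose total error is of order
  \<open>n powr (1 - 2 / \<alpha>)\<close>.\<close>

lemma laplace_reflected_mean:
  assumes f: "bounded_lipschitz f B L" and \<beta>: "0 < \<beta>" and t: "0 < t"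
  shows "exp (- t * \<beta> powr \<alpha>) * (LINT x|leb_pos. exp (- \<beta> * x) * reflected_mean f t x)
    = (LINT x|leb_pos. exp (- \<beta> * x) * f x)
      - 1 / \<beta> * (LINT s|leb_pos. indicat_real {..t} s * (\<beta> powr \<alpha> * exp (- (\<beta> powr \<alpha>) * s) * reflected_mean f s 0))"
proof -
  interpret f: bounded_lipschitz f B L by fact
  define b where "b = \<beta> powr \<alpha>"
  have b: "0 < b" using \<beta> by (simp add: b_def)
  define h where "h n = t / real (Suc n)" for n
  have h: "0 < h n" "h \<longlonglongrightarrow> 0" for n
    using lim_1_over_Suc(1)[OF t] lim_1_over_Suc(2)[of t] by (simp_all add: h_def[abs_def])
  define F where "F n k = (lindley_op (law (h n)) ^^ k) f" for n k
  have lawh: "real_distribution (law (h n))" for n using law h(1)[of n] by simp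
  have FB: "bounded_lipschitz (F n k) B L" for n k
    unfolding F_def by (rule f.funpow_lindley_op[OF lawh])
  have Fb: "\<bar>F n k x\<bar> \<le> B" for n k x using bounded_lipschitz.bounded[OF FB] .
  have Fm: "F n k \<in> borel_measurable borel" for n k using bounded_lipschitz.measurable_borel[OF FB] .
  have Nh: "real (Suc n) * h n = t" for n by (simp add: h_def)
  have Nc: "real (Suc n) * (h n * b) = t * b" for n using Nh[of n] by (simp only: mult.assoc[symmetric])
  let ?w = "\<lambda>n k. exp (- real k * (h n * b)) - exp (- real (Suc k) * (h n * b))"
  define a where "a n = (LINT x|leb_pos. exp (- \<beta> * x) * F n (Suc n) x)" for n
  define a0 where "a0 = (LINT x|leb_pos. exp (- \<beta> * x) * f x)"
  define a\<^sub>t where "a\<^sub>t = (LINT x|leb_pos. exp (- \<beta> * x) * reflected_mean f t x)"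
  define T where "T n = (\<Sum>k<Suc n. F n k 0 * ?w n k)" for n
  define S where "S n = (\<Sum>k<Suc n. F n (Suc k) 0 * ?w n k)" for n
  define I where "I = (LINT s|leb_pos. indicat_real {..t} s * (b * exp (- b * s) * reflected_mean f s 0))"
  define E where "E h = 2 * L * t * (h powr (2 / \<alpha> - 1) * exp ((\<beta> * h powr (1 / \<alpha>) + 1) powr \<alpha>))" for h :: real
  have chain: "\<bar>exp (- t * b) * a n - a0 + 1 / \<beta> * T n\<bar> \<le> E (h n)" for n
  proof -
    \<comment> \<open>The scaling of the stable process: this \<open>\<delta>\<close> keeps the exponential moment in the error bounded as \<open>h n\<close> tends to \<open>0\<close>.\<close>
    define \<delta> where "\<delta> = h n powr (- (1 / \<alpha>))"
    have \<delta>: "0 < \<delta>" using h(1)[of n] by (simp add: \<delta>_def)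
    have "\<bar>exp (- real (Suc n) * (h n * b)) * a n - a0 + 1 / \<beta> * T n\<bar>
        \<le> real (Suc n) * (2 * L / \<delta>\<^sup>2 * (LINT z|law (h n). exp ((\<beta> + \<delta>) * z)))"
      unfolding a_def a0_def T_def F_def
      using \<beta> \<delta> b h(1)[of n]
      by (intro f.lindley_laplace_chain[OF lawh] exp_moment) (auto simp: exp_moment b_def)
    also have "(LINT z|law (h n). exp ((\<beta> + \<delta>) * z)) = exp (h n * (\<beta> + \<delta>) powr \<alpha>)"
      using \<beta> \<delta> h(1)[of n] by (intro exp_moment) auto
    also have "h n * (\<beta> + \<delta>) powr \<alpha> = (\<beta> * h n powr (1 / \<alpha>) + 1) powr \<alpha>"
    proof -
      have "h n = (h n powr (1 / \<alpha>)) powr \<alpha>" using h(1)[of n] \<alpha> by (simp add: powr_powr)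
      then have "h n * (\<beta> + \<delta>) powr \<alpha> = (h n powr (1 / \<alpha>)) powr \<alpha> * (\<beta> + \<delta>) powr \<alpha>" by simp
      also have "\<dots> = (h n powr (1 / \<alpha>) * (\<beta> + \<delta>)) powr \<alpha>" by (simp add: powr_mult)
      also have "h n powr (1 / \<alpha>) * (\<beta> + \<delta>) = \<beta> * h n powr (1 / \<alpha>) + 1"
        using h(1)[of n] by (simp add: \<delta>_def algebra_simps flip: powr_add)
      finally show ?thesis .
    qed
    also have "real (Suc n) * (2 * L / \<delta>\<^sup>2 * exp ((\<beta> * h n powr (1 / \<alpha>) + 1) powr \<alpha>)) = E (h n)"
    proof -
      have "real (Suc n) = t / h n" using t by (simp add: h_def)
      moreover have "1 / \<delta>\<^sup>2 = h n powr (2 / \<alpha>)"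
        using h(1)[of n] by (simp add: \<delta>_def power2_eq_square powr_minus_divide flip: powr_add)
      ultimately have "real (Suc n) * (2 * L / \<delta>\<^sup>2) = 2 * L * t * (h n powr (2 / \<alpha>) / h n)"
        using h(1)[of n] by (simp add: divide_inverse mult_ac)
      also have "h n powr (2 / \<alpha>) / h n = h n powr (2 / \<alpha> - 1)"
        using h(1)[of n] by (simp add: powr_diff)
      finally have A: "real (Suc n) * (2 * L / \<delta>\<^sup>2) = 2 * L * t * h n powr (2 / \<alpha> - 1)" .
      show ?thesis unfolding E_def mult.assoc[symmetric] A[unfolded mult.assoc[symmetric]] ..
    qed
    also have "- real (Suc n) * (h n * b) = - t * b" unfolding mult_minus_left Nc ..
    finally show ?thesis .
  qed
  have hr: "filterlim h (at_right 0) sequentially"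
    using h by (auto simp: filterlim_at intro!: always_eventually less_imp_neq[symmetric])
  have E0: "(\<lambda>n. E (h n)) \<longlonglongrightarrow> 0"
  proof -
    have p: "0 < 2 / \<alpha> - 1" "0 < 1 / \<alpha>" using \<alpha> by auto
    have pw: "((\<lambda>x::real. x powr r) \<longlongrightarrow> 0) (at_right 0)" if "0 < r" for r
      using that by real_asymp
    have "(E \<longlongrightarrow> 2 * L * t * (0 * exp ((\<beta> * 0 + 1) powr \<alpha>))) (at_right 0)"
      unfolding E_def[abs_def] by (intro tendsto_intros pw p) auto
    then show ?thesis using filterlim_compose[OF _ hr] by simp
  qed
  have Sint: "S n = (LINT s|leb_pos. indicat_real {..t} s * (b * exp (- b * s) * F n (nat \<lceil>s / h n\<rceil>) 0))" for n
    unfolding S_def using integral_step_function[OF b h(1)[of n], where U = "\<lambda>k. F n k 0" and N = "Suc n"]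
    unfolding Nh by simp
  have S: "S \<longlonglongrightarrow> I"
    unfolding Sint I_def
  proof (rule integral_dominated_convergence[where w = "\<lambda>s. B * b * exp (- b * s)"])
    show "AE s in leb_pos. (\<lambda>n. indicat_real {..t} s * (b * exp (- b * s) * F n (nat \<lceil>s / h n\<rceil>) 0))
        \<longlonglongrightarrow> indicat_real {..t} s * (b * exp (- b * s) * reflected_mean f s 0)"
    proof (rule AE_leb_pos)
      fix s :: real assume "0 < s"
      then have "(\<lambda>n. F n (nat \<lceil>s / h n\<rceil>) 0) \<longlonglongrightarrow> reflected_mean f s 0"
        unfolding F_def by (intro chain_at_time_tendsto[OF f _ _ h]) auto
      then show "(\<lambda>n. indicat_real {..t} s * (b * exp (- b * s) * F n (nat \<lceil>s / h n\<rceil>) 0))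
        \<longlonglongrightarrow> indicat_real {..t} s * (b * exp (- b * s) * reflected_mean f s 0)"
        by (rule tendsto_mult_left[OF tendsto_mult_left])
    qed
    show "AE s in leb_pos. norm (indicat_real {..t} s * (b * exp (- b * s) * F n (nat \<lceil>s / h n\<rceil>) 0)) \<le> B * b * exp (- b * s)" for n
    proof (rule AE_leb_pos)
      fix s :: real
      have "\<bar>indicat_real {..t} s\<bar> * (b * exp (- b * s) * \<bar>F n (nat \<lceil>s / h n\<rceil>) 0\<bar>) \<le> 1 * (b * exp (- b * s) * B)"
        using b Fb by (intro mult_mono mult_left_mono) (auto simp: indicator_def)
      then show "norm (indicat_real {..t} s * (b * exp (- b * s) * F n (nat \<lceil>s / h n\<rceil>) 0)) \<le> B * b * exp (- b * s)"
        using b by (simp add: abs_mult mult_ac)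
    qed
    have im: "(\<lambda>s. indicat_real {..t} s * (b * exp (- b * s))) \<in> borel_measurable leb_pos"
      by (rule borel_measurable_leb_pos) measurable
    show "(\<lambda>s. indicat_real {..t} s * (b * exp (- b * s) * reflected_mean f s 0)) \<in> borel_measurable leb_pos"
      using borel_measurable_times[OF im measurable_reflected_mean(1)[OF f]] by (simp add: mult.assoc)
    show "(\<lambda>s. indicat_real {..t} s * (b * exp (- b * s) * F n (nat \<lceil>s / h n\<rceil>) 0)) \<in> borel_measurable leb_pos" for n
    proof -
      have "(\<lambda>s. nat \<lceil>s / h n\<rceil>) \<in> borel \<rightarrow>\<^sub>M count_space UNIV" by measurable
      from measurable_compose[OF this, of "\<lambda>k. F n k 0" borel]
      have "(\<lambda>s. F n (nat \<lceil>s / h n\<rceil>) 0) \<in> borel_measurable leb_pos" by (intro borel_measurable_leb_pos) simp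
      from borel_measurable_times[OF im this] show ?thesis by (simp add: mult.assoc)
    qed
  qed (use laplace_integrals(1)[OF b] in simp)
  have hb0: "(\<lambda>n. exp (- (h n * b))) \<longlonglongrightarrow> 1"
  proof -
    have "(\<lambda>n. exp (- (h n * b))) \<longlonglongrightarrow> exp (- (0 * b))" by (intro tendsto_intros h)
    then show ?thesis by simp
  qed
  have wstep: "?w n (Suc k) = exp (- (h n * b)) * ?w n k" for n k
  proof -
    have "exp (- real (Suc j) * (h n * b)) = exp (- (h n * b)) * exp (- real j * (h n * b))" for j
      by (simp add: algebra_simps flip: exp_add)
    then show ?thesis by (simp only: right_diff_distrib)
  qed
  \<comment> \<open>The weights of consecutive grid intervals differ by the factor \<open>exp (- (h n * b))\<close>, which tends to \<open>1\<close>, so sampling the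
    chain at the left or at the right ends of the intervals gives the same limit.\<close>
  have TS: "T n = F n 0 0 * (1 - exp (- (h n * b))) + exp (- (h n * b)) * (S n - F n (Suc n) 0 * ?w n n)" for n
  proof -
    have "T n = F n 0 0 * ?w n 0 + (\<Sum>k<n. F n (Suc k) 0 * ?w n (Suc k))"
      unfolding T_def by (rule sum.lessThan_Suc_shift)
    also have "(\<Sum>k<n. F n (Suc k) 0 * ?w n (Suc k)) = exp (- (h n * b)) * (\<Sum>k<n. F n (Suc k) 0 * ?w n k)"
      unfolding wstep sum_distrib_left by (simp only: mult.left_commute)
    also have "(\<Sum>k<n. F n (Suc k) 0 * ?w n k) = S n - F n (Suc n) 0 * ?w n n"
      unfolding S_def by simp
    finally show ?thesis by simp
  qed
  have small: "(\<lambda>n. F n k 0 * (1 - exp (- (h n * b)))) \<longlonglongrightarrow> 0" for k :: nat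
  proof (rule Lim_null_comparison)
    show "(\<lambda>n. B * (1 - exp (- (h n * b)))) \<longlonglongrightarrow> 0"
      using tendsto_mult_left[OF tendsto_diff[OF tendsto_const hb0], of B 1] by simp
    have "norm (F n k 0 * (1 - exp (- (h n * b)))) \<le> B * (1 - exp (- (h n * b)))" for n
      using Fb[of n k 0] h(1)[of n] b by (auto simp: abs_mult intro!: mult_right_mono)
    then show "\<forall>\<^sub>F n in sequentially. norm (F n k 0 * (1 - exp (- (h n * b)))) \<le> B * (1 - exp (- (h n * b)))" by simp
  qed
  have last: "(\<lambda>n. F n (Suc n) 0 * ?w n n) \<longlonglongrightarrow> 0"
  proof (rule Lim_null_comparison)
    show "(\<lambda>n. B * (1 - exp (- (h n * b)))) \<longlonglongrightarrow> 0"
      using tendsto_mult_left[OF tendsto_diff[OF tendsto_const hb0], of B 1] by simp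
    have "norm (F n (Suc n) 0 * ?w n n) \<le> B * (1 - exp (- (h n * b)))" for n
    proof -
      have c: "0 \<le> h n * b" using h(1)[of n] b by simp
      have "?w n n = exp (- (real n * (h n * b))) * (1 - exp (- (h n * b)))"
        by (simp add: algebra_simps flip: exp_add)
      moreover have "exp (- (real n * (h n * b))) \<le> 1" using c by simp
      ultimately have "\<bar>?w n n\<bar> \<le> 1 * (1 - exp (- (h n * b)))"
        using c by (simp only: abs_mult abs_exp_cancel) (intro mult_mono, auto)
      then show ?thesis unfolding real_norm_def abs_mult using Fb[of n "Suc n" 0] f.B_nonneg
        by (intro mult_mono) auto
    qed
    then show "\<forall>\<^sub>F n in sequentially. norm (F n (Suc n) 0 * ?w n n) \<le> B * (1 - exp (- (h n * b)))" by simp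
  qed
  have "(\<lambda>n. F n 0 0 * (1 - exp (- (h n * b))) + exp (- (h n * b)) * (S n - F n (Suc n) 0 * ?w n n)) \<longlonglongrightarrow> 0 + 1 * (I - 0)"
    by (intro tendsto_add tendsto_mult tendsto_diff small hb0 S last)
  then have T: "T \<longlonglongrightarrow> I" unfolding TS[symmetric] by simp
  have A: "a \<longlonglongrightarrow> a\<^sub>t"
    unfolding a_def[abs_def] a\<^sub>t_def
  proof (rule integral_dominated_convergence[where w = "\<lambda>x. B * exp (- \<beta> * x)"])
    show "AE x in leb_pos. (\<lambda>n. exp (- \<beta> * x) * F n (Suc n) x) \<longlonglongrightarrow> exp (- \<beta> * x) * reflected_mean f t x"
    proof (rule AE_leb_pos)
      fix x :: real assume "0 < x"
      then have "(\<lambda>n. F n (Suc n) x) \<longlonglongrightarrow> reflected_mean f t x"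
        unfolding F_def using t Nh by (intro chain_tendsto_reflected_mean[OF f _ _ h]) (auto simp del: of_nat_Suc)
      then show "(\<lambda>n. exp (- \<beta> * x) * F n (Suc n) x) \<longlonglongrightarrow> exp (- \<beta> * x) * reflected_mean f t x"
        by (rule tendsto_mult_left)
    qed
    show "AE x in leb_pos. norm (exp (- \<beta> * x) * F n (Suc n) x) \<le> B * exp (- \<beta> * x)" for n
      using Fb by (simp add: abs_mult mult.commute)
    have em: "(\<lambda>x. exp (- \<beta> * x)) \<in> borel_measurable leb_pos" by (rule borel_measurable_leb_pos) measurable
    show "(\<lambda>x. exp (- \<beta> * x) * reflected_mean f t x) \<in> borel_measurable leb_pos"
      using t by (intro borel_measurable_times em measurable_reflected_mean(2)[OF f]) simp
    show "(\<lambda>x. exp (- \<beta> * x) * F n (Suc n) x) \<in> borel_measurable leb_pos" for n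
      by (intro borel_measurable_times em borel_measurable_leb_pos[OF Fm])
  qed (use laplace_integrals(1)[OF \<beta>] in simp)
  have "(\<lambda>n. exp (- t * b) * a n - a0 + 1 / \<beta> * T n) \<longlonglongrightarrow> exp (- t * b) * a\<^sub>t - a0 + 1 / \<beta> * I"
    by (intro tendsto_intros A T)
  moreover have "(\<lambda>n. exp (- t * b) * a n - a0 + 1 / \<beta> * T n) \<longlonglongrightarrow> 0"
    by (rule Lim_null_comparison[OF _ E0]) (use chain in simp)
  ultimately have "exp (- t * b) * a\<^sub>t - a0 + 1 / \<beta> * I = 0" by (rule LIMSEQ_unique)
  then have "exp (- t * b) * a\<^sub>t = a0 - 1 / \<beta> * I" by linarith
  then show ?thesis unfolding a\<^sub>t_def a0_def I_def b_def .
qed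

text \<open>Since the Laplace transform of \<open>u\<close> at time \<open>t\<close> is bounded, the left-hand side of \<open>laplace_reflected_mean\<close> vanishes
  as \<open>t\<close> tends to infinity, and the boundary value is determined by the initial function.\<close>

lemma laplace_reflected_mean_at_0:
  assumes f: "bounded_lipschitz f B L" and \<beta>: "0 < \<beta>"
  shows "(LINT s|leb_pos. exp (- (\<beta> powr \<alpha>) * s) * reflected_mean f s 0) = \<beta> / \<beta> powr \<alpha> * (LINT x|leb_pos. exp (- \<beta> * x) * f x)"
proof -
  interpret f: bounded_lipschitz f B L by fact
  define b where "b = \<beta> powr \<alpha>"
  have b: "0 < b" using \<beta> by (simp add: b_def)
  define a0 where "a0 = (LINT x|leb_pos. exp (- \<beta> * x) * f x)"
  define V where "V = (LINT s|leb_pos. exp (- b * s) * reflected_mean f s 0)"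
  let ?t = "\<lambda>n. real (Suc n)"
  have I: "(\<lambda>n. LINT s|leb_pos. indicat_real {..?t n} s * (b * exp (- b * s) * reflected_mean f s 0)) \<longlonglongrightarrow> (LINT s|leb_pos. b * exp (- b * s) * reflected_mean f s 0)"
  proof (rule integral_dominated_convergence[where w = "\<lambda>s. B * b * exp (- b * s)"])
    show "AE s in leb_pos. (\<lambda>n. indicat_real {..?t n} s * (b * exp (- b * s) * reflected_mean f s 0)) \<longlonglongrightarrow> b * exp (- b * s) * reflected_mean f s 0"
    proof (rule AE_leb_pos, rule tendsto_eventually)
      fix s :: real
      have "\<forall>\<^sub>F n in sequentially. s \<le> ?t n" by real_asymp
      then show "\<forall>\<^sub>F n in sequentially. indicat_real {..?t n} s * (b * exp (- b * s) * reflected_mean f s 0) = b * exp (- b * s) * reflected_mean f s 0"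
        by eventually_elim simp
    qed
    show "AE s in leb_pos. norm (indicat_real {..?t n} s * (b * exp (- b * s) * reflected_mean f s 0)) \<le> B * b * exp (- b * s)" for n
    proof (rule AE_leb_pos)
      fix s :: real assume s: "0 < s"
      have "\<bar>indicat_real {..?t n} s\<bar> * (b * exp (- b * s) * \<bar>reflected_mean f s 0\<bar>) \<le> 1 * (b * exp (- b * s) * B)"
        using b s abs_reflected_mean_le[OF f, of 0 s] by (intro mult_mono mult_left_mono) (auto simp: indicator_def)
      then show "norm (indicat_real {..?t n} s * (b * exp (- b * s) * reflected_mean f s 0)) \<le> B * b * exp (- b * s)"
        using b by (simp add: abs_mult mult_ac)
    qed
    have em: "(\<lambda>s. b * exp (- b * s)) \<in> borel_measurable leb_pos" by (rule borel_measurable_leb_pos) measurable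
    show m: "(\<lambda>s. b * exp (- b * s) * reflected_mean f s 0) \<in> borel_measurable leb_pos"
      by (intro borel_measurable_times em measurable_reflected_mean(1)[OF f])
    show "(\<lambda>s. indicat_real {..?t n} s * (b * exp (- b * s) * reflected_mean f s 0)) \<in> borel_measurable leb_pos" for n
      by (intro borel_measurable_times m borel_measurable_leb_pos[of "indicat_real {..?t n}"]) measurable
  qed (use laplace_integrals(1)[OF b] in simp)
  have "(\<lambda>n. exp (- ?t n * b) * (LINT x|leb_pos. exp (- \<beta> * x) * reflected_mean f (?t n) x)) \<longlonglongrightarrow> 0"
  proof (rule Lim_null_comparison)
    show "(\<lambda>n. exp (- ?t n * b) * (B / \<beta>)) \<longlonglongrightarrow> 0" using b by real_asymp
    have "norm (exp (- ?t n * b) * (LINT x|leb_pos. exp (- \<beta> * x) * reflected_mean f (?t n) x)) \<le> exp (- ?t n * b) * (B / \<beta>)" for n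
    proof -
      have t: "0 \<le> ?t n" by simp
      have i: "integrable leb_pos (\<lambda>x. exp (- \<beta> * x) * reflected_mean f (?t n) x)"
        using integrable_leb_pos_bounded_mult[OF laplace_integrals(1)[OF \<beta>] measurable_reflected_mean(2)[OF f t], of B]
          abs_reflected_mean_le[OF f _ t] by (simp add: mult.commute)
      have "\<bar>LINT x|leb_pos. exp (- \<beta> * x) * reflected_mean f (?t n) x\<bar> \<le> (LINT x|leb_pos. exp (- \<beta> * x) * B)"
      proof (rule order_trans[OF integral_abs_bound], rule integral_mono_AE[OF integrable_abs[OF i]])
        show "AE x in leb_pos. \<bar>exp (- \<beta> * x) * reflected_mean f (?t n) x\<bar> \<le> exp (- \<beta> * x) * B"
          using abs_reflected_mean_le[OF f _ t] by (intro AE_leb_pos) (simp add: abs_mult)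
      qed (use laplace_integrals(1)[OF \<beta>] in simp)
      also have "\<dots> = B / \<beta>" using laplace_integrals(2)[OF \<beta>] by simp
      finally show ?thesis unfolding real_norm_def abs_mult abs_exp_cancel by (rule mult_left_mono) simp
    qed
    then show "\<forall>\<^sub>F n in sequentially. norm (exp (- ?t n * b) * (LINT x|leb_pos. exp (- \<beta> * x) * reflected_mean f (?t n) x)) \<le> exp (- ?t n * b) * (B / \<beta>)" by simp
  qed
  moreover have "exp (- ?t n * b) * (LINT x|leb_pos. exp (- \<beta> * x) * reflected_mean f (?t n) x)
     = a0 - 1 / \<beta> * (LINT s|leb_pos. indicat_real {..?t n} s * (b * exp (- b * s) * reflected_mean f s 0))" for n
    unfolding a0_def b_def by (rule laplace_reflected_mean[OF f \<beta>]) simp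
  ultimately have "(\<lambda>n. a0 - 1 / \<beta> * (LINT s|leb_pos. indicat_real {..?t n} s * (b * exp (- b * s) * reflected_mean f s 0))) \<longlonglongrightarrow> 0"
    by (simp only:)
  moreover have "(\<lambda>n. a0 - 1 / \<beta> * (LINT s|leb_pos. indicat_real {..?t n} s * (b * exp (- b * s) * reflected_mean f s 0)))
      \<longlonglongrightarrow> a0 - 1 / \<beta> * (LINT s|leb_pos. b * exp (- b * s) * reflected_mean f s 0)"
    by (intro tendsto_intros I)
  ultimately have "0 = a0 - 1 / \<beta> * (LINT s|leb_pos. b * exp (- b * s) * reflected_mean f s 0)"
    by (rule LIMSEQ_unique)
  also have "(LINT s|leb_pos. b * exp (- b * s) * reflected_mean f s 0) = b * V"
    unfolding V_def by (simp only: mult.assoc integral_mult_right_zero)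
  finally have "V = \<beta> / b * a0" using \<beta> b by (simp add: field_simps)
  then show ?thesis unfolding V_def a0_def b_def .
qed

lemma bounded_lipschitz_mittag_leffler:
  obtains B L where "bounded_lipschitz (\<lambda>x. mittag_leffler \<alpha> (q * x)) B L"
proof -
  obtain B where B: "\<And>x. \<bar>mittag_leffler \<alpha> x\<bar> \<le> B" using mittag_leffler_bounded[OF \<alpha>] by blast
  obtain L where L: "\<And>x y. \<bar>mittag_leffler \<alpha> x - mittag_leffler \<alpha> y\<bar> \<le> L * \<bar>x - y\<bar>"
    using mittag_leffler_lipschitz[OF \<alpha>] by blast
  have "\<bar>mittag_leffler \<alpha> (q * x) - mittag_leffler \<alpha> (q * y)\<bar> \<le> (L * \<bar>q\<bar>) * \<bar>x - y\<bar>" for x y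
    using L[of "q * x" "q * y"] by (simp add: abs_mult mult.assoc flip: right_diff_distrib)
  with B have "bounded_lipschitz (\<lambda>x. mittag_leffler \<alpha> (q * x)) B (L * \<bar>q\<bar>)" by unfold_locales
  then show thesis by (rule that)
qed

lemma laplace_unique_real:
  fixes u v :: "real \<Rightarrow> real"
  assumes m: "u \<in> borel_measurable leb_pos" "v \<in> borel_measurable leb_pos"
    and B: "\<And>x. 0 < x \<Longrightarrow> \<bar>u x\<bar> \<le> B" "\<And>x. 0 < x \<Longrightarrow> \<bar>v x\<bar> \<le> B"
    and eq: "\<And>b. 0 < b \<Longrightarrow> (LINT x|leb_pos. exp (- b * x) * u x) = (LINT x|leb_pos. exp (- b * x) * v x)"
  shows "AE x in leb_pos. u x = v x"
proof -
  have "AE x in leb_pos. complex_of_real (u x - v x) = 0"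
  proof (rule laplace_unique)
    show "(\<lambda>x. complex_of_real (u x - v x)) \<in> borel_measurable leb_pos" using m by measurable
    show "norm (complex_of_real (u x - v x)) \<le> B + B" if "0 < x" for x
      using B[OF that] unfolding norm_of_real by linarith
    fix b :: real assume b: "0 < b"
    have i: "integrable leb_pos (\<lambda>x. exp (- b * x) * w x)"
      if "w \<in> borel_measurable leb_pos" "\<And>x. 0 < x \<Longrightarrow> \<bar>w x\<bar> \<le> B" for w
      using integrable_leb_pos_bounded_mult[OF laplace_integrals(1)[OF b] that(1), of B] that(2)
      by (simp add: mult.commute)
    have "(LINT x|leb_pos. complex_of_real (exp (- b * x)) * complex_of_real (u x - v x))
       = complex_of_real (LINT x|leb_pos. exp (- b * x) * u x - exp (- b * x) * v x)"
      unfolding of_real_mult[symmetric] right_diff_distrib by (rule integral_complex_of_real)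
    also have "(LINT x|leb_pos. exp (- b * x) * u x - exp (- b * x) * v x) = 0"
      using eq[OF b] i[OF m(1) B(1)] i[OF m(2) B(2)] by simp
    finally show "(LINT x|leb_pos. complex_of_real (exp (- b * x)) * complex_of_real (u x - v x)) = 0" by simp
  qed
  then show ?thesis by eventually_elim (simp flip: of_real_diff)
qed

text \<open>For the initial function \<open>J (q x)\<close> the boundary value has the Laplace transform \<open>1 / (b + q\<^sup>\<alpha>)\<close>, so it is
  \<open>exp (- q\<^sup>\<alpha> s)\<close> for almost every \<open>s\<close>. Inserted into \<open>laplace_reflected_mean\<close>, this gives the Laplace transform in
  the starting point at every time.\<close>

theorem reflected_mean_mittag_leffler:
  assumes q: "0 < q" and t: "0 < t"
  shows "AE x in leb_pos. reflected_mean (\<lambda>x. mittag_leffler \<alpha> (q * x)) t x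
    = exp (- (q powr \<alpha>) * t) * mittag_leffler \<alpha> (q * x)"
proof -
  let ?f = "\<lambda>x. mittag_leffler \<alpha> (q * x)" and ?\<theta> = "q powr \<alpha>"
  obtain B L where f: "bounded_lipschitz ?f B L" by (rule bounded_lipschitz_mittag_leffler)
  interpret f: bounded_lipschitz ?f B L by fact
  have \<theta>: "0 < ?\<theta>" using q by simp
  have a0: "(LINT x|leb_pos. exp (- \<beta> * x) * ?f x) = \<beta> powr (\<alpha> - 1) / (\<beta> powr \<alpha> + ?\<theta>)" if "0 < \<beta>" for \<beta>
    by (rule laplace_mittag_leffler_scale[OF \<alpha> that q])
  have at0: "AE s in leb_pos. reflected_mean ?f s 0 = exp (- ?\<theta> * s)"
  proof (rule laplace_unique_real[where B = "max B 1"])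
    show "(\<lambda>s. reflected_mean ?f s 0) \<in> borel_measurable leb_pos" by (rule measurable_reflected_mean(1)[OF f])
    show "(\<lambda>s. exp (- ?\<theta> * s)) \<in> borel_measurable leb_pos" by (rule borel_measurable_leb_pos) measurable
    show "\<bar>reflected_mean ?f s 0\<bar> \<le> max B 1" if "0 < s" for s
      using abs_reflected_mean_le[OF f, of 0 s] that by (simp add: le_max_iff_disj)
    show "\<bar>exp (- ?\<theta> * s)\<bar> \<le> max B 1" if "0 < s" for s
      using \<theta> that by (simp add: le_max_iff_disj)
    fix b :: real assume b: "0 < b"
    define \<beta> where "\<beta> = b powr (1 / \<alpha>)"
    have \<beta>: "0 < \<beta>" "\<beta> powr \<alpha> = b" using b \<alpha> by (auto simp: \<beta>_def powr_powr)
    have "(LINT s|leb_pos. exp (- b * s) * reflected_mean ?f s 0) = \<beta> / b * (\<beta> powr (\<alpha> - 1) / (b + ?\<theta>))"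
      using laplace_reflected_mean_at_0[OF f \<beta>(1)] unfolding a0[OF \<beta>(1)] \<beta>(2) .
    also have "\<dots> = 1 / (b + ?\<theta>)"
    proof -
      have "\<beta> * \<beta> powr (\<alpha> - 1) = b" using \<beta> by (simp add: powr_diff)
      then show ?thesis using b by (simp add: field_simps)
    qed
    also have "\<dots> = (LINT s|leb_pos. exp (- (b + ?\<theta>) * s))"
      by (rule laplace_integrals(2)[OF add_pos_pos[OF b \<theta>], symmetric])
    also have "\<dots> = (LINT s|leb_pos. exp (- b * s) * exp (- ?\<theta> * s))"
      by (simp add: algebra_simps flip: exp_add)
    finally show "(LINT s|leb_pos. exp (- b * s) * reflected_mean ?f s 0) = (LINT s|leb_pos. exp (- b * s) * exp (- ?\<theta> * s))" .
  qed
  show ?thesis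
  proof (rule laplace_unique_real[where B = B])
    show "(\<lambda>x. reflected_mean ?f t x) \<in> borel_measurable leb_pos" using measurable_reflected_mean(2)[OF f] t by simp
    show "(\<lambda>x. exp (- ?\<theta> * t) * ?f x) \<in> borel_measurable leb_pos"
      by (intro borel_measurable_leb_pos borel_measurable_times borel_measurable_const f.measurable_borel)
    show "\<bar>reflected_mean ?f t x\<bar> \<le> B" if "0 < x" for x
      using abs_reflected_mean_le[OF f, of x t] that t by simp
    show "\<bar>exp (- ?\<theta> * t) * ?f x\<bar> \<le> B" for x
    proof -
      have "exp (- ?\<theta> * t) * \<bar>?f x\<bar> \<le> 1 * B" using \<theta> t f.bounded by (intro mult_mono) auto
      then show ?thesis by (simp add: abs_mult)
    qed
    fix \<beta> :: real assume \<beta>: "0 < \<beta>"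
    let ?b = "\<beta> powr \<alpha>"
    have b: "0 < ?b" using \<beta> by simp
    let ?I = "LINT s|leb_pos. indicat_real {..t} s * (?b * exp (- ?b * s) * reflected_mean ?f s 0)"
    have "?I = (LINT s|leb_pos. ?b / (?b + ?\<theta>) * (indicat_real {0<..t} s * ((?b + ?\<theta>) * exp (- (?b + ?\<theta>) * s))))"
    proof (rule integral_cong_AE)
      have pos: "AE s in leb_pos. 0 < s" by (rule AE_leb_pos)
      show "AE s in leb_pos. indicat_real {..t} s * (?b * exp (- ?b * s) * reflected_mean ?f s 0)
        = ?b / (?b + ?\<theta>) * (indicat_real {0<..t} s * ((?b + ?\<theta>) * exp (- (?b + ?\<theta>) * s)))"
        using at0 pos
      proof eventually_elim
        case (elim s)
        have "exp (- (?b + ?\<theta>) * s) = exp (- ?b * s) * exp (- ?\<theta> * s)" by (simp add: algebra_simps flip: exp_add)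
        moreover have "?b + ?\<theta> \<noteq> 0" using add_pos_pos[OF b \<theta>] by simp
        ultimately show ?case using elim by (simp add: indicator_def)
      qed
      have "(\<lambda>s. indicat_real {..t} s * (?b * exp (- ?b * s))) \<in> borel_measurable leb_pos"
        by (rule borel_measurable_leb_pos) measurable
      from borel_measurable_times[OF this measurable_reflected_mean(1)[OF f]]
      show "(\<lambda>s. indicat_real {..t} s * (?b * exp (- ?b * s) * reflected_mean ?f s 0)) \<in> borel_measurable leb_pos"
        by (simp add: mult.assoc)
      show "(\<lambda>s. ?b / (?b + ?\<theta>) * (indicat_real {0<..t} s * ((?b + ?\<theta>) * exp (- (?b + ?\<theta>) * s)))) \<in> borel_measurable leb_pos"
        by (rule borel_measurable_leb_pos) measurable
    qed
    also have "\<dots> = ?b / (?b + ?\<theta>) * (exp (- (?b + ?\<theta>) * 0) - exp (- (?b + ?\<theta>) * t))"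
      using t by (subst integral_mult_right_zero, subst integral_exp_Ioc(2)[OF add_pos_pos[OF b \<theta>]]) auto
    finally have I: "?I = ?b / (?b + ?\<theta>) * (1 - exp (- (?b + ?\<theta>) * t))" by simp
    define D where "D = ?b + ?\<theta>"
    define m where "m = \<beta> powr (\<alpha> - 1)"
    have bm: "?b = \<beta> * m" using \<beta> by (simp add: m_def powr_diff)
    have "exp (- t * ?b) * (LINT x|leb_pos. exp (- \<beta> * x) * reflected_mean ?f t x) = m / D - 1 / \<beta> * (?b / D * (1 - exp (- D * t)))"
      using laplace_reflected_mean[OF f \<beta> t] unfolding I a0[OF \<beta>] D_def m_def .
    also have "1 / \<beta> * (?b / D * (1 - exp (- D * t))) = m / D * (1 - exp (- D * t))"
      using \<beta> by (simp add: bm)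
    also have "m / D - m / D * (1 - exp (- D * t)) = m / D * exp (- D * t)"
      by (simp add: algebra_simps)
    also have "exp (- D * t) = exp (- t * ?b) * exp (- ?\<theta> * t)" by (simp add: D_def algebra_simps flip: exp_add)
    finally have "exp (- t * ?b) * (LINT x|leb_pos. exp (- \<beta> * x) * reflected_mean ?f t x) = exp (- t * ?b) * (exp (- ?\<theta> * t) * (m / D))"
      by (simp only: mult.left_commute mult.commute)
    then have "(LINT x|leb_pos. exp (- \<beta> * x) * reflected_mean ?f t x) = exp (- ?\<theta> * t) * (m / D)"
      by (simp only: mult_cancel_left exp_not_eq_zero simp_thms)
    also have "\<dots> = exp (- ?\<theta> * t) * (LINT x|leb_pos. exp (- \<beta> * x) * ?f x)"
      unfolding a0[OF \<beta>] D_def m_def ..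
    also have "\<dots> = (LINT x|leb_pos. exp (- \<beta> * x) * (exp (- ?\<theta> * t) * ?f x))"
      by (simp only: mult.left_commute[of _ "exp (- ?\<theta> * t)"] integral_mult_right_zero)
    finally show "(LINT x|leb_pos. exp (- \<beta> * x) * reflected_mean ?f t x) = (LINT x|leb_pos. exp (- \<beta> * x) * (exp (- ?\<theta> * t) * ?f x))" .
  qed
qed

lemma transition_op_eq_reflected_mean:
  assumes "0 < x" "0 \<le> t"
  shows "transition_op M Z t (\<lambda>x. complex_of_real (f x)) x = complex_of_real (reflected_mean f t x)"
proof -
  have "reflected_process Z x t \<omega> = cadlag_path.reflected (\<lambda>s. Z s \<omega>) x t" if "\<omega> \<in> space M" for \<omega>
    unfolding reflected_process_def using cadlag_path.reflected_path_eq[OF cadlag[OF that] assms] .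
  then have "transition_op M Z t (\<lambda>x. complex_of_real (f x)) x = (LINT \<omega>|M. complex_of_real (f (cadlag_path.reflected (\<lambda>s. Z s \<omega>) x t)))"
    unfolding transition_op_def by (intro Bochner_Integration.integral_cong) auto
  then show ?thesis by (simp add: reflected_mean_def)
qed

end

section \<open>Completeness and orthogonal complements in \<open>L\<^sup>2\<close>\<close>

lemma abs_l2_eq_iff:
  assumes "square_integrable f" "square_integrable g"
  shows "abs_l2 f = abs_l2 g \<longleftrightarrow> (AE x in leb_pos. f x = g x)"
  using Quotient3_rel[OF Quotient3_l2, of f g] assms by (auto simp: l2_rel_def)

lemma zero_l2_eq: "(0 :: l2) = abs_l2 (\<lambda>x. 0)"
  by (simp add: zero_l2_def)

lemma abs_l2_diff:
  assumes "square_integrable f" "square_integrable g"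
  shows "abs_l2 f - abs_l2 g = abs_l2 (\<lambda>x. f x - g x)"
  using assms by (intro minus_l2.abs_eq) (auto simp: l2_rel_def)

lemma l2_scale_abs: "square_integrable f \<Longrightarrow> l2_scale c (abs_l2 f) = abs_l2 (\<lambda>x. c * f x)"
  by (intro l2_scale.abs_eq) (auto simp: l2_rel_def)

lemma l2_cinner_abs:
  assumes "square_integrable f" "square_integrable g"
  shows "l2_cinner (abs_l2 f) (abs_l2 g) = (LINT x|leb_pos. f x * cnj (g x))"
  using assms by (intro l2_cinner.abs_eq) (auto simp: l2_rel_def)

lemma norm_abs_l2_square: "square_integrable f \<Longrightarrow> (norm (abs_l2 f))\<^sup>2 = (LINT x|leb_pos. (cmod (f x))\<^sup>2)"
  using Re_l2_cinner_self[of f] by (simp add: power2_norm_eq_inner inner_l2_def)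

lemma nn_integral_norm_abs_l2:
  assumes "square_integrable f"
  shows "(\<integral>\<^sup>+x. ennreal ((cmod (f x))\<^sup>2) \<partial>leb_pos) = ennreal ((norm (abs_l2 f))\<^sup>2)"
  unfolding norm_abs_l2_square[OF assms]
  using assms by (intro nn_integral_eq_integral) (auto simp: square_integrable_def)

lemma l2_cinner_add_right: "l2_cinner a (b + c) = l2_cinner a b + l2_cinner a c"
  by (subst (1 2 3) l2_cinner_commute) (simp add: l2_cinner_add_left)

lemma l2_cinner_scale_right: "l2_cinner a (l2_scale z b) = cnj z * l2_cinner a b"
  by (subst (1 2) l2_cinner_commute) (simp add: l2_cinner_scale_left)

lemma l2_cinner_diff_left: "l2_cinner (a - b) c = l2_cinner a c - l2_cinner b c"
  using l2_cinner_add_left[of "a - b" b c] by simp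

lemma l2_cinner_diff_right: "l2_cinner a (b - c) = l2_cinner a b - l2_cinner a c"
  using l2_cinner_add_right[of a "b - c" c] by simp

lemma l2_scale_diff: "l2_scale z (a - b) = l2_scale z a - l2_scale z b"
proof (cases a rule: l2_cases)
  case (1 f)
  show ?thesis
  proof (cases b rule: l2_cases)
    case (1 g)
    with \<open>square_integrable f\<close> \<open>a = abs_l2 f\<close> show ?thesis
      by (simp add: abs_l2_diff l2_scale_abs square_integrable_diff square_integrable_scale right_diff_distrib)
  qed
qed

lemma l2_eqI: 
  assumes "\<And>v. l2_cinner a v = l2_cinner b v" shows "a = b"
  using assms[of "a - b"] l2_cinner_self_eq_0[of "a - b"] by (simp add: l2_cinner_diff_left)

lemma l2_eqI_right:
  assumes "\<And>v. l2_cinner v a = l2_cinner v b" shows "a = b"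
  using assms[of "a - b"] l2_cinner_self_eq_0[of "a - b"] by (simp add: l2_cinner_diff_right)

text \<open>The Riesz-Fischer argument: along a fast subsequence the series of the weighted squares \<open>2\<^sup>k \<bar>d\<^sub>k\<bar>\<^sup>2\<close> of the increments
  is integrable, hence finite almost everywhere. So the increments decay geometrically at almost every point, and
  Fatou's lemma turns pointwise convergence into convergence in norm.\<close>

lemma l2_Cauchy_convergent:
  fixes X :: "nat \<Rightarrow> l2"
  assumes X: "Cauchy X"
  shows "convergent X"
proof -
  have "\<forall>k. \<exists>N. \<forall>m\<ge>N. \<forall>n\<ge>N. norm (X m - X n) < (1/2) ^ k"
    using X unfolding Cauchy_iff by (meson zero_less_power half_gt_zero zero_less_one)
  then obtain N where N: "\<And>k m n. N k \<le> m \<Longrightarrow> N k \<le> n \<Longrightarrow> norm (X m - X n) < (1/2) ^ k" by metis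
  \<comment> \<open>Indices along which consecutive members differ by less than \<open>(1 / 2) ^ k\<close> in norm.\<close>
  define r where "r = rec_nat (N 0) (\<lambda>k p. max (Suc p) (N (Suc k)))"
  have r0: "r 0 = N 0" and rS: "r (Suc k) = max (Suc (r k)) (N (Suc k))" for k by (simp_all add: r_def)
  have rN: "N k \<le> r k" for k by (cases k) (simp_all add: r0 rS)
  have sm: "strict_mono r" by (intro strict_monoI_Suc) (simp add: rS less_max_iff_disj)
  have close: "norm (X (r j) - X (r k)) < (1/2) ^ k" if "k \<le> j" for j k
    using that strict_mono_leD[OF sm that] rN[of k] by (intro N) auto
  have "\<forall>n. \<exists>f. square_integrable f \<and> X n = abs_l2 f" by (metis l2_cases)
  then obtain F where F: "\<And>n. square_integrable (F n)" "\<And>n. X n = abs_l2 (F n)" by metis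
  have Fm [measurable]: "F n \<in> borel_measurable leb_pos" for n using F(1) by (simp add: square_integrable_def)
  have dist: "(\<integral>\<^sup>+x. ennreal ((cmod (F (r j) x - F (r k) x))\<^sup>2) \<partial>leb_pos) \<le> ennreal ((1/4) ^ k)" if "k \<le> j" for j k
  proof -
    have "(\<integral>\<^sup>+x. ennreal ((cmod (F (r j) x - F (r k) x))\<^sup>2) \<partial>leb_pos) = ennreal ((norm (X (r j) - X (r k)))\<^sup>2)"
      unfolding F(2) abs_l2_diff[OF F(1) F(1)] by (rule nn_integral_norm_abs_l2) (intro square_integrable_diff F)
    also have "\<dots> \<le> ennreal ((1/4) ^ k)"
    proof (rule ennreal_leI)
      have "(norm (X (r j) - X (r k)))\<^sup>2 \<le> ((1/2) ^ k)\<^sup>2"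
        using close[OF that] by (intro power_mono) auto
      then show "(norm (X (r j) - X (r k)))\<^sup>2 \<le> (1/4) ^ k" by (simp add: power2_eq_square flip: power_mult_distrib)
    qed
    finally show ?thesis .
  qed
  define d where "d k x = F (r (Suc k)) x - F (r k) x" for k x
  have "(\<integral>\<^sup>+x. (\<Sum>k. ennreal (2 ^ k * (cmod (d k x))\<^sup>2)) \<partial>leb_pos) = (\<Sum>k. \<integral>\<^sup>+x. ennreal (2 ^ k * (cmod (d k x))\<^sup>2) \<partial>leb_pos)"
    by (rule nn_integral_suminf) (simp add: d_def)
  also have "\<dots> \<le> (\<Sum>k. ennreal ((1/2) ^ k))"
  proof (rule suminf_le[OF _ summableI summableI])
    fix k
    have "(\<integral>\<^sup>+x. ennreal (2 ^ k * (cmod (d k x))\<^sup>2) \<partial>leb_pos) = ennreal (2 ^ k) * (\<integral>\<^sup>+x. ennreal ((cmod (d k x))\<^sup>2) \<partial>leb_pos)"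
      by (subst nn_integral_cmult[symmetric]) (auto simp: d_def ennreal_mult)
    also have "\<dots> \<le> ennreal (2 ^ k) * ennreal ((1/4) ^ k)"
      unfolding d_def by (intro mult_left_mono dist) auto
    also have "\<dots> = ennreal ((1/2) ^ k)"
      by (simp add: ennreal_mult[symmetric] flip: power_mult_distrib)
    finally show "(\<integral>\<^sup>+x. ennreal (2 ^ k * (cmod (d k x))\<^sup>2) \<partial>leb_pos) \<le> ennreal ((1/2) ^ k)" .
  qed
  also have "\<dots> < \<infinity>"
    using summable_geometric[of "1/2 :: real"] by (subst suminf_ennreal2) auto
  finally have "(\<integral>\<^sup>+x. (\<Sum>k. ennreal (2 ^ k * (cmod (d k x))\<^sup>2)) \<partial>leb_pos) \<noteq> \<infinity>" by simp
  note finite = this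
  have dm [measurable]: "d k \<in> borel_measurable leb_pos" for k
    unfolding d_def[abs_def] by measurable
  have "AE x in leb_pos. (\<Sum>k. ennreal (2 ^ k * (cmod (d k x))\<^sup>2)) \<noteq> \<infinity>"
    by (rule nn_integral_noteq_infinite[OF _ finite]) measurable
  then have conv: "AE x in leb_pos. convergent (\<lambda>k. F (r k) x)"
  proof eventually_elim
    case (elim x)
    define C where "C = enn2real (\<Sum>k. ennreal (2 ^ k * (cmod (d k x))\<^sup>2))"
    have Cb: "2 ^ k * (cmod (d k x))\<^sup>2 \<le> C" for k
    proof -
      have "ennreal (2 ^ k * (cmod (d k x))\<^sup>2) \<le> (\<Sum>k. ennreal (2 ^ k * (cmod (d k x))\<^sup>2))"
        by (rule order_trans[OF _ sum_le_suminf[OF summableI, of "{k}"]]) auto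
      also have "\<dots> = ennreal C" unfolding C_def by (rule ennreal_enn2real[symmetric]) (use elim in \<open>simp add: less_top[symmetric]\<close>)
      finally show ?thesis by (subst (asm) ennreal_le_iff) (simp_all add: C_def)
    qed
    have C0: "0 \<le> C" by (simp add: C_def)
    have geo: "norm (d k x) \<le> sqrt C * (sqrt (1/2)) ^ k" for k
    proof -
      have "(cmod (d k x))\<^sup>2 \<le> C * (1/2) ^ k" using Cb[of k] by (simp add: power_divide field_simps)
      then have "sqrt ((cmod (d k x))\<^sup>2) \<le> sqrt (C * (1/2) ^ k)" by (rule real_sqrt_le_mono)
      then show ?thesis by (simp add: real_sqrt_mult real_sqrt_power)
    qed
    have "summable (\<lambda>k. sqrt C * (sqrt (1/2)) ^ k)"
      by (intro summable_mult summable_geometric) simp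
    then have "summable (\<lambda>k. d k x)" by (rule summable_comparison_test'[where N = 0]) (rule geo)
    then have "convergent (\<lambda>n. \<Sum>k<n. d k x)" by (simp add: summable_iff_convergent)
    moreover have "(\<Sum>k<n. d k x) = F (r n) x - F (r 0) x" for n
      unfolding d_def by (rule sum_lessThan_telescope)
    ultimately have "convergent (\<lambda>n. F (r n) x - F (r 0) x)" by simp
    from convergent_add[OF this convergent_const, of "F (r 0) x"] show ?case by simp
  qed
  define f where "f x = lim (\<lambda>k. F (r k) x)" for x
  have fm [measurable]: "f \<in> borel_measurable leb_pos"
    unfolding f_def[abs_def] by measurable
  have lim: "AE x in leb_pos. (\<lambda>k. F (r k) x) \<longlonglongrightarrow> f x"
    using conv by eventually_elim (simp add: f_def convergent_LIMSEQ_iff)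
  have fd: "(\<integral>\<^sup>+x. ennreal ((cmod (f x - F (r k) x))\<^sup>2) \<partial>leb_pos) \<le> ennreal ((1/4) ^ k)" for k
  proof -
    have "(\<integral>\<^sup>+x. ennreal ((cmod (f x - F (r k) x))\<^sup>2) \<partial>leb_pos)
       = (\<integral>\<^sup>+x. liminf (\<lambda>j. ennreal ((cmod (F (r j) x - F (r k) x))\<^sup>2)) \<partial>leb_pos)"
    proof (rule nn_integral_cong_AE)
      show "AE x in leb_pos. ennreal ((cmod (f x - F (r k) x))\<^sup>2) = liminf (\<lambda>j. ennreal ((cmod (F (r j) x - F (r k) x))\<^sup>2))"
        using lim
      proof eventually_elim
        case (elim x)
        then have "(\<lambda>j. ennreal ((cmod (F (r j) x - F (r k) x))\<^sup>2)) \<longlonglongrightarrow> ennreal ((cmod (f x - F (r k) x))\<^sup>2)"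
          by (intro tendsto_intros)
        from lim_imp_Liminf[OF _ this] show ?case by simp
      qed
    qed
    also have "\<dots> \<le> liminf (\<lambda>j. \<integral>\<^sup>+x. ennreal ((cmod (F (r j) x - F (r k) x))\<^sup>2) \<partial>leb_pos)"
      by (rule nn_integral_liminf) measurable
    also have "\<dots> \<le> liminf (\<lambda>j. ennreal ((1/4) ^ k))"
      by (rule Liminf_mono) (use dist in \<open>auto simp: eventually_sequentially\<close>)
    also have "\<dots> = ennreal ((1/4) ^ k)" by (rule Liminf_const) simp
    finally show ?thesis .
  qed
  have dsq: "square_integrable (\<lambda>x. f x - F (r k) x)" for k
    unfolding square_integrable_def
  proof
    show "integrable leb_pos (\<lambda>x. (cmod (f x - F (r k) x))\<^sup>2)"
    proof (rule integrableI_bounded)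
      show "(\<integral>\<^sup>+x. ennreal (norm ((cmod (f x - F (r k) x))\<^sup>2)) \<partial>leb_pos) < \<infinity>"
        using le_less_trans[OF fd[of k]] by simp
    qed measurable
  qed measurable
  have fsq: "square_integrable f"
    using square_integrable_add[OF dsq[of 0] F(1)[of "r 0"]] by simp
  have nd: "norm (X (r k) - abs_l2 f) \<le> (1/2) ^ k" for k
  proof -
    have "ennreal ((norm (abs_l2 f - X (r k)))\<^sup>2) \<le> ennreal ((1/4) ^ k)"
      unfolding F(2) abs_l2_diff[OF fsq F(1)] using fd[of k] by (simp add: nn_integral_norm_abs_l2[OF dsq])
    then have "(norm (abs_l2 f - X (r k)))\<^sup>2 \<le> ((1/2) ^ k)\<^sup>2"
      by (simp add: power2_eq_square flip: power_mult_distrib)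
    then have "norm (abs_l2 f - X (r k)) \<le> (1/2) ^ k" by (rule power2_le_imp_le) simp
    then show ?thesis by (simp add: norm_minus_commute)
  qed
  have "(\<lambda>k. X (r k)) \<longlonglongrightarrow> abs_l2 f"
  proof (rule LIM_zero_cancel, rule Lim_null_comparison)
    show "(\<lambda>k. (1/2 :: real) ^ k) \<longlonglongrightarrow> 0" by (rule LIMSEQ_power_zero) simp
  qed (use nd in simp)
  from Cauchy_converges_subseq[OF X sm, of "abs_l2 f"] this
  have "X \<longlonglongrightarrow> abs_l2 f" by (simp add: comp_def)
  then show ?thesis by (rule convergentI)
qed

lemma subspace_closure:
  fixes S :: "'a::real_normed_vector set"
  assumes "subspace S"
  shows "subspace (closure S)"
proof (rule subspaceI)
  show "0 \<in> closure S" using subspace_0[OF assms] closure_subset by blast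
next
  fix x y assume "x \<in> closure S" "y \<in> closure S"
  then obtain X Y where "\<And>n. X n \<in> S" "X \<longlonglongrightarrow> x" "\<And>n. Y n \<in> S" "Y \<longlonglongrightarrow> y"
    unfolding closure_sequential by blast
  then show "x + y \<in> closure S"
    unfolding closure_sequential using assms
    by (intro exI[of _ "\<lambda>n. X n + Y n"]) (auto intro: tendsto_add subspace_add)
next
  fix c :: real and x assume "x \<in> closure S"
  then obtain X where "\<And>n. X n \<in> S" "X \<longlonglongrightarrow> x"
    unfolding closure_sequential by blast
  then show "c *\<^sub>R x \<in> closure S"
    unfolding closure_sequential using assms
    by (intro exI[of _ "\<lambda>n. c *\<^sub>R X n"]) (auto intro: tendsto_scaleR subspace_scale)
qed

text \<open>The orthogonal projection onto a complete subspace: by the parallelogram law a minimising sequence for the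
  distance is a Cauchy sequence, and the difference between \<open>y\<close> and its limit is orthogonal to the subspace.\<close>

lemma complete_orthogonal_vector:
  fixes V :: "'a::real_inner set"
  assumes V: "subspace V" "\<And>X :: nat \<Rightarrow> 'a. (\<And>n. X n \<in> V) \<Longrightarrow> Cauchy X \<Longrightarrow> \<exists>l\<in>V. X \<longlonglongrightarrow> l" and y: "y \<notin> V"
  obtains w where "w \<noteq> 0" "\<And>u. u \<in> V \<Longrightarrow> inner w u = 0"
proof -
  define d where "d = infdist y V"
  have V0: "0 \<in> V" using V(1) by (rule subspace_0)
  then have ne: "V \<noteq> {}" by auto
  have dle: "d \<le> norm (y - v)" if "v \<in> V" for v
    using infdist_le[OF that, of y] by (simp add: d_def dist_norm)
  have "\<exists>v\<in>V. norm (y - v) < d + 1 / real (Suc n)" for n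
  proof (rule ccontr)
    assume "\<not> (\<exists>v\<in>V. norm (y - v) < d + 1 / real (Suc n))"
    then have "\<And>v. v \<in> V \<Longrightarrow> d + 1 / real (Suc n) \<le> dist y v" by (force simp: dist_norm)
    then have "d + 1 / real (Suc n) \<le> d"
      unfolding d_def infdist_notempty[OF ne] by (intro cINF_greatest ne) auto
    then show False by (simp add: divide_le_0_iff)
  qed
  then obtain v where v: "\<And>n. v n \<in> V" "\<And>n. norm (y - v n) < d + 1 / real (Suc n)" by metis
  have d0: "0 \<le> d" by (simp add: d_def infdist_nonneg)
  have close: "(norm (v m - v n))\<^sup>2 \<le> 2 * (norm (y - v m))\<^sup>2 + 2 * (norm (y - v n))\<^sup>2 - 4 * d\<^sup>2" for m n
  proof -
    have "(1/2) *\<^sub>R (v m + v n) \<in> V" using V(1) v(1) by (intro subspace_scale subspace_add)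
    from dle[OF this] have "d \<le> norm (y - (1/2) *\<^sub>R (v m + v n))" .
    then have "(2 * d)\<^sup>2 \<le> (norm (2 *\<^sub>R (y - (1/2) *\<^sub>R (v m + v n))))\<^sup>2"
      using d0 by (intro power_mono) auto
    also have "2 *\<^sub>R (y - (1/2) *\<^sub>R (v m + v n)) = (y - v m) + (y - v n)"
      by (simp add: algebra_simps scaleR_2)
    finally have "4 * d\<^sup>2 \<le> (norm ((y - v m) + (y - v n)))\<^sup>2" by (simp add: power_mult_distrib)
    moreover have "(norm ((y - v m) + (y - v n)))\<^sup>2 + (norm (v m - v n))\<^sup>2 = 2 * (norm (y - v m))\<^sup>2 + 2 * (norm (y - v n))\<^sup>2"
      by (simp add: power2_norm_eq_inner inner_simps inner_commute)
    ultimately show ?thesis by linarith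
  qed
  have sq: "(\<lambda>n. 2 * (d + 1 / real (Suc n))\<^sup>2 - 2 * d\<^sup>2) \<longlonglongrightarrow> 0"
  proof -
    have "(\<lambda>n. 2 * (d + 1 / real (Suc n))\<^sup>2 - 2 * d\<^sup>2) \<longlonglongrightarrow> 2 * (d + 0)\<^sup>2 - 2 * d\<^sup>2"
      by (intro tendsto_intros LIMSEQ_Suc[OF lim_1_over_n])
    then show ?thesis by simp
  qed
  have "Cauchy v"
  proof (rule metric_CauchyI)
    fix e :: real assume e: "0 < e"
    have "\<forall>\<^sub>F n in sequentially. 2 * (d + 1 / real (Suc n))\<^sup>2 - 2 * d\<^sup>2 < e\<^sup>2 / 2"
      using sq e by (intro order_tendstoD) auto
    then obtain N where N: "\<And>n. N \<le> n \<Longrightarrow> 2 * (d + 1 / real (Suc n))\<^sup>2 - 2 * d\<^sup>2 < e\<^sup>2 / 2"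
      by (auto simp: eventually_sequentially)
    have "dist (v m) (v n) < e" if "N \<le> m" "N \<le> n" for m n
    proof -
      have "(norm (y - v k))\<^sup>2 \<le> (d + 1 / real (Suc k))\<^sup>2" for k
        using v(2)[of k] by (intro power_mono) auto
      then have "(norm (v m - v n))\<^sup>2 < e\<^sup>2"
        using close[of m n] N[OF that(1)] N[OF that(2)] by (smt (verit) field_sum_of_halves)
      then show ?thesis using e power_less_imp_less_base[of "norm (v m - v n)" 2 e] by (simp add: dist_norm)
    qed
    then show "\<exists>M. \<forall>m\<ge>M. \<forall>n\<ge>M. dist (v m) (v n) < e" by blast
  qed
  then obtain l where l: "l \<in> V" "v \<longlonglongrightarrow> l"
    using V(2)[of v] v(1) by blast
  have "norm (y - l) \<le> d + 0"
  proof (rule LIMSEQ_le)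
    show "(\<lambda>n. norm (y - v n)) \<longlonglongrightarrow> norm (y - l)" by (intro tendsto_intros l)
    show "(\<lambda>n. d + 1 / real (Suc n)) \<longlonglongrightarrow> d + 0" by (intro tendsto_intros LIMSEQ_Suc[OF lim_1_over_n])
    show "\<exists>N. \<forall>n\<ge>N. norm (y - v n) \<le> d + 1 / real (Suc n)" using v(2) by (meson less_imp_le)
  qed
  then have min: "norm (y - l) \<le> norm (y - u)" if "u \<in> V" for u using dle[OF that] by simp
  show thesis
  proof (rule that)
    show "y - l \<noteq> 0" using l(1) y by auto
    fix u assume u: "u \<in> V"
    show "inner (y - l) u = 0"
    proof (cases "u = 0")
      case False
      define s where "s = inner (y - l) u / (norm u)\<^sup>2"
      have nu: "0 < (norm u)\<^sup>2" using False by simp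
      have "l + s *\<^sub>R u \<in> V" using V(1) l(1) u by (intro subspace_add subspace_scale)
      from min[OF this] have "(norm (y - l))\<^sup>2 \<le> (norm ((y - l) - s *\<^sub>R u))\<^sup>2"
        by (intro power_mono) (auto simp: algebra_simps)
      also have "\<dots> = (norm (y - l))\<^sup>2 - 2 * s * inner (y - l) u + s\<^sup>2 * (norm u)\<^sup>2"
      proof -
        have "(norm (w - s *\<^sub>R u))\<^sup>2 = (norm w)\<^sup>2 - 2 * s * inner w u + s\<^sup>2 * (norm u)\<^sup>2" for w
          unfolding power2_norm_eq_inner
          by (simp add: inner_diff_left inner_diff_right inner_commute[of u w]) (simp add: power2_eq_square algebra_simps)
        then show ?thesis .
      qed
      also have "inner (y - l) u = s * (norm u)\<^sup>2" using nu by (simp add: s_def)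
      finally have "s\<^sup>2 * (norm u)\<^sup>2 \<le> 0" by (simp add: power2_eq_square algebra_simps)
      then have "s = 0" using nu by (simp add: mult_le_0_iff)
      then show ?thesis using nu by (simp add: s_def)
    qed simp
  qed
qed

lift_definition l2_conj :: "l2 \<Rightarrow> l2" is "\<lambda>f x. cnj (f x)"
  unfolding l2_rel_def square_integrable_def
  by (auto elim: eventually_mono intro!: borel_measurable_continuous_on[where f = cnj] continuous_intros)

lemma square_integrable_cnj: "square_integrable f \<Longrightarrow> square_integrable (\<lambda>x. cnj (f x))"
  unfolding square_integrable_def
  by (auto intro!: borel_measurable_continuous_on[where f = cnj] continuous_intros)

lemma l2_conj_abs: "square_integrable f \<Longrightarrow> l2_conj (abs_l2 f) = abs_l2 (\<lambda>x. cnj (f x))"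
  by (intro l2_conj.abs_eq) (auto simp: l2_rel_def)

lemma l2_cinner_conj: "l2_cinner (l2_conj u) (l2_conj v) = cnj (l2_cinner u v)"
proof (cases u rule: l2_cases)
  case (1 f)
  note f = 1
  show ?thesis
  proof (cases v rule: l2_cases)
    case (1 g)
    have "(LINT x|leb_pos. cnj (f x) * cnj (cnj (g x))) = cnj (LINT x|leb_pos. f x * cnj (g x))"
      by (subst Bochner_Integration.integral_cnj[symmetric]) simp
    then show ?thesis using f 1 by (simp add: l2_conj_abs l2_cinner_abs square_integrable_cnj)
  qed
qed

lemma l2_conj_conj [simp]: "l2_conj (l2_conj u) = u"
  by (cases u rule: l2_cases) (simp add: l2_conj_abs square_integrable_cnj)

lemma l2_conj_scale: "l2_conj (l2_scale z u) = l2_scale (cnj z) (l2_conj u)"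
  by (cases u rule: l2_cases) (simp add: l2_conj_abs l2_scale_abs square_integrable_cnj square_integrable_scale)

lemma l2_conj_eq_0_iff: "l2_conj u = 0 \<longleftrightarrow> u = 0"
proof -
  have "l2_conj 0 = 0" by (simp add: zero_l2_eq l2_conj_abs square_integrable_zero)
  then show ?thesis by (metis l2_conj_conj)
qed

section \<open>Adjoints and the residual spectrum\<close>

context
  fixes A B :: "l2 \<Rightarrow> l2"
  assumes adj: "is_adjoint A B"
begin

lemma adjoint: "l2_cinner (A u) v = l2_cinner u (B v)"
  using adj by (simp add: is_adjoint_def)

lemma adjoint_add: "B (v + w) = B v + B w"
  by (rule l2_eqI_right) (simp add: l2_cinner_add_right flip: adjoint)

lemma adjoint_scale: "B (l2_scale c v) = l2_scale c (B v)"
  by (rule l2_eqI_right) (simp add: l2_cinner_scale_right flip: adjoint)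

lemma subspace_range_adjoint: "subspace (range (\<lambda>u. B u - l2_scale z u))"
proof (rule subspaceI)
  have B0: "B 0 = 0" using adjoint_add[of 0 0] by simp
  have z0: "l2_scale z 0 = 0" using l2_scale_diff[of z 0 0] by simp
  show "0 \<in> range (\<lambda>u. B u - l2_scale z u)" by (rule range_eqI[of _ _ 0]) (simp add: B0 z0)
next
  have sc: "l2_scale z (v + w) = l2_scale z v + l2_scale z w" for v w
    using l2_scale_diff[of z "v + w" w] by simp
  fix x y assume "x \<in> range (\<lambda>u. B u - l2_scale z u)" "y \<in> range (\<lambda>u. B u - l2_scale z u)"
  then obtain v w where "x = B v - l2_scale z v" "y = B w - l2_scale z w" by auto
  then have "x + y = B (v + w) - l2_scale z (v + w)" by (simp add: adjoint_add sc)
  then show "x + y \<in> range (\<lambda>u. B u - l2_scale z u)" by blast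
next
  have com: "l2_scale z (l2_scale c v) = l2_scale c (l2_scale z v)" for c v
    by (rule l2_eqI) (simp add: l2_cinner_scale_left)
  fix c :: real and x assume "x \<in> range (\<lambda>u. B u - l2_scale z u)"
  then obtain v where "x = B v - l2_scale z v" by auto
  then have "c *\<^sub>R x = B (l2_scale (of_real c) v) - l2_scale z (l2_scale (of_real c) v)"
    by (simp add: scaleR_l2_def l2_scale_diff adjoint_scale com)
  then show "c *\<^sub>R x \<in> range (\<lambda>u. B u - l2_scale z u)" by blast
qed

text \<open>The orthogonal complement of the range of \<open>B - z\<close> is the kernel of \<open>A\<close> minus the conjugate of \<open>z\<close>. Completeness
  provides a nonzero vector in the complement when the range is not dense.\<close>

lemma range_not_dense_iff:
  "closure (range (\<lambda>u. B u - l2_scale z u)) \<subset> UNIV \<longleftrightarrow> (\<exists>w. w \<noteq> 0 \<and> A w = l2_scale (cnj z) w)"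
proof
  let ?R = "range (\<lambda>u. B u - l2_scale z u)"
  have pair: "l2_cinner w (B u - l2_scale z u) = l2_cinner (A w - l2_scale (cnj z) w) u" for w u
    by (simp add: l2_cinner_diff_right l2_cinner_diff_left l2_cinner_scale_left l2_cinner_scale_right adjoint)
  {
    assume "closure ?R \<subset> UNIV"
    then obtain y where y: "y \<notin> closure ?R" by auto
    have c: "\<exists>l\<in>closure ?R. X \<longlonglongrightarrow> l" if "\<And>n. X n \<in> closure ?R" "Cauchy X" for X
      using l2_Cauchy_convergent[OF that(2)] closed_sequentially[OF closed_closure that(1)]
      by (auto simp: convergent_def)
    obtain w where w: "w \<noteq> 0" "\<And>u. u \<in> closure ?R \<Longrightarrow> inner w u = 0"
      using complete_orthogonal_vector[OF subspace_closure[OF subspace_range_adjoint] c y] by metis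
    have re: "Re (l2_cinner (A w - l2_scale (cnj z) w) u) = 0" for u
    proof -
      have "B u - l2_scale z u \<in> closure ?R" by (intro closure_subset[THEN subsetD]) auto
      from w(2)[OF this] show ?thesis by (simp add: inner_l2_def pair)
    qed
    have "A w - l2_scale (cnj z) w = 0"
      using re[of "A w - l2_scale (cnj z) w"] by (simp add: l2_cinner_self_eq_0)
    with w(1) show "\<exists>w. w \<noteq> 0 \<and> A w = l2_scale (cnj z) w" by auto
  }
  {
    assume "\<exists>w. w \<noteq> 0 \<and> A w = l2_scale (cnj z) w"
    then obtain w where w: "w \<noteq> 0" "A w - l2_scale (cnj z) w = 0" by auto
    have "l2_cinner 0 u = 0" for u using l2_cinner_diff_left[of 0 0 u] by simp
    then have "inner w v = 0" if "v \<in> ?R" for v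
      using that w(2) by (auto simp: inner_l2_def pair)
    moreover have "closed {v. inner w v = 0}"
      by (intro closed_Collect_eq continuous_intros)
    ultimately have "closure ?R \<subseteq> {v. inner w v = 0}" by (intro closure_minimal) auto
    then have "w \<notin> closure ?R" using w(1) by auto
    then show "closure ?R \<subset> UNIV" by auto
  }
qed

end

lemma point_spectrum_iff:
  assumes "A 0 = 0"
  shows "z \<in> point_spectrum A \<longleftrightarrow> (\<exists>w. w \<noteq> 0 \<and> A w = l2_scale z w)"
proof -
  have "l2_scale z 0 = 0" using l2_scale_diff[of z 0 0] by simp
  then have "0 \<in> op_kernel (\<lambda>u. A u - l2_scale z u)" using assms by (simp add: op_kernel_def)
  then show ?thesis by (auto simp: point_spectrum_def op_kernel_def)
qed

section \<open>The spectrum of the reflected semigroup\<close>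

locale reflected_semigroup = stable_process +
  fixes P P_hat :: "real \<Rightarrow> l2 \<Rightarrow> l2"
  assumes semigroup: "reflected_L2_semigroup M Z P"
    and adjoint: "\<And>t. 0 \<le> t \<Longrightarrow> is_adjoint (P t) (P_hat t)"
begin

definition eigenvector :: "real \<Rightarrow> l2" where
  "eigenvector q = abs_l2 (\<lambda>x. complex_of_real (mittag_leffler \<alpha> (q * x)))"

lemma square_integrable_eigenfunction:
  "0 < q \<Longrightarrow> square_integrable (\<lambda>x. complex_of_real (mittag_leffler \<alpha> (q * x)))"
  by (rule square_integrable_mittag_leffler[OF \<alpha>])

lemma eigenvector_nonzero:
  assumes q: "0 < q"
  shows "eigenvector q \<noteq> 0"
proof
  assume "eigenvector q = 0"
  then have "AE x in leb_pos. complex_of_real (mittag_leffler \<alpha> (q * x)) = 0"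
    unfolding eigenvector_def zero_l2_eq
    by (subst (asm) abs_l2_eq_iff) (use q square_integrable_eigenfunction square_integrable_zero in auto)
  then have "AE x in leb_pos. exp (- 1 * x) * mittag_leffler \<alpha> (q * x) = 0"
    by eventually_elim simp
  then have "(LINT x|leb_pos. exp (- 1 * x) * mittag_leffler \<alpha> (q * x)) = 0"
    by (rule integral_eq_zero_AE)
  moreover have "(LINT x|leb_pos. exp (- 1 * x) * mittag_leffler \<alpha> (q * x)) = 1 powr (\<alpha> - 1) / (1 powr \<alpha> + q powr \<alpha>)"
    by (rule laplace_mittag_leffler_scale[OF \<alpha> _ q]) simp
  moreover have "0 < 1 + q powr \<alpha>" using q by (simp add: add_pos_nonneg)
  ultimately show False by simp
qed

lemma tendsto_mittag_leffler_at_top: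
  assumes q: "0 < q"
  shows "((\<lambda>x. complex_of_real (mittag_leffler \<alpha> (q * x))) \<longlongrightarrow> 0) at_top"
proof -
  obtain C where C: "\<And>x. \<bar>x * mittag_leffler \<alpha> x\<bar> \<le> C" using mittag_leffler_decay[OF \<alpha>] by blast
  show ?thesis
  proof (rule Lim_null_comparison)
    show "\<forall>\<^sub>F x in at_top. norm (complex_of_real (mittag_leffler \<alpha> (q * x))) \<le> C / (q * x)"
      using eventually_gt_at_top[of 0]
    proof eventually_elim
      case (elim x)
      then have "0 < q * x" using q by simp
      from C[of "q * x"] have "q * x * \<bar>mittag_leffler \<alpha> (q * x)\<bar> \<le> C"
        unfolding abs_mult[of "q * x"] abs_of_pos[OF \<open>0 < q * x\<close>] .
      then show ?case
        unfolding norm_of_real pos_le_divide_eq[OF \<open>0 < q * x\<close>] by (simp only: mult.commute)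
    qed
    show "((\<lambda>x. C / (q * x)) \<longlongrightarrow> 0) at_top" using q by real_asymp
  qed
qed

lemma semigroup_eigenvector:
  assumes q: "0 < q" and t: "0 < t"
  shows "P t (eigenvector q) = l2_scale (complex_of_real (exp (- (q powr \<alpha>) * t))) (eigenvector q)"
proof -
  let ?J = "\<lambda>x. mittag_leffler \<alpha> (q * x)"
  let ?f = "\<lambda>x. complex_of_real (?J x)" and ?c = "complex_of_real (exp (- (q powr \<alpha>) * t))"
  have sq: "square_integrable ?f" by (rule square_integrable_eigenfunction[OF q])
  have "continuous_on UNIV ?J"
    by (rule continuous_on_compose2[OF continuous_mittag_leffler[OF \<alpha>]]) (auto intro: continuous_intros)
  then have "continuous_on {0..} ?f"
    by (intro continuous_on_of_real) (rule continuous_on_subset, auto)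
  then have cls: "l2_class (transition_op M Z t ?f) (P t (eigenvector q))"
    using semigroup t sq tendsto_mittag_leffler_at_top[OF q]
    by (auto simp: reflected_L2_semigroup_def l2_class_def eigenvector_def)
  have "AE x in leb_pos. transition_op M Z t ?f x = ?c * ?f x"
    using reflected_mean_mittag_leffler[OF q t] AE_space
  proof eventually_elim
    case (elim x)
    then have "0 < x" by (simp add: space_restrict_space)
    with elim show ?case
      using t by (simp add: transition_op_eq_reflected_mean)
  qed
  then have "abs_l2 (transition_op M Z t ?f) = abs_l2 (\<lambda>x. ?c * ?f x)"
    using cls sq by (subst abs_l2_eq_iff) (auto simp: l2_class_def intro: square_integrable_scale)
  then show ?thesis
    using cls sq by (simp add: l2_class_def eigenvector_def l2_scale_abs)
qed

text \<open>It suffices that \<open>g\<close> is orthogonal to almost every eigenvector; the exceptional \<open>q\<close> in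
  \<open>adjoint_no_eigenvector\<close> needs this.\<close>

lemma eigenvectors_total:
  assumes z: "AE q in leb_pos. l2_cinner (eigenvector q) g = 0"
  shows "g = 0"
proof (cases g rule: l2_cases)
  case (1 G)
  have "AE x in leb_pos. cnj (G x) = 0"
  proof (rule mittag_leffler_complete[OF \<alpha> square_integrable_cnj[OF 1(1)]])
    show "AE q in leb_pos. (LINT x|leb_pos. complex_of_real (mittag_leffler \<alpha> (q * x)) * cnj (G x)) = 0"
      using z AE_space
    proof eventually_elim
      case (elim q)
      then have "0 < q" by (simp add: space_restrict_space)
      with elim show ?case
        by (simp add: 1 eigenvector_def l2_cinner_abs square_integrable_eigenfunction)
    qed
  qed
  then have "AE x in leb_pos. G x = 0" by eventually_elim simp
  then show ?thesis
    using 1 by (simp add: zero_l2_eq abs_l2_eq_iff square_integrable_zero)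
qed

lemma adjoint_eigenvector:
  assumes "0 < q" "0 < t"
  shows "l2_cinner (eigenvector q) (P_hat t v) = complex_of_real (exp (- (q powr \<alpha>) * t)) * l2_cinner (eigenvector q) v"
proof -
  have "is_adjoint (P t) (P_hat t)" using adjoint assms by simp
  then have "l2_cinner (eigenvector q) (P_hat t v) = l2_cinner (P t (eigenvector q)) v"
    by (simp add: is_adjoint_def)
  then show ?thesis by (simp add: semigroup_eigenvector[OF assms] l2_cinner_scale_left)
qed

text \<open>Pairing an eigenvector of the adjoint with the eigenvectors of the semigroup shows that it is orthogonal to all of
  them, except possibly for one \<open>q\<close>, because \<open>q \<mapsto> exp (- q\<^sup>\<alpha> t)\<close> is injective.\<close>

lemma adjoint_no_eigenvector:
  assumes t: "0 < t" and eig: "P_hat t g = l2_scale z g"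
  shows "g = 0"
proof (rule eigenvectors_total)
  let ?E = "{q. 0 < q \<and> complex_of_real (exp (- (q powr \<alpha>) * t)) = cnj z}"
  have "a = b" if "a \<in> ?E" "b \<in> ?E" for a b
  proof -
    have "complex_of_real (exp (- (a powr \<alpha>) * t)) = complex_of_real (exp (- (b powr \<alpha>) * t))"
      using that by simp
    then have "a powr \<alpha> = b powr \<alpha>" using t by (simp only: of_real_eq_iff exp_inj_iff) simp
    then have "(a powr \<alpha>) powr (1 / \<alpha>) = (b powr \<alpha>) powr (1 / \<alpha>)" by simp
    then show ?thesis using that \<alpha> by (simp add: powr_powr)
  qed
  then have "?E \<subseteq> {q}" if "q \<in> ?E" for q using that by blast
  then have "finite ?E" by (cases "?E = {}") (auto intro: finite_subset)
  then have "?E \<in> null_sets lborel" by (rule finite_imp_null_set_lborel)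
  then have "AE q in lborel. q \<notin> ?E" by (rule AE_not_in)
  then have "AE q in leb_pos. q \<notin> ?E"
    by (subst AE_restrict_space_iff) (auto elim: eventually_mono)
  then show "AE q in leb_pos. l2_cinner (eigenvector q) g = 0"
    using AE_space
  proof eventually_elim
    case (elim q)
    then have q: "0 < q" "complex_of_real (exp (- (q powr \<alpha>) * t)) \<noteq> cnj z"
      by (auto simp: space_restrict_space)
    have "cnj z * l2_cinner (eigenvector q) g = complex_of_real (exp (- (q powr \<alpha>) * t)) * l2_cinner (eigenvector q) g"
      using adjoint_eigenvector[OF q(1) t, of g] by (simp only: eig l2_cinner_scale_right)
    then show ?case using q(2) by (metis mult_right_cancel)
  qed
qed

lemma conj_eigenvector: "0 < q \<Longrightarrow> l2_conj (eigenvector q) = eigenvector q"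
  by (simp add: eigenvector_def l2_conj_abs square_integrable_eigenfunction)

text \<open>Both sides have the same inner product with every eigenvector, as the eigenfunctions and the eigenvalues are
  real. Totality identifies them.\<close>

lemma adjoint_conj:
  assumes t: "0 < t"
  shows "l2_conj (P_hat t (l2_conj v)) = P_hat t v"
proof -
  have "l2_conj (P_hat t (l2_conj v)) - P_hat t v = 0"
  proof (rule eigenvectors_total)
    show "AE q in leb_pos. l2_cinner (eigenvector q) (l2_conj (P_hat t (l2_conj v)) - P_hat t v) = 0"
    proof (rule AE_leb_pos)
      fix q :: real assume q: "0 < q"
      have "l2_cinner (eigenvector q) (l2_conj (P_hat t (l2_conj v))) = cnj (l2_cinner (eigenvector q) (P_hat t (l2_conj v)))"
        using l2_cinner_conj[of "eigenvector q" "P_hat t (l2_conj v)"] by (simp only: conj_eigenvector[OF q])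
      also have "\<dots> = complex_of_real (exp (- (q powr \<alpha>) * t)) * cnj (l2_cinner (eigenvector q) (l2_conj v))"
        by (simp only: adjoint_eigenvector[OF q t] complex_cnj_mult complex_cnj_complex_of_real)
      also have "cnj (l2_cinner (eigenvector q) (l2_conj v)) = l2_cinner (eigenvector q) v"
        using l2_cinner_conj[of "eigenvector q" "l2_conj v"] by (simp only: conj_eigenvector[OF q] l2_conj_conj)
      finally show "l2_cinner (eigenvector q) (l2_conj (P_hat t (l2_conj v)) - P_hat t v) = 0"
        by (simp only: l2_cinner_diff_right adjoint_eigenvector[OF q t]) simp
    qed
  qed
  then show ?thesis by simp
qed

lemma semigroup_conj:
  assumes t: "0 < t"
  shows "P t (l2_conj u) = l2_conj (P t u)"
proof (rule l2_eqI)
  fix v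
  have adj: "l2_cinner (P t u) v = l2_cinner u (P_hat t v)" for u v
    using adjoint[of t] t by (simp add: is_adjoint_def)
  have "l2_cinner (l2_conj (P t u)) v = cnj (l2_cinner (P t u) (l2_conj v))"
    using l2_cinner_conj[of "P t u" "l2_conj v"] by simp
  also have "\<dots> = l2_cinner (l2_conj u) (l2_conj (P_hat t (l2_conj v)))"
    by (simp add: adj l2_cinner_conj)
  also have "\<dots> = l2_cinner (P t (l2_conj u)) v"
    by (simp add: adjoint_conj[OF t] adj)
  finally show "l2_cinner (P t (l2_conj u)) v = l2_cinner (l2_conj (P t u)) v" by simp
qed

lemma semigroup_0: "0 \<le> t \<Longrightarrow> P t 0 = 0"
  using semigroup
  by (auto simp: reflected_L2_semigroup_def contraction_C0_semigroup_def bounded_operator_def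
      intro: linear_0[OF bounded_linear.linear])

lemma point_spectrum_semigroup_iff:
  assumes t: "0 < t"
  shows "z \<in> point_spectrum (P t) \<longleftrightarrow> (\<exists>w. w \<noteq> 0 \<and> P t w = l2_scale (cnj z) w)"
proof -
  have conj: "\<exists>w. w \<noteq> 0 \<and> P t w = l2_scale (cnj z) w" if "w \<noteq> 0" "P t w = l2_scale z w" for w z
    using that by (intro exI[of _ "l2_conj w"]) (simp add: semigroup_conj[OF t] l2_conj_scale l2_conj_eq_0_iff)
  have "z \<in> point_spectrum (P t) \<longleftrightarrow> (\<exists>w. w \<noteq> 0 \<and> P t w = l2_scale z w)"
    using t by (intro point_spectrum_iff semigroup_0) simp
  also have "\<dots> \<longleftrightarrow> (\<exists>w. w \<noteq> 0 \<and> P t w = l2_scale (cnj z) w)"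
    using conj[of _ z] conj[of _ "cnj z"] by auto
  finally show ?thesis .
qed

lemma op_kernel_adjoint:
  assumes t: "0 < t"
  shows "op_kernel (\<lambda>u. P_hat t u - l2_scale z u) = {0}"
proof -
  have "is_adjoint (P t) (P_hat t)" using adjoint t by simp
  from adjoint_add[OF this, of 0 0] have "P_hat t 0 = 0" by simp
  moreover have "l2_scale z 0 = 0" using l2_scale_diff[of z 0 0] by simp
  ultimately show ?thesis
    using adjoint_no_eigenvector[OF t] by (auto simp: op_kernel_def)
qed

theorem spectrum:
  assumes t: "0 < t"
  shows "point_spectrum (P_hat t) = {}"
    and "residual_spectrum (P_hat t) = point_spectrum (P t)"
    and "0 < q \<Longrightarrow> complex_of_real (exp (- (q powr \<alpha>) * t)) \<in> point_spectrum (P t)"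
proof -
  show "point_spectrum (P_hat t) = {}"
    by (simp add: point_spectrum_def op_kernel_adjoint[OF t])
  have "is_adjoint (P t) (P_hat t)" using adjoint t by simp
  from range_not_dense_iff[OF this]
  show "residual_spectrum (P_hat t) = point_spectrum (P t)"
    by (auto simp: residual_spectrum_def op_kernel_adjoint[OF t] point_spectrum_semigroup_iff[OF t])
  assume "0 < q"
  then show "complex_of_real (exp (- (q powr \<alpha>) * t)) \<in> point_spectrum (P t)"
    using point_spectrum_iff[of "P t"] semigroup_0[of t] t eigenvector_nonzero[of q] semigroup_eigenvector[of q t] by auto
qed

end

theorem lemma5p1:
  fixes \<alpha> :: real
    and M :: "'a measure" and Z :: "real \<Rightarrow> 'a \<Rightarrow> real"
    and P P_hat :: "real \<Rightarrow> l2 \<Rightarrow> l2"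
  assumes "1 < \<alpha>" and "\<alpha> < 2"
    and "spectrally_negative_stable M \<alpha> Z"
    and "reflected_L2_semigroup M Z P"
    and "\<And>t. t \<ge> 0 \<Longrightarrow> is_adjoint (P t) (P_hat t)"
  shows "\<forall>t>0.
    point_spectrum (P_hat t) = {} \<and>
    (\<lambda>q. complex_of_real (exp (- (q powr \<alpha>) * t))) ` {0<..} \<subseteq> residual_spectrum (P_hat t) \<and>
    residual_spectrum (P_hat t) = point_spectrum (P t)"
proof -
  have "prob_space M"
    using assms(3) by (simp add: spectrally_negative_stable_def levy_process_def)
  then interpret reflected_semigroup M \<alpha> Z P P_hat
    using assms by (intro reflected_semigroup.intro stable_process.intro
        stable_process_axioms.intro reflected_semigroup_axioms.intro)
  show ?thesis using spectrum by auto
qed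

end
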